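(* For every integer $d\ge2$, $\frac43\le\mathfrak{q}(d)\le\frac{2}{1+2^{1-d}}$.
   Context: $\mathbb{T}^d$ is the $d$-fold torus with normalized Haar measure. $H^p(\mathbb{T}^d)$ denotes the Hardy space (for $p\ge1$: functions in $L^p(\mathbb{T}^d)$ with Fourier coefficients supported in $\mathbb{N}_0^d$; for $0<p<1$ the usual Hardy space on the polydisc). The Riesz projection is $P_+\psi=\sum_{\alpha\in\mathbb{N}_0^d}\widehat\psi(\alpha)z^\alpha$. For nontrivial $\varphi$ in some $H^p(\mathbb{T}^d)$, $\|\varphi\|_0:=\exp\left(\int_{\mathbb{T}^d}\log|\varphi|\right)$. For $1\le q\le\infty$, $\mathfrak{p}_d(q):=\sup\{p\ge0: \|P_+\psi\|_p\le\|\psi\|_q \text{ for every }\psi\in L^q(\mathbb{T}^d)\}$ if this set is nonempty, and $\mathfrak{p}_d(q):=-1$ otherwise. The minimal admissible exponent is $\mathfrak{q}(d):=\inf\{q:\mathfrak{p}_d(q)\ge0\}$. *)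

theory Defs
  imports "HOL-Analysis.Analysis"
begin

text \<open>The torus T^d is parametrised by [0,1]^d via t \<mapsto> (e^{2 pi i t_j})_j; normalized Haar
  measure becomes the product of Lebesgue measures on [0,1]. Points are functions
  nat \<Rightarrow> real (extensional outside {..<d}).\<close>

definition torus :: "nat \<Rightarrow> (nat \<Rightarrow> real) measure" where
  "torus d = PiM {..<d} (\<lambda>_. restrict_space lborel {0..1::real})"

definition chr :: "nat \<Rightarrow> (nat \<Rightarrow> int) \<Rightarrow> (nat \<Rightarrow> real) \<Rightarrow> complex" where
  "chr d \<alpha> t = cis (2 * pi * (\<Sum>j<d. of_int (\<alpha> j) * t j))"

definition fourier :: "nat \<Rightarrow> ((nat \<Rightarrow> real) \<Rightarrow> complex) \<Rightarrow> (nat \<Rightarrow> int) \<Rightarrow> complex" where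
  "fourier d \<psi> \<alpha> = (\<integral> t. \<psi> t * cnj (chr d \<alpha> t) \<partial>torus d)"

definition multi_idx :: "nat \<Rightarrow> (nat \<Rightarrow> nat) set" where
  "multi_idx d = {\<alpha>. \<forall>j\<ge>d. \<alpha> j = 0}"

text \<open>Dilation (P_+ psi)_r(z) = (P_+ psi)(r z) of the holomorphic extension of the Riesz
  projection to the polydisc, restricted to the torus, 0 \<le> r < 1.\<close>
definition riesz_dil :: "nat \<Rightarrow> ((nat \<Rightarrow> real) \<Rightarrow> complex) \<Rightarrow> real \<Rightarrow> (nat \<Rightarrow> real) \<Rightarrow> complex" where
  "riesz_dil d \<psi> r t =
     (\<Sum>\<^sub>\<infinity>\<alpha>\<in>multi_idx d. fourier d \<psi> (int \<circ> \<alpha>) * of_real (r ^ (\<Sum>j<d. \<alpha> j)) * chr d (int \<circ> \<alpha>) t)"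

definition in_Lq :: "nat \<Rightarrow> real \<Rightarrow> ((nat \<Rightarrow> real) \<Rightarrow> complex) \<Rightarrow> bool" where
  "in_Lq d q \<psi> \<longleftrightarrow> \<psi> \<in> borel_measurable (torus d) \<and>
      (\<integral>\<^sup>+ t. ennreal (cmod (\<psi> t) powr q) \<partial>torus d) < \<infinity>"

definition Lq_norm :: "nat \<Rightarrow> real \<Rightarrow> ((nat \<Rightarrow> real) \<Rightarrow> complex) \<Rightarrow> real" where
  "Lq_norm d q \<psi> = (enn2real (\<integral>\<^sup>+ t. ennreal (cmod (\<psi> t) powr q) \<partial>torus d)) powr (1 / q)"

definition int_mean :: "nat \<Rightarrow> real \<Rightarrow> ((nat \<Rightarrow> real) \<Rightarrow> complex) \<Rightarrow> ennreal" where
  "int_mean d p f = (\<integral>\<^sup>+ t. ennreal (cmod (f t) powr p) \<partial>torus d)"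

text \<open>Geometric mean ||f||_0 = exp(\<integral> log|f|), with value 0 when \<integral> log|f| = -\<infinity>
  (the positive part of log|f| is integrable for f in some L^s, s > 0).\<close>
definition geo_mean :: "nat \<Rightarrow> ((nat \<Rightarrow> real) \<Rightarrow> complex) \<Rightarrow> real" where
  "geo_mean d f =
    (let P = (\<integral>\<^sup>+ t. ennreal (max 0 (ln (cmod (f t)))) \<partial>torus d);
         N = (\<integral>\<^sup>+ t. (if f t = 0 then \<infinity> else ennreal (max 0 (- ln (cmod (f t))))) \<partial>torus d)
     in if N = \<infinity> then 0 else exp (enn2real P - enn2real N))"

text \<open>The inequality ||P_+ psi||_p \<le> c.  For p > 0: P_+ psi lies in H^p(T^d) with
  H^p (quasi-)norm sup_{0\<le>r<1} M_p((P_+psi)_r) \<le> c.  For p = 0: either P_+ psi is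
  trivial, or P_+ psi lies in some H^s (s > 0) with boundary function f (the
  L^s-limit of the dilations) and exp(\<integral> log|f|) \<le> c.\<close>
definition riesz_bound :: "nat \<Rightarrow> real \<Rightarrow> ((nat \<Rightarrow> real) \<Rightarrow> complex) \<Rightarrow> real \<Rightarrow> bool" where
  "riesz_bound d p \<psi> c \<longleftrightarrow>
    (if p > 0 then (\<forall>r\<in>{0..<1}. int_mean d p (riesz_dil d \<psi> r) \<le> ennreal (c powr p))
     else (\<forall>\<alpha>\<in>multi_idx d. fourier d \<psi> (int \<circ> \<alpha>) = 0) \<or>
          (\<exists>s>0. \<exists>f. f \<in> borel_measurable (torus d) \<and>
              (\<exists>C. \<forall>r\<in>{0..<1}. int_mean d s (riesz_dil d \<psi> r) \<le> ennreal C) \<and>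
              ((\<lambda>r. int_mean d s (\<lambda>t. riesz_dil d \<psi> r t - f t)) \<longlongrightarrow> 0) (at_left 1) \<and>
              geo_mean d f \<le> c))"

definition pd :: "nat \<Rightarrow> real \<Rightarrow> ereal" where
  "pd d q = (let S = {p::real. p \<ge> 0 \<and> (\<forall>\<psi>. in_Lq d q \<psi> \<longrightarrow> riesz_bound d p \<psi> (Lq_norm d q \<psi>))}
             in if S = {} then -1 else Sup (ereal ` S))"

definition qd :: "nat \<Rightarrow> ereal" where
  "qd d = Inf {ereal q | q. q \<ge> 1 \<and> pd d q \<ge> 0}"

end

theory Submission
  imports Defs "HOL-Complex_Analysis.Complex_Analysis" "HOL-Probability.Infinite_Product_Measure"
begin

text \<open>
Upper bound. On the circle, write the dilated projection of \<open>g\<close> as \<open>f\<close> and the Poisson integral of \<open>g\<close> as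
\<open>f + cnj k\<close> with \<open>k\<close> analytic and vanishing at the origin. If \<open>|f + cnj k| \<le> 1\<close>, then
\<open>|f|^4 \<le> 1 + Re (- 4 f k + 2 (f k)^2)\<close>, and the real part has mean zero; so the projection is a contraction from
\<open>L^\<infinity>\<close> to \<open>L^4\<close>, and by duality from \<open>L^{4/3}\<close> to \<open>L^1\<close>. Riesz-Thorin interpolation with the contraction on
\<open>L^2\<close> yields contractions from \<open>L^{Q (n + 1)}\<close> to \<open>L^{Q n}\<close>, where \<open>1 / Q n = 1/2 + 2^{-n}\<close>, and applying them
one variable at a time shows that the projection in \<open>d - 1\<close> variables is a contraction from \<open>L^{Q d}\<close> to \<open>L^1\<close>.
In the last variable the geometric mean of \<open>|P \<phi>|\<close> is at most the \<open>L^1\<close> norm of \<open>\<phi>\<close>: test \<open>\<phi>\<close> against the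
quotient of \<open>P \<phi>\<close> and an outer function of almost the same modulus. Regularising \<open>ln |f|\<close> to \<open>ln (|f| + \<epsilon>)\<close>
makes this inequality stable under the \<open>L^1\<close> limit of the dilations.

Lower bound. With \<open>w = z1 / z2\<close>, the projection truncates \<open>z1 z2 (1 - h + i \<eta> (w + 1/w) + h (w^2 + 1/w^2))\<close>,
\<open>h = \<eta>^2\<close>, to \<open>(z1 + i \<eta> z2) (z2 + i \<eta> z1)\<close>, whose geometric mean is 1, whereas the \<open>L^q\<close> norm is
\<open>1 - c h^2 + O(h^3)\<close> with \<open>c > 0\<close> precisely when \<open>q < 4/3\<close>.
\<close>

section \<open>Bounded measurable functions and the torus\<close>

text \<open>On the scale of reciprocal exponents, interpolation at parameter \<theta> sends 1/2 +
  \<theta>/4 to 1/2 + \<theta>/2: one variable doubles the excess over 1/2. Ending in L^1, with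
  excess 1/2, after d - 1 variables means starting with excess 2^{-d}.

  A contraction alone does not suffice, because the bound for p = 0 also asks for a boundary
  function. Hence a second, cruder estimate on L^4: dualised to L^{4/3} it loses a factor 2 per
  variable but keeps the exponent, and it makes the dilations Cauchy in L^1.

  Estimates are first proved for bounded functions, where integrability and Fubini are automatic,
  and for dilations r < 1, where one-variable projections are analytic across the unit circle.
  Truncation is removed at fixed r, and the limit r -> 1 comes last.

  In the lower bound the mean of |psi|^q has no term of first order in h, and the coefficient of h^2
  is (q/2) (9q/2 - 6). All p > 0 fail together with p = 0, since power means dominate the geometric
  mean.\<close>

definition bdd :: "'a measure \<Rightarrow> ('a \<Rightarrow> 'b::{real_normed_vector,second_countable_topology}) \<Rightarrow> bool" where
  "bdd M f \<longleftrightarrow> f \<in> borel_measurable M \<and> (\<exists>B. \<forall>x\<in>space M. norm (f x) \<le> B)"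

lemma bddI: "f \<in> borel_measurable M \<Longrightarrow> (\<And>x. x \<in> space M \<Longrightarrow> norm (f x) \<le> B) \<Longrightarrow> bdd M f"
  unfolding bdd_def by blast

lemma bdd_measurable[measurable_dest]: "bdd M f \<Longrightarrow> f \<in> borel_measurable M"
  by (simp add: bdd_def)

lemma bdd_bound: assumes "bdd M f" obtains B where "B \<ge> 0" "\<And>x. x \<in> space M \<Longrightarrow> norm (f x) \<le> B"
proof -
  obtain B where "\<forall>x\<in>space M. norm (f x) \<le> B" using assms by (auto simp: bdd_def)
  then have "\<And>x. x \<in> space M \<Longrightarrow> norm (f x) \<le> max B 0" by (meson max.coboundedI1)
  then show ?thesis using that[of "max B 0"] by simp
qed

lemma bdd_const[simp]: "bdd M (\<lambda>x. c)"
  by (rule bddI[of _ _ "norm c"]) auto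

lemma bdd_add: assumes "bdd M f" "bdd M g" shows "bdd M (\<lambda>x. f x + g x)"
proof -
  obtain A where A: "\<And>x. x \<in> space M \<Longrightarrow> norm (f x) \<le> A" by (rule bdd_bound[OF assms(1)]) blast
  obtain B where B: "\<And>x. x \<in> space M \<Longrightarrow> norm (g x) \<le> B" by (rule bdd_bound[OF assms(2)]) blast
  show ?thesis using assms
    by (intro bddI[of _ _ "A + B"]) (auto simp: bdd_def intro!: norm_triangle_mono A B)
qed

lemma bdd_uminus: "bdd M f \<Longrightarrow> bdd M (\<lambda>x. - f x)"
  by (simp add: bdd_def)

lemma bdd_diff: "bdd M f \<Longrightarrow> bdd M g \<Longrightarrow> bdd M (\<lambda>x. f x - g x)"
  using bdd_add[OF _ bdd_uminus, of M f g] by simp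

lemma bdd_mult:
  fixes f g :: "'a \<Rightarrow> 'b::{real_normed_algebra,second_countable_topology}"
  assumes "bdd M f" "bdd M g" shows "bdd M (\<lambda>x. f x * g x)"
proof -
  obtain A where A: "\<And>x. x \<in> space M \<Longrightarrow> norm (f x) \<le> A" "A \<ge> 0" by (rule bdd_bound[OF assms(1)]) blast
  obtain B where B: "\<And>x. x \<in> space M \<Longrightarrow> norm (g x) \<le> B" by (rule bdd_bound[OF assms(2)]) blast
  show ?thesis using assms
    by (intro bddI[of _ _ "A * B"]) (auto simp: bdd_def intro!: order.trans[OF norm_mult_ineq] mult_mono A B)
qed

lemma bdd_power2: "bdd M f \<Longrightarrow> bdd M (\<lambda>x. (f x :: 'b::{real_normed_algebra_1,second_countable_topology}) ^ n)"
  by (induction n) (auto intro: bdd_mult)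

lemma bdd_cnj: "bdd M f \<Longrightarrow> bdd M (\<lambda>x. cnj (f x))"
  unfolding bdd_def
  by (auto intro: measurable_compose[of f M borel, OF _ borel_measurable_continuous_onI[of cnj]] continuous_intros)

lemma bdd_Re: "bdd M f \<Longrightarrow> bdd M (\<lambda>x. Re (f x))"
  unfolding bdd_def by (auto intro: order_trans[OF abs_Re_le_cmod])

lemma bdd_of_real: "bdd M f \<Longrightarrow> bdd M (\<lambda>x. complex_of_real (f x))"
  by (auto simp: bdd_def)

lemma bdd_norm: "bdd M f \<Longrightarrow> bdd M (\<lambda>x. norm (f x))"
  by (auto simp: bdd_def)

lemma bdd_powr:
  assumes "bdd M f" "p \<ge> 0" shows "bdd M (\<lambda>x. norm (f x) powr p)"
proof -
  obtain A where A: "\<And>x. x \<in> space M \<Longrightarrow> norm (f x) \<le> A" "A \<ge> 0" by (rule bdd_bound[OF assms(1)]) blast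
  have [measurable]: "f \<in> borel_measurable M" using assms by (simp add: bdd_def)
  show ?thesis using assms(2)
    by (intro bddI[of _ _ "A powr p"]) (auto intro!: powr_mono2 A)
qed

lemma bdd_integrable:
  fixes f :: "'a \<Rightarrow> 'b::{banach,second_countable_topology}"
  assumes "finite_measure M" "bdd M f" shows "integrable M f"
proof -
  obtain A where A: "\<And>x. x \<in> space M \<Longrightarrow> norm (f x) \<le> A" "A \<ge> 0" by (rule bdd_bound[OF assms(2)]) blast
  show ?thesis
    by (rule finite_measure.integrable_const_bound[OF assms(1), of _ A])
       (use assms A in \<open>auto simp: bdd_def\<close>)
qed

lemma bdd_compose: "bdd N f \<Longrightarrow> g \<in> M \<rightarrow>\<^sub>M N \<Longrightarrow> bdd M (\<lambda>x. f (g x))"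
  unfolding bdd_def using measurable_compose[of g M N f borel] measurable_space[of g M N] by blast

text \<open>Integrability is not assumed: the integral of a non-integrable function is 0, and 0 is
  within the bound because \<open>B \<ge> 0\<close>.\<close>

lemma (in prob_space) integral_bound:
  fixes f :: "'a \<Rightarrow> 'b::{banach,second_countable_topology}"
  assumes "\<And>x. x \<in> space M \<Longrightarrow> norm (f x) \<le> B" "B \<ge> 0"
  shows "norm (integral\<^sup>L M f) \<le> B"
proof (cases "integrable M f")
  case True
  have "norm (integral\<^sup>L M f) \<le> (\<integral>x. norm (f x) \<partial>M)" by (rule integral_norm_bound)
  also have "\<dots> \<le> (\<integral>x. B \<partial>M)" using True assms by (intro integral_mono) auto
  finally show ?thesis by (simp add: prob_space)
qed (simp add: not_integrable_integral_eq assms)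

lemma (in prob_space) bdd_integral_snd:
  fixes f :: "'c \<Rightarrow> 'a \<Rightarrow> 'b::{banach,second_countable_topology}"
  assumes "bdd (N \<Otimes>\<^sub>M M) (\<lambda>(x, y). f x y)"
  shows "bdd N (\<lambda>x. \<integral>y. f x y \<partial>M)"
proof -
  obtain A where A: "\<And>x. x \<in> space (N \<Otimes>\<^sub>M M) \<Longrightarrow> norm (case x of (x, y) \<Rightarrow> f x y) \<le> A" "A \<ge> 0"
    by (rule bdd_bound[OF assms]) blast
  have [measurable]: "(\<lambda>(x, y). f x y) \<in> borel_measurable (N \<Otimes>\<^sub>M M)" using assms by (simp add: bdd_def)
  show ?thesis
    using A by (intro bddI[of _ _ A] borel_measurable_lebesgue_integral integral_bound)
      (auto simp: space_pair_measure)
qed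

lemma bdd_slice:
  assumes "bdd (N \<Otimes>\<^sub>M M) (\<lambda>(x, y). f x y)" "x \<in> space N"
  shows "bdd M (\<lambda>y. f x y)"
  using bdd_compose[OF assms(1), of "\<lambda>y. (x, y)" M] assms(2) by simp

lemma bdd_Fubini:
  fixes f :: "'a \<Rightarrow> 'c \<Rightarrow> 'b::{banach,second_countable_topology}"
  assumes "prob_space M" "prob_space N" "bdd (M \<Otimes>\<^sub>M N) (\<lambda>(x, y). f x y)"
  shows "(\<integral>x. (\<integral>y. f x y \<partial>N) \<partial>M) = (\<integral>y. (\<integral>x. f x y \<partial>M) \<partial>N)"
proof -
  interpret M: prob_space M by fact
  interpret N: prob_space N by fact
  interpret P: pair_prob_space M N ..
  show ?thesis
    using P.Fubini_integral[OF bdd_integrable[OF P.P.finite_measure_axioms assms(3)]] by simp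
qed

section \<open>Normalised Lebesgue measure on the unit interval and on the torus\<close>

definition circ :: "real measure" where "circ = restrict_space lborel {0..1}"

lemma space_circ[simp]: "space circ = {0..1}"
  by (simp add: circ_def space_restrict_space)

lemma prob_circ: "prob_space circ"
  by (rule prob_spaceI) (simp add: circ_def emeasure_restrict_space space_restrict_space)

interpretation circ: prob_space circ by (rule prob_circ)

lemma measurable_circ: "f \<in> borel_measurable borel \<Longrightarrow> f \<in> measurable circ borel"
  unfolding circ_def by (rule measurable_restrict_space1) simp

lemma circ_ident[measurable]: "(\<lambda>x. x) \<in> measurable circ borel"
  by (rule measurable_circ) simp

lemma continuous_bdd_circ:
  fixes f :: "real \<Rightarrow> 'b::{real_normed_vector,second_countable_topology}"
  assumes "continuous_on UNIV f" shows "bdd circ f"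
proof -
  have "compact (f ` {0..1})"
    by (rule compact_continuous_image[OF continuous_on_subset[OF assms]]) auto
  then obtain B where "\<forall>y\<in>f ` {0..1}. norm y \<le> B"
    using compact_imp_bounded bounded_iff by metis
  then have "norm (f x) \<le> B" if "x \<in> space circ" for x using that by simp
  then show ?thesis
    by (rule bddI[OF measurable_circ[OF borel_measurable_continuous_onI[OF assms]]])
qed

lemma has_integral_circ:
  fixes f :: "real \<Rightarrow> complex"
  assumes "continuous_on UNIV f" "(f has_integral I) {0..1}"
  shows "(\<integral>x. f x \<partial>circ) = I"
proof -
  have "set_integrable lborel {0..1} f"
    by (rule borel_integrable_atLeastAtMost') (rule continuous_on_subset[OF assms(1)], simp)
  then have "(f has_integral (LINT x:{0..1}|lborel. f x)) {0..1}"
    using has_integral_set_lebesgue by (metis (no_types, lifting) has_integral_iff set_borel_integral_eq_integral)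
  then have "(LINT x:{0..1}|lborel. f x) = I" using assms(2) has_integral_unique by blast
  then show ?thesis unfolding circ_def
    by (simp add: integral_restrict_space set_lebesgue_integral_def)
qed

lemma torus_eq: "torus d = PiM {..<d} (\<lambda>_. circ)"
  by (simp add: torus_def circ_def)

lemma prob_torus: "prob_space (torus d)"
  unfolding torus_eq by (rule prob_space_PiM) (rule prob_circ)

interpretation torus: prob_space "torus d" for d by (rule prob_torus)

lemma component_torus[measurable]: "j < d \<Longrightarrow> (\<lambda>t. t j) \<in> torus d \<rightarrow>\<^sub>M circ"
  unfolding torus_eq by (rule measurable_component_singleton) simp

lemma component_torus_borel[measurable]: "j < d \<Longrightarrow> (\<lambda>t. t j) \<in> torus d \<rightarrow>\<^sub>M borel"
  using measurable_compose[OF component_torus circ_ident] by simp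

lemma upd_torus:
  assumes "j < d" shows "(\<lambda>(t, u). t(j := u)) \<in> torus d \<Otimes>\<^sub>M circ \<rightarrow>\<^sub>M torus d"
proof -
  have "insert j {..<d} = {..<d}" using assms by auto
  then show ?thesis unfolding torus_eq
    using measurable_add_dim[of j "{..<d}" "\<lambda>_. circ"] by simp
qed

text \<open>Replacing one coordinate by an independent uniform variable preserves Haar measure. It
  suffices to compare boxes: the preimage puts no constraint on the old coordinate \<open>j\<close>,
  which contributes the factor 1, while the new variable supplies the factor for
  \<open>A j\<close>.\<close>

lemma distr_upd_torus:
  assumes j: "j < d"
  shows "distr (torus d \<Otimes>\<^sub>M circ) (torus d) (\<lambda>(t, u). t(j := u)) = torus d"
proof -
  interpret P: product_sigma_finite "\<lambda>_::nat. circ" 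
    by unfold_locales
  let ?U = "\<lambda>(t :: nat \<Rightarrow> real, u :: real). t(j := u)"
  let ?P = "distr (torus d \<Otimes>\<^sub>M circ) (torus d) ?U"
  have "?P = PiM {..<d} (\<lambda>_. circ)"
  proof (rule P.PiM_eqI)
    fix A :: "nat \<Rightarrow> real set" assume A: "\<And>i. i \<in> {..<d} \<Longrightarrow> A i \<in> sets circ"
    let ?A = "A(j := space circ)"
    have pre: "?U -` Pi\<^sub>E {..<d} A \<inter> space (torus d \<Otimes>\<^sub>M circ) = Pi\<^sub>E {..<d} ?A \<times> A j"
    proof (rule set_eqI)
      fix p :: "(nat \<Rightarrow> real) \<times> real"
      obtain t u where p: "p = (t, u)" by (cases p)
      have A': "x \<in> A i \<Longrightarrow> i < d \<Longrightarrow> x \<in> space circ" for x i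
        using A[of i] sets.sets_into_space[of "A i" circ] by blast
      show "p \<in> ?U -` Pi\<^sub>E {..<d} A \<inter> space (torus d \<Otimes>\<^sub>M circ) \<longleftrightarrow> p \<in> Pi\<^sub>E {..<d} ?A \<times> A j"
        (is "?L \<longleftrightarrow> ?R")
      proof
        assume ?L
        then have L: "\<And>i. i < d \<Longrightarrow> (t(j := u)) i \<in> A i" "\<And>i. i < d \<Longrightarrow> t i \<in> space circ" "t \<in> extensional {..<d}"
          unfolding p by (auto simp: space_pair_measure torus_eq space_PiM PiE_iff simp del: space_circ)
        have "t i \<in> ?A i" if "i < d" for i using L(1)[OF that] L(2)[OF that] by (cases "i = j") auto
        then show ?R unfolding p using L(1)[OF j] L(3) by (auto simp: PiE_iff)
      next
        assume ?R
        then have R: "\<And>i. i < d \<Longrightarrow> t i \<in> ?A i" "u \<in> A j" "t \<in> extensional {..<d}"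
          unfolding p by (auto simp: PiE_iff)
        have 1: "t i \<in> space circ" if "i < d" for i using R(1)[OF that] A'[of _ i] that by (cases "i = j") auto
        have 2: "(t(j := u)) i \<in> A i" if "i < d" for i using R(1)[OF that] R(2) by (cases "i = j") auto
        have 3: "t(j := u) \<in> extensional {..<d}" using R(3) j by (auto simp: extensional_def)
        show ?L unfolding p using 1 2 3 R(3) A'[OF R(2) j]
          by (auto simp: space_pair_measure torus_eq space_PiM PiE_iff simp del: space_circ)
      qed
    qed
    have jj: "j \<in> {..<d}" using j by simp
    have As: "i \<in> {..<d} \<Longrightarrow> ?A i \<in> sets circ" for i using A[of i] sets.top[of circ] by (simp del: space_circ)
    have A': "Pi\<^sub>E {..<d} ?A \<in> sets (torus d)"
      unfolding torus_eq by (rule sets_PiM_I_finite[OF finite_lessThan As])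
    have "emeasure (?P) (Pi\<^sub>E {..<d} A)
        = emeasure (torus d \<Otimes>\<^sub>M circ) (Pi\<^sub>E {..<d} ?A \<times> A j)"
      using A by (subst emeasure_distr[OF upd_torus[OF j]]) (auto simp only: pre[unfolded torus_eq] torus_eq finite_lessThan intro!: sets_PiM_I_finite)
    also have "\<dots> = emeasure (torus d) (Pi\<^sub>E {..<d} ?A) * emeasure circ (A j)"
      by (rule circ.emeasure_pair_measure_Times[OF A' A[OF jj]])
    also have "emeasure (torus d) (Pi\<^sub>E {..<d} ?A) = (\<Prod>i<d. emeasure circ (?A i))"
      unfolding torus_eq by (rule P.emeasure_PiM) (simp_all only: finite_lessThan As)
    also have "\<dots> = emeasure circ (?A j) * (\<Prod>i\<in>{..<d} - {j}. emeasure circ (?A i))"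
      by (rule prod.remove) (use j in auto)
    also have "emeasure circ (?A j) = 1" by (simp only: fun_upd_same circ.emeasure_space_1)
    also have "(\<Prod>i\<in>{..<d} - {j}. emeasure circ (?A i)) = (\<Prod>i\<in>{..<d} - {j}. emeasure circ (A i))"
      by (rule prod.cong) auto
    also have "1 * (\<Prod>i\<in>{..<d} - {j}. emeasure circ (A i)) * emeasure circ (A j) = (\<Prod>i<d. emeasure circ (A i))"
      using prod.remove[OF finite_lessThan jj, of "\<lambda>i. emeasure circ (A i)"] by (simp add: mult.commute)
    finally show "emeasure (?P) (Pi\<^sub>E {..<d} A)
        = (\<Prod>i<d. emeasure circ (A i))" .
  qed (auto simp: torus_eq)
  then show ?thesis by (simp add: torus_eq)
qed

text \<open>Fubini in the form used by every argument that treats one variable at a time: both outer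
  integrals run over the whole torus, so coordinate \<open>j\<close> is averaged without splitting
  the product space.\<close>

lemma torus_average:
  fixes F :: "(nat \<Rightarrow> real) \<Rightarrow> 'b::{banach,second_countable_topology}"
  assumes j: "j < d" and F: "bdd (torus d) F"
  shows "(\<integral>t. F t \<partial>torus d) = (\<integral>t. (\<integral>u. F (t(j := u)) \<partial>circ) \<partial>torus d)"
proof -
  interpret P: pair_prob_space "torus d" circ ..
  have b: "bdd (torus d \<Otimes>\<^sub>M circ) (\<lambda>(t, u). F (t(j := u)))"
    using bdd_compose[OF F upd_torus[OF j]] by (simp add: case_prod_unfold)
  have "(\<integral>t. F t \<partial>torus d) = (\<integral>t. F t \<partial>distr (torus d \<Otimes>\<^sub>M circ) (torus d) (\<lambda>(t, u). t(j := u)))"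
    by (simp add: distr_upd_torus[OF j])
  also have "\<dots> = (\<integral>x. (case x of (t, u) \<Rightarrow> F (t(j := u))) \<partial>(torus d \<Otimes>\<^sub>M circ))"
    using bdd_measurable[OF F] by (subst integral_distr[OF upd_torus[OF j]]) (simp_all add: case_prod_unfold)
  also have "\<dots> = (\<integral>t. (\<integral>u. F (t(j := u)) \<partial>circ) \<partial>torus d)"
    using P.integral_fst'[OF bdd_integrable[OF P.P.finite_measure_axioms b]] by simp
  finally show ?thesis .
qed

lemma bdd_upd_torus:
  assumes "j < d" "bdd (torus d) F"
  shows "bdd (torus d \<Otimes>\<^sub>M circ) (\<lambda>(t, u). F (t(j := u)))"
  using bdd_compose[OF assms(2) upd_torus[OF assms(1)]] by (simp add: case_prod_unfold)

section \<open>Cauchy's formula on the unit circle\<close>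

definition cis2pi :: "real \<Rightarrow> complex" where "cis2pi t = cis (2 * pi * t)"

lemma norm_cis2pi[simp]: "cmod (cis2pi t) = 1" by (simp add: cis2pi_def)
lemma cis2pi_nz[simp]: "cis2pi t \<noteq> 0" by (simp add: cis2pi_def)
lemma cnj_cis2pi: "cnj (cis2pi t) = cis2pi (- t)" by (simp add: cis2pi_def cis_cnj)
lemma cis2pi_diff: "cis2pi (s - t) = cis2pi s * cis2pi (- t)" by (simp add: cis2pi_def cis_mult algebra_simps)
lemma cis2pi_minus: "cis2pi (- t) = inverse (cis2pi t)" by (simp add: cis2pi_def)
lemma cis2pi_add: "cis2pi (s + t) = cis2pi s * cis2pi t" by (simp add: cis2pi_def cis_mult algebra_simps)
lemma continuous_cis2pi[continuous_intros]: "continuous_on S f \<Longrightarrow> continuous_on S (\<lambda>x. cis2pi (f x))"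
  unfolding cis2pi_def by (intro continuous_intros)
lemma measurable_cis2pi[measurable]: "cis2pi \<in> borel_measurable borel"
  by (rule borel_measurable_continuous_onI) (intro continuous_intros)

lemma one_minus_cis2pi_nz: "cmod a < 1 \<Longrightarrow> 1 - a * cis2pi t \<noteq> 0"
  by (metis eq_iff_diff_eq_0 mult.right_neutral norm_cis2pi norm_mult norm_one order_less_irrefl)

text \<open>On the circle dz / (z - a) equals 2 pi i dt / (1 - a cnj z), so Cauchy's formula becomes
  integration against the Szego kernel. Analyticity on a disc of radius \<open>R > 1\<close> avoids
  boundary values.\<close>

lemma circle_cauchy:
  assumes H: "H holomorphic_on ball 0 R" and R: "R > 1" and a: "cmod a < 1"
  shows "(\<integral>t. H (cis2pi t) / (1 - a * cis2pi (- t)) \<partial>circ) = H a"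
proof -
  have "((\<lambda>u. H u / (u - a)) has_contour_integral 2 * of_real pi * \<i> * H a) (circlepath 0 1)"
    by (rule Cauchy_integral_circlepath_simple) (use R a in \<open>auto intro: holomorphic_on_subset[OF H]\<close>)
  then have "((\<lambda>t. H (cis2pi t) / (cis2pi t - a) * (2 * of_real pi * \<i> * cis2pi t)) has_integral 2 * of_real pi * \<i> * H a) {0..1}"
    unfolding has_contour_integral vector_derivative_circlepath
    by (simp add: cis2pi_def circlepath cis_conv_exp mult_ac)
  then have "((\<lambda>t. inverse (2 * of_real pi * \<i>) * (H (cis2pi t) / (cis2pi t - a) * (2 * of_real pi * \<i> * cis2pi t)))
      has_integral inverse (2 * of_real pi * \<i>) * (2 * of_real pi * \<i> * H a)) {0..1}"
    by (rule has_integral_mult_right)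
  moreover have "inverse (2 * of_real pi * \<i>) * (H (cis2pi t) / (cis2pi t - a) * (2 * of_real pi * \<i> * cis2pi t))
      = H (cis2pi t) / (1 - a * cis2pi (- t))" for t
  proof -
    have "cis2pi t - a \<noteq> 0" using a by (metis eq_iff_diff_eq_0 norm_cis2pi order_less_irrefl)
    moreover have "1 - a * cis2pi (- t) \<noteq> 0" using one_minus_cis2pi_nz[OF a] .
    ultimately show ?thesis by (simp add: cis2pi_minus field_simps)
  qed
  moreover have "inverse (2 * of_real pi * \<i>) * (2 * of_real pi * \<i> * H a) = H a"
    by (simp add: field_simps)
  ultimately have "((\<lambda>t. H (cis2pi t) / (1 - a * cis2pi (- t))) has_integral H a) {0..1}"
    by (simp only:)
  moreover have "continuous_on UNIV (\<lambda>t. H (cis2pi t) / (1 - a * cis2pi (- t)))"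
    using R one_minus_cis2pi_nz[OF a]
    by (intro continuous_intros continuous_on_compose2[OF holomorphic_on_imp_continuous_on[OF H]]) auto
  ultimately show ?thesis by (rule has_integral_circ[rotated])
qed

lemma circle_mean:
  assumes "H holomorphic_on ball 0 R" "R > 1"
  shows "(\<integral>t. H (cis2pi t) \<partial>circ) = H 0"
  using circle_cauchy[OF assms, of 0] by simp

text \<open>The analytic function on the disc whose Taylor coefficients are the Fourier coefficients
  of \<open>g\<close> of non-negative index, that is, the one-variable Riesz projection before
  boundary values are taken.\<close>

definition cauchy_trans :: "(real \<Rightarrow> complex) \<Rightarrow> complex \<Rightarrow> complex" where
  "cauchy_trans g z = (\<integral>u. g u / (1 - z * cis2pi (- u)) \<partial>circ)"

lemma cauchy_trans_sums:
  assumes g: "bdd circ g" and z: "cmod z < 1"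
  shows "(\<lambda>n. (\<integral>u. g u * cis2pi (- u) ^ n \<partial>circ) * z ^ n) sums cauchy_trans g z"
proof -
  obtain B where B: "\<And>x. x \<in> space circ \<Longrightarrow> norm (g x) \<le> B" "B \<ge> 0" by (rule bdd_bound[OF g]) blast
  note bdd_measurable[OF g, measurable]
  have bn: "bdd circ (\<lambda>u. g u * cis2pi (- u) ^ n * z ^ n)" for n
    by (intro bdd_mult g bdd_power2 continuous_bdd_circ continuous_intros bdd_const)
  have nb: "norm (g u * cis2pi (- u) ^ n * z ^ n) \<le> B * cmod z ^ n" if "u \<in> space circ" for u n
    using B that by (simp add: norm_mult norm_power mult_right_mono)
  have sm: "summable (\<lambda>n. B * cmod z ^ n)" using z by (intro summable_mult summable_geometric) simp
  have "(\<lambda>n. (\<integral>u. g u * cis2pi (- u) ^ n * z ^ n \<partial>circ)) sums (\<integral>u. (\<Sum>n. g u * cis2pi (- u) ^ n * z ^ n) \<partial>circ)"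
  proof (rule sums_integral)
    show "integrable circ (\<lambda>u. g u * cis2pi (- u) ^ n * z ^ n)" for n
      by (rule bdd_integrable[OF circ.finite_measure_axioms bn])
    show "AE u in circ. summable (\<lambda>n. norm (g u * cis2pi (- u) ^ n * z ^ n))"
      by (intro AE_I2 summable_comparison_test'[OF sm]) (use nb in auto)
    show "summable (\<lambda>n. \<integral>u. norm (g u * cis2pi (- u) ^ n * z ^ n) \<partial>circ)"
      by (rule summable_comparison_test'[OF sm, of 0]) (intro circ.integral_bound, use nb B in \<open>auto\<close>)
  qed
  moreover have "(\<integral>u. g u * cis2pi (- u) ^ n * z ^ n \<partial>circ) = (\<integral>u. g u * cis2pi (- u) ^ n \<partial>circ) * z ^ n" for n
    by simp
  moreover have "(\<Sum>n. g u * cis2pi (- u) ^ n * z ^ n) = g u / (1 - z * cis2pi (- u))" for u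
  proof -
    have "(\<lambda>n. g u * (z * cis2pi (- u)) ^ n) sums (g u * (1 / (1 - z * cis2pi (- u))))"
      using z by (intro sums_mult geometric_sums) (simp add: norm_mult)
    then show ?thesis by (simp add: sums_iff power_mult_distrib mult_ac)
  qed
  ultimately show ?thesis by (simp add: cauchy_trans_def)
qed

lemma cauchy_trans_holomorphic: "bdd circ g \<Longrightarrow> cauchy_trans g holomorphic_on ball 0 1"
  by (rule power_series_holomorphic[where a="\<lambda>n. \<integral>u. g u * cis2pi (- u) ^ n \<partial>circ"]) (simp add: cauchy_trans_sums)

section \<open>The Szego and Poisson kernels on the circle\<close>

definition szego :: "real \<Rightarrow> real \<Rightarrow> complex" where "szego r x = 1 / (1 - of_real r * cis2pi x)"

text \<open>The dilated Riesz projection in one variable, as a convolution operator.\<close>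

definition szego_op :: "real \<Rightarrow> (real \<Rightarrow> complex) \<Rightarrow> real \<Rightarrow> complex" where
  "szego_op r g t = (\<integral>u. szego r (t - u) * g u \<partial>circ)"

text \<open>The classical kernel (1 - r^2) / |1 - r e^{2 pi i x}|^2, written through
  \<open>szego\<close> so that Poisson integrals split into an analytic and an antianalytic
  part.\<close>

definition poisson :: "real \<Rightarrow> real \<Rightarrow> real" where "poisson r x = 2 * Re (szego r x) - 1"

lemma szego_denom_nz: "0 \<le> r \<Longrightarrow> r < 1 \<Longrightarrow> 1 - complex_of_real r * cis2pi x \<noteq> 0"
  by (rule one_minus_cis2pi_nz) simp

lemma continuous_szego[continuous_intros]:
  "0 \<le> r \<Longrightarrow> r < 1 \<Longrightarrow> continuous_on S f \<Longrightarrow> continuous_on S (\<lambda>x. szego r (f x))"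
  unfolding szego_def by (intro continuous_intros ballI szego_denom_nz)

lemma measurable_szego[measurable]: "szego r \<in> borel_measurable borel"
  unfolding szego_def[abs_def] by measurable

lemma norm_szego_le:
  assumes "0 \<le> r" "r < 1" shows "cmod (szego r x) \<le> 1 / (1 - r)"
proof -
  have "1 - r \<le> cmod (1 - complex_of_real r * cis2pi x)"
    using norm_triangle_ineq2[of 1 "complex_of_real r * cis2pi x"] assms by (simp add: norm_mult)
  then show ?thesis using assms by (simp add: szego_def norm_divide frac_le)
qed

lemma szego_uminus: "szego r (- x) = cnj (szego r x)"
  by (simp add: szego_def cnj_cis2pi)

lemma poisson_uminus: "poisson r (- x) = poisson r x"
  by (simp add: poisson_def szego_uminus)

lemma szego_eq: "szego r (t - u) = 1 / (1 - (of_real r * cis2pi t) * cis2pi (- u))"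
  by (simp add: szego_def cis2pi_diff mult.assoc)

lemma szego_op_eq_cauchy_trans: "szego_op r g t = cauchy_trans g (of_real r * cis2pi t)"
  unfolding szego_op_def cauchy_trans_def szego_eq by (rule Bochner_Integration.integral_cong) auto

text \<open>The claim is Re (1 / (1 - w)) \<ge> 1/2, that is |1 - w|^2 \<le> 2 Re (1 - w), which
  rearranges to |w| \<le> 1.\<close>

lemma poisson_nonneg:
  assumes "0 \<le> r" "r < 1" shows "0 \<le> poisson r x"
proof -
  define w where "w = complex_of_real r * cis2pi x"
  have w: "cmod w < 1" using assms by (simp add: w_def norm_mult)
  have nz: "cmod (1 - w) > 0" using w by auto
  have "Re (szego r x) = Re (1 - w) / (cmod (1 - w))\<^sup>2"
    by (simp add: szego_def w_def[symmetric] Re_divide cmod_power2)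
  moreover have "(cmod (1 - w))\<^sup>2 \<le> 2 * Re (1 - w)"
  proof -
    have "(cmod w)\<^sup>2 \<le> 1" using w by (simp add: abs_square_le_1)
    then show ?thesis unfolding cmod_power2 by (simp add: power2_eq_square algebra_simps)
  qed
  moreover have "0 < (cmod (1 - w))\<^sup>2" using nz by simp
  ultimately have "1 / 2 \<le> Re (szego r x)" by (simp only: pos_le_divide_eq)
  then show ?thesis by (simp add: poisson_def)
qed

lemma bdd_circ_int: "bdd circ (f::real \<Rightarrow> 'b::{banach,second_countable_topology}) \<Longrightarrow> integrable circ f"
  by (rule bdd_integrable[OF circ.finite_measure_axioms])

context
  fixes r :: real
  assumes r: "0 \<le> r" "r < 1"
begin

lemma bdd_szego: "bdd circ (\<lambda>u. szego r (t - u))"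
  by (intro continuous_bdd_circ continuous_intros r)

lemma bdd_poisson: "bdd circ (\<lambda>u. poisson r (t - u))"
  unfolding poisson_def by (intro bdd_diff bdd_mult bdd_Re bdd_szego bdd_const)

lemma int_szego: "(\<integral>u. szego r (t - u) \<partial>circ) = 1"
  using circle_cauchy[of "\<lambda>_. 1" 2 "of_real r * cis2pi t"] r by (simp add: szego_eq norm_mult)

lemma int_poisson: "(\<integral>u. poisson r (t - u) \<partial>circ) = 1"
proof -
  have "(\<integral>u. Re (szego r (t - u)) \<partial>circ) = Re (\<integral>u. szego r (t - u) \<partial>circ)"
    by (rule integral_Re[OF bdd_integrable[OF circ.finite_measure_axioms bdd_szego]])
  then show ?thesis unfolding poisson_def
    by (simp add: int_szego bdd_integrable[OF circ.finite_measure_axioms bdd_Re[OF bdd_szego]] circ.prob_space[unfolded space_circ])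
qed

lemma int_pois': "(\<integral>t. poisson r (t - u) \<partial>circ) = 1"
  using int_poisson[of u] by (simp add: poisson_uminus[of r "u - _", simplified])

definition poisson_op :: "(real \<Rightarrow> complex) \<Rightarrow> real \<Rightarrow> complex" where
  "poisson_op g t = (\<integral>u. of_real (poisson r (t - u)) * g u \<partial>circ)"

definition poisson_avg :: "(real \<Rightarrow> real) \<Rightarrow> real \<Rightarrow> real" where
  "poisson_avg h t = (\<integral>u. poisson r (t - u) * h u \<partial>circ)"

lemma bdd_poisson2: "bdd (circ \<Otimes>\<^sub>M circ) (\<lambda>(t, u). poisson r (t - u))"
proof -
  have "norm (poisson r x) \<le> 2 * (1 / (1 - r)) + 1" for x
    using norm_szego_le[OF r, of x] abs_Re_le_cmod[of "szego r x"] unfolding poisson_def by auto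
  then show ?thesis unfolding poisson_def by (intro bddI) (measurable, auto)
qed

lemma poisson_avg_mean:
  assumes h: "bdd circ h" shows "(\<integral>t. poisson_avg h t \<partial>circ) = (\<integral>u. h u \<partial>circ)"
proof -
  have "bdd (circ \<Otimes>\<^sub>M circ) (\<lambda>(t, u). poisson r (t - u) * h u)"
    using bdd_mult[OF bdd_poisson2 bdd_compose[OF h measurable_snd[of circ circ]]] by (simp add: case_prod_unfold)
  then have "(\<integral>t. poisson_avg h t \<partial>circ) = (\<integral>u. (\<integral>t. poisson r (t - u) * h u \<partial>circ) \<partial>circ)"
    unfolding poisson_avg_def by (rule bdd_Fubini[OF prob_circ prob_circ])
  then show ?thesis by (simp add: int_pois')
qed

lemma bdd_poisson_avg: assumes h: "bdd circ h" shows "bdd circ (poisson_avg h)"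
proof -
  have "bdd (circ \<Otimes>\<^sub>M circ) (\<lambda>(t, u). poisson r (t - u) * h u)"
    using bdd_mult[OF bdd_poisson2 bdd_compose[OF h measurable_snd[of circ circ]]] by (simp add: case_prod_unfold)
  then show ?thesis unfolding poisson_avg_def by (rule circ.bdd_integral_snd)
qed

lemma norm_poisson_op_le:
  assumes "bdd circ g" shows "cmod (poisson_op g t) \<le> poisson_avg (\<lambda>u. cmod (g u)) t"
proof -
  have "cmod (poisson_op g t) \<le> (\<integral>u. cmod (of_real (poisson r (t - u)) * g u) \<partial>circ)"
    unfolding poisson_op_def by (rule integral_norm_bound)
  then show ?thesis unfolding poisson_avg_def using poisson_nonneg[OF r] by (simp add: norm_mult)
qed

lemma poisson_avg_mono:
  assumes "bdd circ g" "bdd circ h" "\<And>u. u \<in> space circ \<Longrightarrow> g u \<le> h u"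
  shows "poisson_avg g t \<le> poisson_avg h t"
  unfolding poisson_avg_def
  by (rule integral_mono) (use assms poisson_nonneg[OF r] in \<open>auto intro!: bdd_circ_int bdd_mult bdd_poisson mult_left_mono\<close>)

lemma poisson_avg_const: "poisson_avg (\<lambda>_. c) t = c"
  unfolding poisson_avg_def by (simp add: int_poisson)

text \<open>The variance of \<open>h\<close> under the probability density
  \<open>poisson r (t - u)\<close> is non-negative.\<close>

lemma poisson_avg_square:
  assumes h: "bdd circ h" shows "(poisson_avg h t)\<^sup>2 \<le> poisson_avg (\<lambda>u. (h u)\<^sup>2) t"
proof -
  define m where "m = poisson_avg h t"
  have "0 \<le> (\<integral>u. poisson r (t - u) * (h u - m)\<^sup>2 \<partial>circ)"
    by (intro integral_nonneg_AE AE_I2) (simp add: poisson_nonneg[OF r])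
  also have "\<dots> = (\<integral>u. poisson r (t - u) * (h u)\<^sup>2 - 2 * m * (poisson r (t - u) * h u) + m\<^sup>2 * poisson r (t - u) \<partial>circ)"
    by (rule Bochner_Integration.integral_cong) (auto simp: power2_eq_square algebra_simps)
  also have "\<dots> = poisson_avg (\<lambda>u. (h u)\<^sup>2) t - 2 * m * m + m\<^sup>2"
    by (simp add: bdd_circ_int bdd_mult bdd_poisson bdd_power2 h bdd_diff poisson_avg_def m_def int_poisson)
  finally show ?thesis by (simp add: m_def power2_eq_square)
qed

text \<open>The variance inequality is used once for the square and twice for the fourth power;
  integrating in \<open>t\<close> then removes the Poisson average, which preserves the
  mean.\<close>

lemma poisson_op_mean2:
  assumes g: "bdd circ g" shows "(\<integral>t. (cmod (poisson_op g t))\<^sup>2 \<partial>circ) \<le> (\<integral>u. (cmod (g u))\<^sup>2 \<partial>circ)"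
    and "(\<integral>t. (cmod (poisson_op g t))^4 \<partial>circ) \<le> (\<integral>u. (cmod (g u))^4 \<partial>circ)"
proof -
  note b = bdd_norm[OF g] bdd_power2[OF bdd_norm[OF g]]
  have 2: "(cmod (poisson_op g t))\<^sup>2 \<le> poisson_avg (\<lambda>u. (cmod (g u))\<^sup>2) t" for t
    using power_mono[OF norm_poisson_op_le[OF g, of t], of 2] poisson_avg_square[OF b(1), of t] by simp
  have 4: "(cmod (poisson_op g t))^4 \<le> poisson_avg (\<lambda>u. (cmod (g u))^4) t" for t
  proof -
    have "(cmod (poisson_op g t))^4 = ((cmod (poisson_op g t))\<^sup>2)\<^sup>2" by simp
    also have "\<dots> \<le> (poisson_avg (\<lambda>u. (cmod (g u))\<^sup>2) t)\<^sup>2" using 2[of t] by (intro power_mono) auto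
    also have "\<dots> \<le> poisson_avg (\<lambda>u. ((cmod (g u))\<^sup>2)\<^sup>2) t" by (rule poisson_avg_square[OF b(2)])
    finally show ?thesis by simp
  qed
  have "(\<integral>t. (cmod (poisson_op g t))\<^sup>2 \<partial>circ) \<le> (\<integral>t. poisson_avg (\<lambda>u. (cmod (g u))\<^sup>2) t \<partial>circ)"
    by (rule integral_mono') (auto intro!: bdd_circ_int bdd_poisson_avg b order_trans[OF _ 2] simp: 2)
  then show "(\<integral>t. (cmod (poisson_op g t))\<^sup>2 \<partial>circ) \<le> (\<integral>u. (cmod (g u))\<^sup>2 \<partial>circ)" by (simp add: poisson_avg_mean b)
  have "(\<integral>t. (cmod (poisson_op g t))^4 \<partial>circ) \<le> (\<integral>t. poisson_avg (\<lambda>u. (cmod (g u))^4) t \<partial>circ)"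
    by (rule integral_mono') (auto intro!: bdd_circ_int bdd_poisson_avg b order_trans[OF _ 4] simp: 4)
  then show "(\<integral>t. (cmod (poisson_op g t))^4 \<partial>circ) \<le> (\<integral>u. (cmod (g u))^4 \<partial>circ)" by (simp add: poisson_avg_mean b)
qed

text \<open>Extends \<open>szego_op r g\<close> off the circle. Since \<open>r < 1\<close>, the
  extension is analytic beyond the closed unit disc, so that Cauchy's formula and the maximum
  principle apply directly.\<close>

definition szego_ext :: "(real \<Rightarrow> complex) \<Rightarrow> complex \<Rightarrow> complex" where "szego_ext g z = cauchy_trans g (of_real r * z)"

lemma szego_ext_cis2pi: "szego_ext g (cis2pi t) = szego_op r g t"
  by (simp add: szego_ext_def szego_op_eq_cauchy_trans)

text \<open>A radius greater than 1 for which \<open>r * ext_radius < 1\<close>; in contrast to 1/r,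
  this choice also makes sense at r = 0.\<close>

definition ext_radius :: real where "ext_radius = 2 / (1 + r)"

lemma ext_radius_gt: "ext_radius > 1" using r by (simp add: ext_radius_def)

lemma szego_ext_holomorphic: assumes g: "bdd circ g" shows "szego_ext g holomorphic_on ball 0 ext_radius"
proof -
  have "norm (complex_of_real r * z) < 1" if "norm z < ext_radius" for z
  proof -
    have "norm (complex_of_real r * z) \<le> r * ext_radius" using that r by (simp add: norm_mult mult_left_mono)
    also have "\<dots> < 1" using r by (simp add: ext_radius_def field_simps)
    finally show ?thesis .
  qed
  then have "cauchy_trans g \<circ> (\<lambda>z. of_real r * z) holomorphic_on ball 0 ext_radius"
    by (intro holomorphic_on_compose_gen[OF _ cauchy_trans_holomorphic[OF g]] holomorphic_intros) auto
  then show ?thesis by (simp add: o_def szego_ext_def[abs_def])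
qed

text \<open>The function k of the overview. The value at 0 is subtracted because the constant term
  of the Poisson integral already belongs to the analytic part.\<close>

definition conj_ext :: "(real \<Rightarrow> complex) \<Rightarrow> complex \<Rightarrow> complex" where
  "conj_ext g z = szego_ext (\<lambda>u. cnj (g u)) z - szego_ext (\<lambda>u. cnj (g u)) 0"

lemma conj_ext_holomorphic: "bdd circ g \<Longrightarrow> conj_ext g holomorphic_on ball 0 ext_radius"
  unfolding conj_ext_def by (intro holomorphic_intros szego_ext_holomorphic bdd_cnj)

text \<open>The kernel satisfies P = S + cnj S - 1, with S the Szego kernel; the term -1 accounts
  for the constant subtracted in \<open>conj_ext\<close>.\<close>

lemma poisson_op_split:
  assumes g: "bdd circ g"
  shows "poisson_op g t = szego_op r g t + cnj (conj_ext g (cis2pi t))"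
proof -
  have eq: "complex_of_real (poisson r x) = szego r x + cnj (szego r x) - 1" for x
    by (simp add: poisson_def complex_eq_iff)
  have "cnj (szego_ext (\<lambda>u. cnj (g u)) (cis2pi t)) = (\<integral>u. cnj (szego r (t - u)) * g u \<partial>circ)"
    unfolding szego_ext_cis2pi szego_op_def by (subst Bochner_Integration.integral_cnj[symmetric]) simp
  moreover have "cnj (szego_ext (\<lambda>u. cnj (g u)) 0) = (\<integral>u. g u \<partial>circ)"
    unfolding szego_ext_def cauchy_trans_def by (subst Bochner_Integration.integral_cnj[symmetric]) simp
  moreover have "poisson_op g t = (\<integral>u. szego r (t - u) * g u + cnj (szego r (t - u)) * g u - g u \<partial>circ)"
    unfolding poisson_op_def by (rule Bochner_Integration.integral_cong) (auto simp: eq algebra_simps)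
  moreover have "\<dots> = (\<integral>u. szego r (t - u) * g u \<partial>circ) + (\<integral>u. cnj (szego r (t - u)) * g u \<partial>circ) - (\<integral>u. g u \<partial>circ)"
    by (simp add: bdd_circ_int bdd_mult bdd_szego bdd_cnj g)
  ultimately show ?thesis by (simp add: conj_ext_def szego_op_def)
qed

lemma bdd_szego_op: assumes g: "bdd circ g" shows "bdd circ (szego_op r g)"
  unfolding szego_ext_cis2pi[symmetric]
  by (intro continuous_bdd_circ continuous_on_compose2[OF holomorphic_on_imp_continuous_on[OF szego_ext_holomorphic[OF g]]] continuous_intros)
     (use ext_radius_gt in auto)

lemma bdd_szego_ext_cis2pi: assumes "H holomorphic_on ball 0 ext_radius" shows "bdd circ (\<lambda>t. H (cis2pi t))"
  by (intro continuous_bdd_circ continuous_on_compose2[OF holomorphic_on_imp_continuous_on[OF assms]] continuous_intros)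
     (use ext_radius_gt in auto)

text \<open>The product extends analytically past the closed disc and vanishes at the origin because
  \<open>conj_ext\<close> does; so do its positive powers, and the mean over the circle is the value
  at 0.\<close>

lemma mean_zero:
  assumes g: "bdd circ g" and n: "n > 0"
  shows "(\<integral>t. Re ((szego_op r g t * conj_ext g (cis2pi t)) ^ n) \<partial>circ) = 0"
    and "bdd circ (\<lambda>t. Re ((szego_op r g t * conj_ext g (cis2pi t)) ^ n))"
proof -
  have h: "(\<lambda>z. (szego_ext g z * conj_ext g z) ^ n) holomorphic_on ball 0 ext_radius"
    by (intro holomorphic_intros szego_ext_holomorphic conj_ext_holomorphic g)
  have b: "bdd circ (\<lambda>t. (szego_op r g t * conj_ext g (cis2pi t)) ^ n)"
    using bdd_szego_ext_cis2pi[OF h] by (simp add: szego_ext_cis2pi)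
  show "bdd circ (\<lambda>t. Re ((szego_op r g t * conj_ext g (cis2pi t)) ^ n))" by (rule bdd_Re[OF b])
  have "(\<integral>t. (szego_op r g t * conj_ext g (cis2pi t)) ^ n \<partial>circ) = 0"
    using circle_mean[OF h ext_radius_gt] n by (simp add: szego_ext_cis2pi conj_ext_def)
  then show "(\<integral>t. Re ((szego_op r g t * conj_ext g (cis2pi t)) ^ n) \<partial>circ) = 0"
    by (subst integral_Re[OF bdd_circ_int[OF b]]) simp
qed

end

text \<open>The pointwise inequalities below are polynomial inequalities in the three numbers
  \<open>a\<close>, \<open>b\<close>, \<open>x\<close>. The second identity is Re (v^2) = 2 (Re v)^2
  - |v|^2 for v = f k.\<close>

lemma norm4_eq:
  fixes f k :: complex
  defines "a \<equiv> (cmod f)\<^sup>2" and "b \<equiv> (cmod k)\<^sup>2" and "x \<equiv> 2 * Re (f * k)"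
  shows "(cmod (f + cnj k))\<^sup>2 = a + b + x" "2 * Re ((f * k)\<^sup>2) = x\<^sup>2 - 2 * (a * b)"
proof -
  show "(cmod (f + cnj k))\<^sup>2 = a + b + x"
    unfolding a_def b_def x_def cmod_power2 by (simp add: power2_eq_square algebra_simps)
  show "2 * Re ((f * k)\<^sup>2) = x\<^sup>2 - 2 * (a * b)"
    unfolding a_def b_def x_def cmod_power2 by (simp add: power2_eq_square algebra_simps)
qed

lemma norm_pow4: "(cmod f)^4 = ((cmod f)\<^sup>2)\<^sup>2"
  by simp

text \<open>The hypothesis reads a + b \<le> 1 - x. Squaring it and moving 2ab to the right turns
  x^2 into x^2 - 2ab = 2 Re ((f k)^2), and b^2 is dropped on the left.\<close>

lemma pointwise_inf:
  fixes f k :: complex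
  assumes "cmod (f + cnj k) \<le> 1"
  shows "(cmod f)^4 \<le> 1 - 4 * Re (f * k) + 2 * Re ((f * k)\<^sup>2)"
proof -
  define a b x where "a = (cmod f)\<^sup>2" and "b = (cmod k)\<^sup>2" and "x = 2 * Re (f * k)"
  note e = norm4_eq[of f k, folded a_def b_def x_def]
  have "(cmod (f + cnj k))\<^sup>2 \<le> 1" using assms by (simp add: abs_square_le_1)
  then have "a + b \<le> 1 - x" using e(1) by simp
  moreover have "0 \<le> a" "0 \<le> b" by (auto simp: a_def b_def)
  ultimately have le: "(a + b)\<^sup>2 \<le> (1 - x)\<^sup>2" by (intro power_mono) auto
  define y where "y = Re ((f * k)\<^sup>2)"
  have y: "2 * y = x\<^sup>2 - 2 * (a * b)" using e(2) by (simp only: y_def)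
  have "a\<^sup>2 + b\<^sup>2 = (a + b)\<^sup>2 - 2 * (a * b)" by (simp add: power2_eq_square algebra_simps)
  moreover have "(1 - x)\<^sup>2 = 1 - 2 * x + x\<^sup>2" by (simp add: power2_eq_square algebra_simps)
  moreover have "0 \<le> b\<^sup>2" by simp
  ultimately have "a\<^sup>2 \<le> 1 - 2 * x + 2 * y" using le y by linarith
  then show ?thesis unfolding norm_pow4 a_def[symmetric] y_def x_def by simp
qed

text \<open>From a + b = M - x one gets a^2 + 16ab \<le> 5 (M - x)^2, and 14 M^2 + 8 x^2 exceeds the
  right side by (M + x)^2 + 2 (2M + x)^2. The sharp constant is irrelevant here; 14 \<le> 2^4 gives
  the norm bound 2 on L^4.\<close>

lemma pointwise_44:
  fixes f k :: complex
  shows "(cmod f)^4 \<le> 14 * (cmod (f + cnj k))^4 + 16 * Re ((f * k)\<^sup>2)"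
proof -
  define a b x M where "a = (cmod f)\<^sup>2" and "b = (cmod k)\<^sup>2" and "x = 2 * Re (f * k)" and "M = (cmod (f + cnj k))\<^sup>2"
  note e = norm4_eq[of f k, folded a_def b_def x_def M_def]
  have ab: "a + b = M - x" using e(1) by simp
  have nn: "0 \<le> a" "0 \<le> b" by (auto simp: a_def b_def)
  have "a\<^sup>2 \<le> (a + b)\<^sup>2" using nn by (intro power_mono) auto
  then have 1: "a\<^sup>2 \<le> (M - x)\<^sup>2" by (simp add: ab)
  have "0 \<le> (a - b)\<^sup>2" by simp
  then have "4 * (a * b) \<le> (a + b)\<^sup>2" by (simp add: power2_eq_square algebra_simps)
  then have 2: "4 * (a * b) \<le> (M - x)\<^sup>2" by (simp add: ab)
  have 3: "0 \<le> (M + x)\<^sup>2" "0 \<le> (2 * M + x)\<^sup>2" by simp_all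
  have "a\<^sup>2 \<le> 14 * M\<^sup>2 + 8 * (x\<^sup>2 - 2 * (a * b))"
    using 1 2 3 unfolding power2_eq_square by (simp add: algebra_simps)
  note le = this
  define y where "y = Re ((f * k)\<^sup>2)"
  have "2 * y = x\<^sup>2 - 2 * (a * b)" using e(2) by (simp only: y_def)
  then have "8 * (x\<^sup>2 - 2 * (a * b)) = 16 * y" by simp
  then have "a\<^sup>2 \<le> 14 * M\<^sup>2 + 16 * y" using le by simp
  then show ?thesis unfolding norm_pow4 a_def[symmetric] M_def[symmetric] y_def .
qed

lemma pointwise_22:
  fixes f k :: complex
  shows "(cmod f)\<^sup>2 \<le> (cmod (f + cnj k))\<^sup>2 - 2 * Re (f * k)"
  using norm4_eq(1)[of f k] by simp

context
  fixes r :: real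
  assumes r: "0 \<le> r" "r < 1"
begin

lemma bdd_poisson_op: "bdd circ g \<Longrightarrow> bdd circ (poisson_op r g)"
proof -
  assume g: "bdd circ g"
  have "poisson_op r g = (\<lambda>t. szego_op r g t + cnj (conj_ext r g (cis2pi t)))" by (rule ext) (rule poisson_op_split[OF r g])
  then show ?thesis
    using bdd_add[OF bdd_szego_op[OF r g] bdd_cnj[OF bdd_szego_ext_cis2pi[OF r conj_ext_holomorphic[OF r g]]]] by simp
qed

text \<open>Positivity and total mass 1 of the Poisson kernel keep the Poisson integral of
  \<open>g\<close> in the closed unit disc, which is the hypothesis of
  \<open>pointwise_inf\<close>.\<close>

lemma szego_op_inf_4:
  assumes g: "bdd circ g" and le: "\<And>u. u \<in> space circ \<Longrightarrow> cmod (g u) \<le> 1"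
  shows "(\<integral>t. (cmod (szego_op r g t))^4 \<partial>circ) \<le> 1"
proof -
  let ?w = "\<lambda>t. szego_op r g t * conj_ext r g (cis2pi t)"
  have "cmod (poisson_op r g t) \<le> 1" for t
    using norm_poisson_op_le[OF r g, of t] poisson_avg_mono[OF r bdd_norm[OF g] bdd_const le, of t] poisson_avg_const[OF r, of 1 t] by simp
  then have "(cmod (szego_op r g t))^4 \<le> 1 - 4 * Re ((?w t)^1) + 2 * Re ((?w t)\<^sup>2)" for t
    using pointwise_inf[of "szego_op r g t" "conj_ext r g (cis2pi t)"] by (simp add: poisson_op_split[OF r g])
  then have "(\<integral>t. (cmod (szego_op r g t))^4 \<partial>circ) \<le> 
      (\<integral>t. 1 - 4 * Re ((?w t)^1) + 2 * Re ((?w t)\<^sup>2) \<partial>circ)"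
    by (intro integral_mono bdd_circ_int bdd_power2[OF bdd_norm[OF bdd_szego_op[OF r g]]] bdd_add bdd_diff bdd_mult[OF bdd_const] bdd_const mean_zero(2)[OF r g] zero_less_numeral zero_less_one)
  also have "\<dots> = (\<integral>t. (1::real) \<partial>circ) - 4 * (\<integral>t. Re ((?w t)^1) \<partial>circ) + 2 * (\<integral>t. Re ((?w t)\<^sup>2) \<partial>circ)"
    using bdd_circ_int[OF mean_zero(2)[OF r g, of 1]] bdd_circ_int[OF mean_zero(2)[OF r g, of 2]]
    by (simp only: Bochner_Integration.integral_add Bochner_Integration.integral_diff integral_mult_right_zero
      integrable_const circ.finite_measure_axioms finite_measure.integrable_const integrable_mult_right
      Bochner_Integration.integrable_diff zero_less_one zero_less_numeral)
  also have "\<dots> = 1" using mean_zero(1)[OF r g, of 1] mean_zero(1)[OF r g, of 2] circ.prob_space by simp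
  finally show ?thesis .
qed

lemma szego_op_44:
  assumes g: "bdd circ g"
  shows "(\<integral>t. (cmod (szego_op r g t))^4 \<partial>circ) \<le> 14 * (\<integral>u. (cmod (g u))^4 \<partial>circ)"
proof -
  let ?w = "\<lambda>t. szego_op r g t * conj_ext r g (cis2pi t)"
  note bp = bdd_power2[OF bdd_norm[OF bdd_poisson_op[OF g]]]
  have "(cmod (szego_op r g t))^4 \<le> 14 * (cmod (poisson_op r g t))^4 + 16 * Re ((?w t)\<^sup>2)" for t
    using pointwise_44[of "szego_op r g t" "conj_ext r g (cis2pi t)"] by (simp add: poisson_op_split[OF r g])
  then have "(\<integral>t. (cmod (szego_op r g t))^4 \<partial>circ) \<le> 
      (\<integral>t. 14 * (cmod (poisson_op r g t))^4 + 16 * Re ((?w t)\<^sup>2) \<partial>circ)"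
    by (intro integral_mono bdd_circ_int bdd_power2[OF bdd_norm[OF bdd_szego_op[OF r g]]] bdd_add bdd_diff bdd_mult[OF bdd_const] mean_zero(2)[OF r g] bp zero_less_numeral zero_less_one)
  also have "\<dots> = 14 * (\<integral>t. (cmod (poisson_op r g t))^4 \<partial>circ) + 16 * (\<integral>t. Re ((?w t)\<^sup>2) \<partial>circ)"
    using bdd_circ_int[OF mean_zero(2)[OF r g, of 2]] bdd_circ_int[OF bp] by simp
  finally show ?thesis using mean_zero(1)[OF r g, of 2] poisson_op_mean2(2)[OF r g] by simp
qed

lemma szego_op_22:
  assumes g: "bdd circ g"
  shows "(\<integral>t. (cmod (szego_op r g t))\<^sup>2 \<partial>circ) \<le> (\<integral>u. (cmod (g u))\<^sup>2 \<partial>circ)"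
proof -
  let ?w = "\<lambda>t. szego_op r g t * conj_ext r g (cis2pi t)"
  note bp = bdd_power2[OF bdd_norm[OF bdd_poisson_op[OF g]]]
  have "(cmod (szego_op r g t))\<^sup>2 \<le> (cmod (poisson_op r g t))\<^sup>2 - 2 * Re ((?w t)^1)" for t
    using pointwise_22[of "szego_op r g t" "conj_ext r g (cis2pi t)"] by (simp add: poisson_op_split[OF r g])
  then have "(\<integral>t. (cmod (szego_op r g t))\<^sup>2 \<partial>circ) \<le> 
      (\<integral>t. (cmod (poisson_op r g t))\<^sup>2 - 2 * Re ((?w t)^1) \<partial>circ)"
    by (intro integral_mono bdd_circ_int bdd_power2[OF bdd_norm[OF bdd_szego_op[OF r g]]] bdd_add bdd_diff bdd_mult[OF bdd_const] mean_zero(2)[OF r g] bp zero_less_numeral zero_less_one)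
  also have "\<dots> = (\<integral>t. (cmod (poisson_op r g t))\<^sup>2 \<partial>circ) - 2 * (\<integral>t. Re ((?w t)^1) \<partial>circ)"
    using bdd_circ_int[OF mean_zero(2)[OF r g, of 1]] bdd_circ_int[OF bp]
    by (simp only: Bochner_Integration.integral_diff integral_mult_right_zero integrable_mult_right zero_less_one)
  finally show ?thesis using mean_zero(1)[OF r g, of 1] poisson_op_mean2(1)[OF r g] by simp
qed

end

section \<open>Duality and the three lines theorem\<close>

text \<open>Built on the Bochner integral, hence 0 when the power is not integrable; upper bounds
  for it carry information only together with integrability, which holds for bounded functions and
  for members of L^p.\<close>

definition Lpnorm :: "'a measure \<Rightarrow> real \<Rightarrow> ('a \<Rightarrow> 'b::{real_normed_vector,second_countable_topology}) \<Rightarrow> real" where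
  "Lpnorm M p f = (\<integral>x. norm (f x) powr p \<partial>M) powr (1 / p)"

lemma Lpnorm_nonneg: "0 \<le> Lpnorm M p f"
  by (simp add: Lpnorm_def)

lemma Lpnorm_powr:
  assumes "p > 0" shows "Lpnorm M p f powr p = (\<integral>x. norm (f x) powr p \<partial>M)"
  using assms by (simp add: Lpnorm_def powr_powr integral_nonneg_AE)

lemma Lpnorm_le_iff:
  assumes "p > 0" "c \<ge> 0"
  shows "Lpnorm M p f \<le> c \<longleftrightarrow> (\<integral>x. norm (f x) powr p \<partial>M) \<le> c powr p"
proof
  assume "Lpnorm M p f \<le> c"
  then show "(\<integral>x. norm (f x) powr p \<partial>M) \<le> c powr p"
    unfolding Lpnorm_powr[OF assms(1), symmetric] using assms by (intro powr_mono2) (auto simp: Lpnorm_nonneg)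
next
  assume "(\<integral>x. norm (f x) powr p \<partial>M) \<le> c powr p"
  then have "Lpnorm M p f \<le> (c powr p) powr (1 / p)"
    unfolding Lpnorm_def using assms by (intro powr_mono2) (auto intro: integral_nonneg_AE)
  then show "Lpnorm M p f \<le> c" using assms by (simp add: powr_powr)
qed

lemma Lpnorm_cong: "(\<And>x. x \<in> space M \<Longrightarrow> norm (f x) = norm (g x)) \<Longrightarrow> Lpnorm M p f = Lpnorm M p g"
  unfolding Lpnorm_def by (metis (mono_tags, lifting) Bochner_Integration.integral_cong)

lemma Lpnorm_2: "Lpnorm M 2 f = sqrt (\<integral>x. (norm (f x))\<^sup>2 \<partial>M)"
  by (simp add: Lpnorm_def powr_half_sqrt integral_nonneg_AE)

lemma Lpnorm_4_powr: "(\<integral>x. norm (f x) powr 4 \<partial>M) = (\<integral>x. (norm (f x))^4 \<partial>M)"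
  by simp

context prob_space begin

lemma bdd_int: "bdd M (f::'a \<Rightarrow> 'b::{banach,second_countable_topology}) \<Longrightarrow> integrable M f"
  by (rule bdd_integrable[OF finite_measure_axioms])

lemma Lpnorm_eq_0_AE:
  assumes "bdd M f" "p > 0" "Lpnorm M p f = 0" shows "AE x in M. f x = 0"
proof -
  have "(\<integral>x. norm (f x) powr p \<partial>M) = 0"
    using assms by (simp add: Lpnorm_def)
  then have "AE x in M. norm (f x) powr p = 0"
    using integral_nonneg_eq_0_iff_AE[OF bdd_int[OF bdd_powr[OF assms(1)]], of p] assms(2) by simp
  then show ?thesis by (rule AE_mp) (auto simp: powr_eq_0_iff)
qed

lemma AE_0_Lpnorm: "AE x in M. f x = 0 \<Longrightarrow> bdd M f \<Longrightarrow> p > 0 \<Longrightarrow> Lpnorm M p f = 0"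
proof -
  assume a: "AE x in M. f x = 0" and b: "bdd M f" "p > 0"
  have "(\<integral>x. norm (f x) powr p \<partial>M) = (\<integral>x. 0 \<partial>M)"
    by (rule integral_cong_AE) (use a b in \<open>auto intro: bdd_measurable bdd_powr\<close>)
  then show ?thesis using b by (simp add: Lpnorm_def)
qed

text \<open>After division by the norms, Young's inequality integrates to 1/a + 1/b = 1. A vanishing
  norm cannot be divided by, but then the product is zero almost everywhere.\<close>

lemma hoelder:
  fixes f g :: "'a \<Rightarrow> complex"
  assumes f: "bdd M f" and g: "bdd M g" and ab: "a > 1" "b > 1" "1 / a + 1 / b = 1"
  shows "cmod (\<integral>x. f x * g x \<partial>M) \<le> Lpnorm M a f * Lpnorm M b g"
proof (cases "Lpnorm M a f = 0 \<or> Lpnorm M b g = 0")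
  case True
  then have "AE x in M. f x * g x = 0"
    using Lpnorm_eq_0_AE[OF f, of a] Lpnorm_eq_0_AE[OF g, of b] ab by (auto elim: AE_mp)
  then have "(\<integral>x. f x * g x \<partial>M) = (\<integral>x. 0 \<partial>M)"
    by (intro integral_cong_AE) (use f g in \<open>auto intro: bdd_measurable bdd_mult\<close>)
  then show ?thesis using True by (auto simp: Lpnorm_nonneg)
next
  case False
  define c d where "c = Lpnorm M a f" and "d = Lpnorm M b g"
  have pos: "c > 0" "d > 0" using False Lpnorm_nonneg[of M a f] Lpnorm_nonneg[of M b g] by (auto simp: c_def d_def)
  have pw: "c powr a = (\<integral>x. cmod (f x) powr a \<partial>M)" "d powr b = (\<integral>x. cmod (g x) powr b \<partial>M)"
    using ab by (auto simp: c_def d_def Lpnorm_powr)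
    let ?Y = "\<lambda>x. inverse (a * c powr a) * cmod (f x) powr a + inverse (b * d powr b) * cmod (g x) powr b"
  have "cmod (\<integral>x. f x * g x \<partial>M) \<le> (\<integral>x. cmod (f x * g x) \<partial>M)" by (rule integral_norm_bound)
  also have "\<dots> \<le> (\<integral>x. c * d * (?Y x) \<partial>M)"
  proof (rule integral_mono)
    show "integrable M (\<lambda>x. cmod (f x * g x))" by (intro bdd_int bdd_norm bdd_mult f g)
    show "integrable M (\<lambda>x. c * d * (?Y x))"
      by (intro bdd_int bdd_mult[OF bdd_const] bdd_add bdd_powr f g) (use ab in auto)
    fix x
    have "(cmod (f x) / c) * (cmod (g x) / d) \<le> (cmod (f x) / c) powr a / a + (cmod (g x) / d) powr b / b"
      by (rule Youngs_inequality) (use ab pos in auto)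
    also have "\<dots> = ?Y x"
      using pos by (simp add: powr_divide field_simps)
    finally have "c * d * ((cmod (f x) / c) * (cmod (g x) / d)) \<le> c * d * (?Y x)"
      using pos by (intro mult_left_mono) auto
    then show "cmod (f x * g x) \<le> c * d * (?Y x)"
      using pos by (simp add: norm_mult)
  qed
  also have "\<dots> = c * d * (inverse (a * c powr a) * (\<integral>x. cmod (f x) powr a \<partial>M) + inverse (b * d powr b) * (\<integral>x. cmod (g x) powr b \<partial>M))"
    using bdd_int[OF bdd_powr[OF f, of a]] bdd_int[OF bdd_powr[OF g, of b]] ab by simp
  also have "\<dots> = c * d * (1 / a + 1 / b)"
    unfolding pw[symmetric] using pos by (simp add: field_simps)
  finally show ?thesis by (simp add: ab c_def d_def)
qed

lemma dual_1:
  assumes f: "bdd M f" and K: "\<And>h. bdd M h \<Longrightarrow> (\<And>x. x \<in> space M \<Longrightarrow> cmod (h x) \<le> 1) \<Longrightarrow> cmod (\<integral>x. h x * f x \<partial>M) \<le> K"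
  shows "Lpnorm M 1 f \<le> K"
proof -
  note bdd_measurable[OF f, measurable]
  \<comment> \<open>The bounded function that turns \<open>f x\<close> into its modulus; where
    \<open>f\<close> vanishes, division by zero gives the value 0.\<close>
  define h where "h x = cnj (f x) / of_real (cmod (f x))" for x
  have le: "cmod (h x) \<le> 1" for x by (simp add: h_def norm_divide)
  have cm[measurable]: "cnj \<in> borel_measurable borel" by (intro borel_measurable_continuous_onI continuous_intros)
  have bh: "bdd M h" by (rule bddI[of _ _ 1]) (auto simp: le, auto simp: h_def[abs_def])
  have "h x * f x = complex_of_real (cmod (f x))" for x
  proof (cases "f x = 0")
    case False
    have "h x * f x = of_real ((cmod (f x))\<^sup>2) / of_real (cmod (f x))"
      unfolding complex_norm_square by (simp add: h_def mult.commute)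
    then show ?thesis by (simp add: power2_eq_square)
  qed (simp add: h_def)
  then have "cmod (\<integral>x. h x * f x \<partial>M) = (\<integral>x. cmod (f x) \<partial>M)"
    by (simp add: integral_nonneg_AE)
  then show ?thesis using K[OF bh le] by (simp add: Lpnorm_def integral_nonneg_AE)
qed

lemma dual_p:
  assumes f: "bdd M f" and p: "p > 1" "1 / p + 1 / b = 1" and K: "\<And>h. bdd M h \<Longrightarrow> cmod (\<integral>x. h x * f x \<partial>M) \<le> K * Lpnorm M b h"
    and K0: "K \<ge> 0"
  shows "Lpnorm M p f \<le> K"
proof (cases "Lpnorm M p f = 0")
  case True then show ?thesis using K0 by simp
next
  case False
  note bdd_measurable[OF f, measurable]
  \<comment> \<open>The case of equality in Hoelder's inequality: both |h|^b and h f equal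
    |f|^p.\<close>
  define h where "h x = cnj (f x) * of_real (cmod (f x) powr (p - 2))" for x
  have nh: "cmod (h x) = cmod (f x) powr (p - 1)" for x
    using powr_mult_base[of "cmod (f x)" "p - 2"] by (simp add: h_def norm_mult)
  have cm[measurable]: "cnj \<in> borel_measurable borel" by (intro borel_measurable_continuous_onI continuous_intros)
  obtain B where B: "\<And>x. x \<in> space M \<Longrightarrow> norm (f x) \<le> B" "B \<ge> 0" by (rule bdd_bound[OF f]) blast
  have bh: "bdd M h"
    by (rule bddI[of _ _ "B powr (p - 1)"]) (use p B in \<open>auto simp: nh intro!: powr_mono2\<close>, auto simp: h_def[abs_def])
  have b: "b > 0" "(p - 1) * b = p"
  proof -
    have "1 / b = (p - 1) / p" using p by (simp add: field_simps)
    then have "b = p / (p - 1)" by (metis inverse_divide inverse_eq_divide inverse_inverse_eq)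
    then show "b > 0" "(p - 1) * b = p" using p by auto
  qed
  define A where "A = (\<integral>x. cmod (f x) powr p \<partial>M)"
  have A: "A > 0"
    using False p by (simp add: A_def Lpnorm_def integral_nonneg_AE order_less_le)
  have "h x * f x = complex_of_real (cmod (f x) powr p)" for x
  proof (cases "f x = 0")
    case nz: False
    have "h x * f x = of_real ((cmod (f x))\<^sup>2 * cmod (f x) powr (p - 2))"
      using complex_norm_square[of "f x"] by (simp add: h_def mult_ac)
    then show ?thesis using nz by (simp add: powr_diff)
  qed (simp add: h_def)
  then have "cmod (\<integral>x. h x * f x \<partial>M) = A"
    by (simp add: A_def integral_nonneg_AE)
  moreover have "Lpnorm M b h = A powr (1 / b)"
    using b by (simp add: Lpnorm_def nh powr_powr A_def)
  ultimately have "A \<le> K * A powr (1 / b)" using K[OF bh] by simp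
  moreover have "A = A powr (1 / p) * A powr (1 / b)" using A p by (simp flip: powr_add)
  ultimately have "A powr (1 / p) * A powr (1 / b) \<le> K * A powr (1 / b)" by simp
  then have "A powr (1 / p) \<le> K" using A by (simp add: mult_le_cancel_right)
  then show ?thesis by (simp add: Lpnorm_def A_def)
qed

end

text \<open>Exponential sums suffice, since interpolation is carried out on simple functions. Such a
  sum is bounded on the strip, so the factor exp (e (z^2 - 1)) makes it small high up; the maximum
  principle on a rectangle and the limit of e to 0 finish the argument.\<close>

lemma three_lines_exp:
  fixes c :: "'i \<Rightarrow> complex" and l :: "'i \<Rightarrow> real" and I :: "'i set"
  defines "F \<equiv> (\<lambda>z. \<Sum>i\<in>I. c i * exp (of_real (l i) * z))"
  assumes I: "finite I"
    and F0: "\<And>y. cmod (F (\<i> * of_real y)) \<le> 1" and F1: "\<And>y. cmod (F (1 + \<i> * of_real y)) \<le> 1"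
    and x: "0 \<le> x" "x \<le> 1"
  shows "cmod (F (of_real x)) \<le> 1"
proof -
  let ?X = "\<lambda>z. (Re z)\<^sup>2 - (Im z)\<^sup>2 - 1"
  define C where "C = (\<Sum>i\<in>I. cmod (c i) * exp \<bar>l i\<bar>) + 1"
  have C1: "C \<ge> 1" by (auto simp: C_def intro!: sum_nonneg)
  have FC: "cmod (F z) \<le> C" if "0 \<le> Re z" "Re z \<le> 1" for z
  proof -
    have "cmod (F z) \<le> (\<Sum>i\<in>I. cmod (c i * exp (of_real (l i) * z)))"
      unfolding F_def by (rule norm_sum)
    also have "\<dots> \<le> (\<Sum>i\<in>I. cmod (c i) * exp \<bar>l i\<bar>)"
    proof (intro sum_mono)
      fix i
      have "l i * Re z \<le> \<bar>l i * Re z\<bar>" by (rule abs_ge_self)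
      also have "\<dots> = \<bar>l i\<bar> * Re z" using that by (simp add: abs_mult)
      also have "\<dots> \<le> \<bar>l i\<bar>" using mult_left_mono[OF that(2), of "\<bar>l i\<bar>"] by simp
      finally have "exp (l i * Re z) \<le> exp \<bar>l i\<bar>" by simp
      moreover have "cmod (c i * exp (of_real (l i) * z)) = cmod (c i) * exp (l i * Re z)"
        by (simp add: norm_mult)
      ultimately show "cmod (c i * exp (of_real (l i) * z)) \<le> cmod (c i) * exp \<bar>l i\<bar>"
        by (simp add: mult_left_mono)
    qed
    finally show ?thesis by (simp add: C_def)
  qed
  have eps: "cmod (F (of_real x)) * exp (e * (x\<^sup>2 - 1)) \<le> 1" if e: "e > 0" for e
  proof -
    define G where "G z = F z * exp (of_real e * (z\<^sup>2 - 1))" for z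
    \<comment> \<open>The height at which the decay exp (- e R^2) compensates the a priori bound
      \<open>C\<close> on the horizontal sides.\<close>
    define R where "R = sqrt (ln C / e) + 1"
    have R: "R > 0" "e * R\<^sup>2 \<ge> ln C"
    proof -
      have s: "sqrt (ln C / e) \<ge> 0" using C1 e by simp
      show "R > 0" unfolding R_def using s by linarith
      have "(sqrt (ln C / e))\<^sup>2 \<le> R\<^sup>2" using s by (intro power_mono) (auto simp: R_def)
      then show "e * R\<^sup>2 \<ge> ln C" using C1 e by (simp add: field_simps)
    qed
    have nG: "cmod (G z) = cmod (F z) * exp (e * ?X z)" for z
      by (simp add: G_def norm_mult power2_eq_square)
    have szego_ext: "G holomorphic_on UNIV"
      unfolding G_def F_def by (intro holomorphic_intros)
    define S where "S = cbox (Complex 0 (-R)) (Complex 1 R)"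
    have S_iff: "z \<in> S \<longleftrightarrow> 0 \<le> Re z \<and> Re z \<le> 1 \<and> -R \<le> Im z \<and> Im z \<le> R" for z
      by (auto simp: S_def in_cbox_complex_iff)
    have "cmod (G (of_real x)) \<le> 1"
    proof (rule maximum_modulus_frontier[of G S])
      show "G holomorphic_on interior S" using szego_ext by (rule holomorphic_on_subset) auto
      show "continuous_on (closure S) G" using holomorphic_on_imp_continuous_on[OF szego_ext] by (rule continuous_on_subset) auto
      show "bounded S" by (simp add: S_def)
      show "complex_of_real x \<in> S" using x R by (simp add: S_iff)
      fix z assume "z \<in> frontier S"
      then have z: "z \<in> S" "z \<notin> box (Complex 0 (-R)) (Complex 1 R)"
        by (auto simp: frontier_def S_def)
      then have zz: "0 \<le> Re z" "Re z \<le> 1" "- R \<le> Im z" "Im z \<le> R"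
        and cases: "Re z = 0 \<or> Re z = 1 \<or> Im z = -R \<or> Im z = R"
        by (auto simp: S_iff in_box_complex_iff)
      have re: "(Re z)\<^sup>2 \<le> 1" using zz by (simp add: abs_square_le_1)
      have "(Re z)\<^sup>2 - (Im z)\<^sup>2 - 1 \<le> 0" using re zero_le_power2[of "Im z"] by linarith
      then have "e * ?X z \<le> 0" using e by (intro mult_nonneg_nonpos) auto
      then have le1: "exp (e * ?X z) \<le> 1" by simp
      consider "Re z = 0" | "Re z = 1" | "(Im z)\<^sup>2 = R\<^sup>2"
        using cases by auto
      then show "cmod (G z) \<le> 1"
      proof cases
        case 1
        then have "z = \<i> * of_real (Im z)" by (simp add: complex_eq_iff)
        then have "cmod (F z) \<le> 1" using F0[of "Im z"] by metis
        then show ?thesis unfolding nG using le1 by (intro mult_le_one) auto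
      next
        case 2
        then have "z = 1 + \<i> * of_real (Im z)" by (simp add: complex_eq_iff)
        then have "cmod (F z) \<le> 1" using F1[of "Im z"] by metis
        then show ?thesis unfolding nG using le1 by (intro mult_le_one) auto
      next
        case 3
        have "e * ?X z \<le> e * (- (R\<^sup>2))"
          using e 3 re by (intro mult_left_mono) auto
        also have "\<dots> \<le> - ln C" using R by simp
        finally have "exp (e * ?X z) \<le> exp (- ln C)" by simp
        also have "\<dots> = inverse C" using C1 by (simp add: exp_minus)
        finally have "exp (e * ?X z) \<le> inverse C" .
        then have "cmod (F z) * exp (e * ?X z) \<le> C * inverse C"
          using FC[of z] zz C1 by (intro mult_mono) auto
        then show ?thesis unfolding nG using C1 by simp
      qed
    qed
    then show ?thesis by (simp add: nG)
  qed
  have "((\<lambda>e. cmod (F (of_real x)) * exp (e * (x\<^sup>2 - 1))) \<longlongrightarrow> cmod (F (of_real x)) * exp (0 * (x\<^sup>2 - 1))) (at_right 0)"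
    by (intro tendsto_intros)
  moreover have "\<forall>\<^sub>F e in at_right 0. cmod (F (of_real x)) * exp (e * (x\<^sup>2 - 1)) \<le> 1"
    using eventually_at_right_less[of "0::real"] by (rule eventually_mono) (rule eps)
  ultimately have "cmod (F (of_real x)) * exp (0 * (x\<^sup>2 - 1)) \<le> 1"
    by (intro tendsto_upperbound) auto
  then show ?thesis by simp
qed

text \<open>Bilinear rather than sesquilinear, so that inserting holomorphic families in both
  arguments gives a holomorphic function.\<close>

definition szego_form :: "real \<Rightarrow> (real \<Rightarrow> complex) \<Rightarrow> (real \<Rightarrow> complex) \<Rightarrow> complex" where
  "szego_form r g h = (\<integral>t. h t * szego_op r g t \<partial>circ)"

context
  fixes r :: real
  assumes r: "0 \<le> r" "r < 1"
begin

lemma bdd_szego2: "bdd (circ \<Otimes>\<^sub>M circ) (\<lambda>(t, u). szego r (t - u))"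
proof -
  have "norm (szego r x) \<le> 1 / (1 - r)" for x by (rule norm_szego_le[OF r])
  then show ?thesis by (intro bddI) (measurable, auto)
qed

text \<open>The Szego kernel is Hermitian, so the projection is self-adjoint; as the form is
  bilinear, the adjoint shows up with two conjugations.\<close>

lemma szego_form_swap:
  assumes g: "bdd circ g" and h: "bdd circ h"
  shows "szego_form r g h = (\<integral>u. g u * cnj (szego_op r (\<lambda>t. cnj (h t)) u) \<partial>circ)"
proof -
  have "bdd (circ \<Otimes>\<^sub>M circ) (\<lambda>(t, u). h t * (szego r (t - u) * g u))"
    using bdd_mult[OF bdd_compose[OF h measurable_fst[of circ circ]] bdd_mult[OF bdd_szego2 bdd_compose[OF g measurable_snd[of circ circ]]]]
    by (simp add: case_prod_unfold)
  then have "(\<integral>t. (\<integral>u. h t * (szego r (t - u) * g u) \<partial>circ) \<partial>circ) = (\<integral>u. (\<integral>t. h t * (szego r (t - u) * g u) \<partial>circ) \<partial>circ)"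
    by (rule bdd_Fubini[OF prob_circ prob_circ])
  also have "\<dots> = (\<integral>u. g u * cnj (szego_op r (\<lambda>t. cnj (h t)) u) \<partial>circ)"
  proof (rule Bochner_Integration.integral_cong[OF refl])
    fix u
    have "cnj (szego_op r (\<lambda>t. cnj (h t)) u) = (\<integral>t. szego r (t - u) * h t \<partial>circ)"
      unfolding szego_op_def by (subst Bochner_Integration.integral_cnj[symmetric]) (simp add: szego_uminus[of r "u - _", simplified])
    moreover have "(\<integral>t. h t * (szego r (t - u) * g u) \<partial>circ) = (\<integral>t. g u * (szego r (t - u) * h t) \<partial>circ)"
      by (rule Bochner_Integration.integral_cong) auto
    ultimately show "(\<integral>t. h t * (szego r (t - u) * g u) \<partial>circ) = g u * cnj (szego_op r (\<lambda>t. cnj (h t)) u)" by simp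
  qed
  finally show ?thesis by (simp add: szego_form_def szego_op_def)
qed

lemma szego_form_22:
  assumes g: "bdd circ g" and h: "bdd circ h"
  shows "cmod (szego_form r g h) \<le> Lpnorm circ 2 g * Lpnorm circ 2 h"
proof -
  have "cmod (szego_form r g h) \<le> Lpnorm circ 2 h * Lpnorm circ 2 (szego_op r g)"
    unfolding szego_form_def by (rule circ.hoelder[OF h bdd_szego_op[OF r g]]) auto
  also have "\<dots> \<le> Lpnorm circ 2 h * Lpnorm circ 2 g"
    by (intro mult_left_mono Lpnorm_nonneg) (simp add: Lpnorm_2 szego_op_22[OF r g])
  finally show ?thesis by (simp add: mult.commute)
qed

text \<open>Moving the projection onto \<open>h\<close> exchanges bounds into L^4 for bounds out of
  L^{4/3}. The next two lemmas insert the two available estimates of the L^4 norm.\<close>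

lemma szego_form_43:
  assumes g: "bdd circ g" and h: "bdd circ h"
  shows "cmod (szego_form r g h) \<le> Lpnorm circ (4/3) g * Lpnorm circ 4 (szego_op r (\<lambda>t. cnj (h t)))"
proof -
  have "cmod (szego_form r g h) \<le> Lpnorm circ (4/3) g * Lpnorm circ 4 (\<lambda>u. cnj (szego_op r (\<lambda>t. cnj (h t)) u))"
    unfolding szego_form_swap[OF g h] by (rule circ.hoelder[OF g bdd_cnj[OF bdd_szego_op[OF r bdd_cnj[OF h]]]]) auto
  also have "Lpnorm circ 4 (\<lambda>u. cnj (szego_op r (\<lambda>t. cnj (h t)) u)) = Lpnorm circ 4 (szego_op r (\<lambda>t. cnj (h t)))"
    by (rule Lpnorm_cong) simp
  finally show ?thesis .
qed

lemma szego_form_43_inf: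
  assumes g: "bdd circ g" and h: "bdd circ h" and le: "\<And>u. u \<in> space circ \<Longrightarrow> cmod (h u) \<le> 1"
  shows "cmod (szego_form r g h) \<le> Lpnorm circ (4/3) g"
proof -
  have "Lpnorm circ 4 (szego_op r (\<lambda>t. cnj (h t))) \<le> 1"
    using szego_op_inf_4[OF r bdd_cnj[OF h]] le by (simp add: Lpnorm_le_iff)
  then show ?thesis using szego_form_43[OF g h] mult_left_mono[OF _ Lpnorm_nonneg[of circ "4/3" g]] by fastforce
qed

lemma szego_form_43_4:
  assumes g: "bdd circ g" and h: "bdd circ h"
  shows "cmod (szego_form r g h) \<le> 2 * Lpnorm circ (4/3) g * Lpnorm circ 4 h"
proof -
  have "Lpnorm circ 4 (szego_op r (\<lambda>t. cnj (h t))) \<le> 2 * Lpnorm circ 4 h"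
  proof (subst Lpnorm_le_iff)
    have "(2 * Lpnorm circ 4 h) powr 4 = 16 * (Lpnorm circ 4 h powr 4)"
      using Lpnorm_nonneg[of circ 4 h] by (simp add: powr_mult power_mult_distrib)
    also have "Lpnorm circ 4 h powr 4 = (\<integral>x. (cmod (h x))^4 \<partial>circ)" by (subst Lpnorm_powr) auto
    finally have "(2 * Lpnorm circ 4 h) powr 4 = 16 * (\<integral>x. (cmod (h x))^4 \<partial>circ)" .
    moreover have "0 \<le> (\<integral>x. (cmod (h x))^4 \<partial>circ)" by (rule integral_nonneg_AE) simp
    ultimately show "(\<integral>x. cmod (szego_op r (\<lambda>t. cnj (h t)) x) powr 4 \<partial>circ) \<le> (2 * Lpnorm circ 4 h) powr 4"
      using szego_op_44[OF r bdd_cnj[OF h]] unfolding Lpnorm_4_powr complex_mod_cnj by linarith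
  qed (auto simp: Lpnorm_nonneg)
  then show ?thesis using szego_form_43[OF g h] mult_left_mono[OF _ Lpnorm_nonneg[of circ "4/3" g]] by fastforce
qed

lemma szego_op_43_1:
  assumes g: "bdd circ g" shows "Lpnorm circ 1 (szego_op r g) \<le> Lpnorm circ (4/3) g"
  by (rule circ.dual_1[OF bdd_szego_op[OF r g]]) (use szego_form_43_inf[OF g] in \<open>auto simp: szego_form_def\<close>)

lemma szego_op_43_43:
  assumes g: "bdd circ g" shows "Lpnorm circ (4/3) (szego_op r g) \<le> 2 * Lpnorm circ (4/3) g"
  by (rule circ.dual_p[OF bdd_szego_op[OF r g], of _ 4]) (use szego_form_43_4[OF g] in \<open>auto simp: szego_form_def Lpnorm_nonneg\<close>)

end

section \<open>Interpolation\<close>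

lemma simple_bdd:
  assumes "simple_function M (g :: 'a \<Rightarrow> 'b::{real_normed_vector,second_countable_topology})"
  shows "bdd M g"
proof -
  have "finite (g ` space M)" using assms by (rule simple_functionD)
  then have "bounded (g ` space M)" by (rule finite_imp_bounded)
  then obtain B where "\<forall>y\<in>g ` space M. norm y \<le> B" using bounded_iff by metis
  then show ?thesis using assms by (intro bddI[of _ _ B]) (auto intro: borel_measurable_simple_function)
qed

lemma bdd_sum: "(\<And>i. i \<in> I \<Longrightarrow> bdd M (f i)) \<Longrightarrow> bdd M (\<lambda>x. \<Sum>i\<in>I. f i x)"
  by (induction I rule: infinite_finite_induct) (auto intro: bdd_add)

text \<open>The complex power of the modulus that keeps the phase, the usual holomorphic family of
  the Riesz-Thorin proof. The scale \<open>c\<close> will be the norm of the function, so that the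
  norms on both boundary lines become 1.\<close>

definition scaled_power :: "real \<Rightarrow> complex \<Rightarrow> complex \<Rightarrow> complex" where
  "scaled_power c x s = (if x = 0 then 0 else sgn x * exp (s * of_real (ln (cmod x / c))))"

lemma norm_scaled_power: "c > 0 \<Longrightarrow> cmod (scaled_power c x s) = (cmod x / c) powr Re s"
  by (auto simp: scaled_power_def norm_mult powr_def norm_sgn)

lemma scaled_power_1: "c > 0 \<Longrightarrow> scaled_power c x 1 = x / of_real c"
proof (cases "x = 0")
  case False
  assume c: "c > 0"
  have "exp (complex_of_real (ln (cmod x / c))) = of_real (cmod x / c)"
    using False c by (subst exp_of_real) simp
  then have "scaled_power c x 1 = (sgn x * of_real (cmod x)) / of_real c" using False by (simp add: scaled_power_def)
  also have "sgn x * of_real (cmod x) = x" using False by (simp add: sgn_eq)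
  finally show ?thesis .
qed (simp add: scaled_power_def)

context
  fixes r :: real
  assumes r: "0 \<le> r" "r < 1"
begin

lemma szego_op_sum:
  assumes "\<And>x. x \<in> V \<Longrightarrow> bdd circ (G x)"
  shows "szego_op r (\<lambda>u. \<Sum>x\<in>V. c x * G x u) t = (\<Sum>x\<in>V. c x * szego_op r (G x) t)"
proof -
  have "szego_op r (\<lambda>u. \<Sum>x\<in>V. c x * G x u) t = (\<integral>u. (\<Sum>x\<in>V. c x * (szego r (t - u) * G x u)) \<partial>circ)"
    unfolding szego_op_def by (rule Bochner_Integration.integral_cong) (auto simp: sum_distrib_left mult_ac)
  also have "\<dots> = (\<Sum>x\<in>V. c x * szego_op r (G x) t)"
    unfolding szego_op_def
    by (subst Bochner_Integration.integral_sum) (auto intro!: bdd_circ_int bdd_mult[OF bdd_const] bdd_mult[OF bdd_szego[OF r]] assms)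
  finally show ?thesis .
qed

lemma szego_form_sum:
  assumes "\<And>x. x \<in> V \<Longrightarrow> bdd circ (G x)" "\<And>y. y \<in> W \<Longrightarrow> bdd circ (H y)"
  shows "szego_form r (\<lambda>u. \<Sum>x\<in>V. c x * G x u) (\<lambda>u. \<Sum>y\<in>W. d y * H y u) = (\<Sum>x\<in>V. \<Sum>y\<in>W. c x * d y * szego_form r (G x) (H y))"
proof -
  have b2: "x \<in> V \<Longrightarrow> y \<in> W \<Longrightarrow> bdd circ (\<lambda>t. c x * d y * (H y t * szego_op r (G x) t))" for x y
    by (intro bdd_mult[OF bdd_const] bdd_mult[OF assms(2) bdd_szego_op[OF r assms(1)]])
  have "szego_form r (\<lambda>u. \<Sum>x\<in>V. c x * G x u) (\<lambda>u. \<Sum>y\<in>W. d y * H y u)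
      = (\<integral>t. (\<Sum>x\<in>V. \<Sum>y\<in>W. c x * d y * (H y t * szego_op r (G x) t)) \<partial>circ)"
    unfolding szego_form_def
  proof (rule Bochner_Integration.integral_cong[OF refl])
    fix t
    have "(\<Sum>y\<in>W. d y * H y t) * szego_op r (\<lambda>u. \<Sum>x\<in>V. c x * G x u) t
        = (\<Sum>x\<in>V. c x * szego_op r (G x) t) * (\<Sum>y\<in>W. d y * H y t)"
      by (subst szego_op_sum[OF assms(1)]) (auto simp: mult.commute)
    also have "\<dots> = (\<Sum>x\<in>V. \<Sum>y\<in>W. c x * d y * (H y t * szego_op r (G x) t))"
      unfolding sum_product by (simp add: mult_ac)
    finally show "(\<Sum>y\<in>W. d y * H y t) * szego_op r (\<lambda>u. \<Sum>x\<in>V. c x * G x u) t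
        = (\<Sum>x\<in>V. \<Sum>y\<in>W. c x * d y * (H y t * szego_op r (G x) t))" .
  qed
  also have "\<dots> = (\<Sum>x\<in>V. (\<integral>t. (\<Sum>y\<in>W. c x * d y * (H y t * szego_op r (G x) t)) \<partial>circ))"
    by (rule Bochner_Integration.integral_sum) (rule bdd_circ_int[OF bdd_sum[OF b2]])
  also have "\<dots> = (\<Sum>x\<in>V. \<Sum>y\<in>W. c x * d y * szego_form r (G x) (H y))"
  proof (rule sum.cong[OF refl])
    fix x assume "x \<in> V"
    then have "(\<integral>t. (\<Sum>y\<in>W. c x * d y * (H y t * szego_op r (G x) t)) \<partial>circ) = (\<Sum>y\<in>W. (\<integral>t. c x * d y * (H y t * szego_op r (G x) t) \<partial>circ))"
      by (intro Bochner_Integration.integral_sum bdd_circ_int[OF b2])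
    then show "(\<integral>t. (\<Sum>y\<in>W. c x * d y * (H y t * szego_op r (G x) t)) \<partial>circ) = (\<Sum>y\<in>W. c x * d y * szego_form r (G x) (H y))"
      by (simp add: szego_form_def)
  qed
  finally show ?thesis .
qed

text \<open>All functions of \<open>g\<close> live on the level sets of \<open>g\<close>, so the
  parameter of a holomorphic family of such functions enters through coefficients only.\<close>

lemma simple_decomp:
  fixes g :: "real \<Rightarrow> complex" and \<phi> :: "complex \<Rightarrow> complex"
  assumes "simple_function circ g" "t \<in> space circ"
  shows "\<phi> (g t) = (\<Sum>x\<in>g ` space circ. \<phi> x * indicator (g -` {x}) t)"
proof -
  have "finite (g ` space circ)" using assms(1) by (rule simple_functionD)
  then have "(\<Sum>x\<in>g ` space circ. \<phi> x * indicator (g -` {x}) t) = (\<Sum>x\<in>g ` space circ. if x = g t then \<phi> x else 0)"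
    by (intro sum.cong) (auto simp: indicator_def)
  then show ?thesis using \<open>finite _\<close> assms(2) by (simp add: sum.delta')
qed

lemma szego_form_cong:
  assumes "\<And>t. t \<in> space circ \<Longrightarrow> g t = g' t" "\<And>t. t \<in> space circ \<Longrightarrow> h t = h' t"
  shows "szego_form r g h = szego_form r g' h'"
proof -
  have "szego_op r g t = szego_op r g' t" for t
    unfolding szego_op_def by (rule Bochner_Integration.integral_cong) (use assms in auto)
  then show ?thesis unfolding szego_form_def by (intro Bochner_Integration.integral_cong) (use assms in auto)
qed

text \<open>The pair (1/a, 1/b) is the point with parameter \<theta> on the segment from (1/2, 1/2),
  where \<open>szego_form_22\<close> holds, to (3/4, 0), where \<open>szego_form_43_inf\<close>
  holds.\<close>

lemma riesz_thorin_simple: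
  fixes g h :: "real \<Rightarrow> complex"
  assumes g: "simple_function circ g" and h: "simple_function circ h"
    and th: "0 < \<theta>" "\<theta> < 1" and ab: "1 / a = 1 / 2 + \<theta> / 4" "1 / b = (1 - \<theta>) / 2"
  shows "cmod (szego_form r g h) \<le> Lpnorm circ a g * Lpnorm circ b h"
proof (cases "Lpnorm circ a g = 0 \<or> Lpnorm circ b h = 0")
  case True
  have pos: "a > 0" "b > 0" using th ab by (metis add_pos_pos divide_pos_pos zero_less_divide_1_iff zero_less_numeral zero_less_one,
      metis diff_gt_0_iff_gt divide_pos_pos zero_less_divide_1_iff zero_less_numeral)
  have "Lpnorm circ 2 g = 0 \<or> Lpnorm circ 2 h = 0"
    using True pos circ.Lpnorm_eq_0_AE[OF simple_bdd[OF g], of a] circ.Lpnorm_eq_0_AE[OF simple_bdd[OF h], of b]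
      circ.AE_0_Lpnorm[OF _ simple_bdd[OF g], of 2] circ.AE_0_Lpnorm[OF _ simple_bdd[OF h], of 2] by auto
  then show ?thesis using szego_form_22[OF r simple_bdd[OF g] simple_bdd[OF h]] True by auto
next
  case False
  have pos: "a > 0" "b > 0" using th ab by (metis add_pos_pos divide_pos_pos zero_less_divide_1_iff zero_less_numeral zero_less_one,
      metis diff_gt_0_iff_gt divide_pos_pos zero_less_divide_1_iff zero_less_numeral)
  define C D where "C = Lpnorm circ a g" and "D = Lpnorm circ b h"
  have CD: "C > 0" "D > 0" using False Lpnorm_nonneg[of circ a g] Lpnorm_nonneg[of circ b h] by (auto simp: C_def D_def)
  have pw: "(\<integral>x. (cmod (g x) / C) powr a \<partial>circ) = 1" "(\<integral>x. (cmod (h x) / D) powr b \<partial>circ) = 1"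
  proof -
    have "(\<integral>x. (cmod (g x) / C) powr a \<partial>circ) = C powr a / C powr a"
      using CD unfolding C_def Lpnorm_powr[OF pos(1)] by (simp add: powr_divide Lpnorm_powr[OF pos(1)])
    then show "(\<integral>x. (cmod (g x) / C) powr a \<partial>circ) = 1" using CD by simp
    have "(\<integral>x. (cmod (h x) / D) powr b \<partial>circ) = D powr b / D powr b"
      using CD unfolding D_def Lpnorm_powr[OF pos(2)] by (simp add: powr_divide Lpnorm_powr[OF pos(2)])
    then show "(\<integral>x. (cmod (h x) / D) powr b \<partial>circ) = 1" using CD by simp
  qed
  \<comment> \<open>Affine exponents equal to 1 at \<theta>. Their real parts are a/2 and b/2 on the
    line Re z = 0, and 3a/4 and 0 on Re z = 1, which makes the relevant norms of \<open>gz z\<close>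
    and \<open>hz z\<close> at most 1 on each line.\<close>
  define \<alpha> where "\<alpha> z = of_real a * (1 / 2 + z / 4)" for z :: complex
  define \<beta> where "\<beta> z = of_real b * (1 - z) / 2" for z :: complex
  define gz where "gz z u = scaled_power C (g u) (\<alpha> z)" for z u
  define hz where "hz z u = scaled_power D (h u) (\<beta> z)" for z u
  define V W where "V = g ` space circ" and "W = h ` space circ"
  have fin: "finite V" "finite W" using g h by (auto simp: V_def W_def simple_function_def)
  define B where "B x y = szego_form r (indicator (g -` {x})) (indicator (h -` {y}))" for x y
  have bdd_ind: "bdd circ (indicator (g -` {x}) :: _ \<Rightarrow> complex)" "bdd circ (indicator (h -` {x}) :: _ \<Rightarrow> complex)" for x
  proof -
    have *: "bdd circ (\<lambda>u. (if f u = x then 1 else 0) :: complex)" if "simple_function circ f" for f :: "real \<Rightarrow> complex"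
      using simple_function_compose1[OF that, of "\<lambda>v. (if v = x then 1 else 0) :: complex"] by (rule simple_bdd)
    have "(indicator (f -` {x}) :: _ \<Rightarrow> complex) = (\<lambda>u. (if f u = x then 1 else 0))" for f :: "real \<Rightarrow> complex"
      by (auto simp: indicator_def)
    then show "bdd circ (indicator (g -` {x}) :: _ \<Rightarrow> complex)" "bdd circ (indicator (h -` {x}) :: _ \<Rightarrow> complex)"
      using *[OF g] *[OF h] by simp_all
  qed
  have Fsum: "szego_form r (gz z) (hz z) = (\<Sum>x\<in>V. \<Sum>y\<in>W. scaled_power C x (\<alpha> z) * scaled_power D y (\<beta> z) * B x y)" for z
  proof -
    have "szego_form r (gz z) (hz z) = szego_form r (\<lambda>u. \<Sum>x\<in>V. scaled_power C x (\<alpha> z) * indicator (g -` {x}) u) (\<lambda>u. \<Sum>y\<in>W. scaled_power D y (\<beta> z) * indicator (h -` {y}) u)"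
      unfolding gz_def hz_def V_def W_def
      by (intro szego_form_cong simple_decomp g h)
    also have "\<dots> = (\<Sum>x\<in>V. \<Sum>y\<in>W. scaled_power C x (\<alpha> z) * scaled_power D y (\<beta> z) * B x y)"
      unfolding B_def by (rule szego_form_sum) (rule bdd_ind)+
    finally show ?thesis .
  qed
  define lx ly where "lx x = ln (cmod x / C)" and "ly y = ln (cmod y / D)" for x y :: complex
  \<comment> \<open>The exponent \<open>\<alpha> z * lx x + \<beta> z * ly y\<close> is affine in
    \<open>z\<close>: its slope is \<open>l\<close>, and its constant part goes into the coefficient
    \<open>cf\<close>.\<close>
  define l where "l = (\<lambda>(x, y). a / 4 * lx x - b / 2 * ly y)"
  define cf where "cf = (\<lambda>(x, y). if x = 0 \<or> y = 0 then 0 else sgn x * sgn y * exp (of_real (a / 2 * lx x + b / 2 * ly y)) * B x y)"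
  have F: "szego_form r (gz z) (hz z) = (\<Sum>i\<in>V \<times> W. cf i * exp (of_real (l i) * z))" for z
  proof -
    have "scaled_power C x (\<alpha> z) * scaled_power D y (\<beta> z) * B x y = cf (x, y) * exp (of_real (l (x, y)) * z)" for x y
    proof (cases "x = 0 \<or> y = 0")
      case False
      have "exp (\<alpha> z * of_real (lx x)) * exp (\<beta> z * of_real (ly y)) = exp (of_real (a / 2 * lx x + b / 2 * ly y)) * exp (of_real (l (x, y)) * z)"
        unfolding exp_add[symmetric] by (rule arg_cong[where f=exp]) (simp add: \<alpha>_def \<beta>_def l_def field_simps)
      then show ?thesis using False by (simp add: scaled_power_def cf_def mult_ac flip: lx_def ly_def)
    qed (auto simp: scaled_power_def cf_def)
    then show ?thesis unfolding Fsum by (simp add: sum.cartesian_product)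
  qed
  have bgz: "bdd circ (gz z)" and bhz: "bdd circ (hz z)" for z
    unfolding gz_def hz_def by (auto intro!: simple_bdd simple_function_compose1[of circ _ "\<lambda>x. scaled_power C x (\<alpha> z)"] simple_function_compose1[of circ _ "\<lambda>x. scaled_power D x (\<beta> z)"] g h)
  have e0: "cmod (szego_form r (gz (\<i> * of_real y)) (hz (\<i> * of_real y))) \<le> 1" for y
  proof -
    have "cmod (gz (\<i> * of_real y) u) powr 2 = (cmod (g u) / C) powr a" for u
      using CD by (simp add: gz_def norm_scaled_power \<alpha>_def powr_powr)
    then have "Lpnorm circ 2 (gz (\<i> * of_real y)) = 1" unfolding Lpnorm_def by (simp only: pw) simp
    moreover have "cmod (hz (\<i> * of_real y) u) powr 2 = (cmod (h u) / D) powr b" for u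
      using CD by (simp add: hz_def norm_scaled_power \<beta>_def powr_powr)
    then have "Lpnorm circ 2 (hz (\<i> * of_real y)) = 1" unfolding Lpnorm_def by (simp only: pw) simp
    ultimately show ?thesis using szego_form_22[OF r bgz[of "\<i> * of_real y"] bhz[of "\<i> * of_real y"]] by simp
  qed
  have e1: "cmod (szego_form r (gz (1 + \<i> * of_real y)) (hz (1 + \<i> * of_real y))) \<le> 1" for y
  proof -
    have "cmod (gz (1 + \<i> * of_real y) u) powr (4/3) = (cmod (g u) / C) powr a" for u
      using CD by (simp add: gz_def norm_scaled_power \<alpha>_def powr_powr)
    then have "Lpnorm circ (4/3) (gz (1 + \<i> * of_real y)) = 1" unfolding Lpnorm_def by (simp only: pw) simp
    moreover have "cmod (hz (1 + \<i> * of_real y) u) \<le> 1" for u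
      using CD by (simp add: hz_def norm_scaled_power \<beta>_def)
    ultimately show ?thesis using szego_form_43_inf[OF r bgz[of "1 + \<i> * of_real y"] bhz[of "1 + \<i> * of_real y"]] by simp
  qed
  have "cmod (szego_form r (gz (of_real \<theta>)) (hz (of_real \<theta>))) \<le> 1"
    unfolding F by (rule three_lines_exp) (use fin e0 e1 th in \<open>auto simp flip: F\<close>)
  moreover have "gz (of_real \<theta>) = (\<lambda>u. (1 / of_real C) * g u)" "hz (of_real \<theta>) = (\<lambda>u. (1 / of_real D) * h u)"
  proof -
    have "a * (1 / 2 + \<theta> / 4) = 1" "b * (1 - \<theta>) / 2 = 1" using ab pos by (auto simp: field_simps)
    moreover have "\<alpha> (of_real \<theta>) = of_real (a * (1 / 2 + \<theta> / 4))" "\<beta> (of_real \<theta>) = of_real (b * (1 - \<theta>) / 2)"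
      by (simp_all add: \<alpha>_def \<beta>_def)
    ultimately have "\<alpha> (of_real \<theta>) = 1" "\<beta> (of_real \<theta>) = 1" by (simp_all only: of_real_1)
    then show "gz (of_real \<theta>) = (\<lambda>u. (1 / of_real C) * g u)" "hz (of_real \<theta>) = (\<lambda>u. (1 / of_real D) * h u)"
      using CD by (auto simp: gz_def hz_def scaled_power_1)
  qed
  moreover have "szego_form r (\<lambda>u. (1 / of_real C) * g u) (\<lambda>u. (1 / of_real D) * h u) = 1 / of_real C * (1 / of_real D) * szego_form r g h"
    using szego_form_sum[of "{()}" "\<lambda>_. g" "{()}" "\<lambda>_. h" "\<lambda>_. 1 / of_real C" "\<lambda>_. 1 / of_real D"] simple_bdd[OF g] simple_bdd[OF h]
    by simp
  ultimately have "cmod (szego_form r g h) / (C * D) \<le> 1"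
    using CD by (simp add: norm_mult norm_divide)
  then show ?thesis using CD by (simp add: C_def D_def field_simps)
qed

lemma Lpnorm_simple_approx:
  assumes F: "\<And>i. simple_function circ (F i)" "\<And>x. x \<in> space circ \<Longrightarrow> (\<lambda>i. F i x) \<longlonglongrightarrow> (g x :: complex)"
    "\<And>i x. x \<in> space circ \<Longrightarrow> norm (F i x) \<le> B" and p: "p > 0"
  shows "(\<lambda>i. Lpnorm circ p (F i)) \<longlonglongrightarrow> Lpnorm circ p g"
proof -
  have m: "F i \<in> borel_measurable circ" for i by (rule borel_measurable_simple_function[OF F(1)])
  have [measurable]: "g \<in> borel_measurable circ"
    by (rule borel_measurable_LIMSEQ_metric[OF m F(2)])
  note m[measurable]
  have "(\<lambda>i. \<integral>x. norm (F i x) powr p \<partial>circ) \<longlonglongrightarrow> (\<integral>x. norm (g x) powr p \<partial>circ)"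
  proof (rule integral_dominated_convergence[where w="\<lambda>_. B powr p"])
    show "AE x in circ. (\<lambda>i. norm (F i x) powr p) \<longlonglongrightarrow> norm (g x) powr p"
      by (intro AE_I2 tendsto_powr2 tendsto_norm F(2) tendsto_const always_eventually) (use p in auto)
    show "AE x in circ. norm (norm (F i x) powr p) \<le> B powr p" for i
      using F(3) p by (intro AE_I2) (auto intro!: powr_mono2)
  qed auto
  moreover have "0 \<le> (\<integral>x. norm (F i x) powr p \<partial>circ)" for i by (rule integral_nonneg_AE) simp
  ultimately show ?thesis unfolding Lpnorm_def
    using p by (intro tendsto_powr2) (auto intro: always_eventually)
qed

text \<open>A bounded measurable function is a pointwise limit of uniformly bounded simple
  functions, and at fixed \<open>r < 1\<close> the kernel is bounded, so dominated convergence
  passes both sides to the limit.\<close>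

lemma riesz_thorin:
  fixes g h :: "real \<Rightarrow> complex"
  assumes g: "bdd circ g" and h: "bdd circ h"
    and th: "0 < \<theta>" "\<theta> < 1" and ab: "1 / a = 1 / 2 + \<theta> / 4" "1 / b = (1 - \<theta>) / 2"
  shows "cmod (szego_form r g h) \<le> Lpnorm circ a g * Lpnorm circ b h"
proof -
  have pos: "a > 0" "b > 0" using th ab by (metis add_pos_pos divide_pos_pos zero_less_divide_1_iff zero_less_numeral zero_less_one,
      metis diff_gt_0_iff_gt divide_pos_pos zero_less_divide_1_iff zero_less_numeral)
  have ex: "\<exists>F B. (\<forall>i. simple_function circ (F i)) \<and> (\<forall>x\<in>space circ. (\<lambda>i. F i x) \<longlonglongrightarrow> f x) \<and>
      (\<forall>i. \<forall>x\<in>space circ. norm (F i x) \<le> B)" if f: "bdd circ f" for f :: "real \<Rightarrow> complex"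
  proof -
    obtain B where B: "\<And>x. x \<in> space circ \<Longrightarrow> norm (f x) \<le> B" by (rule bdd_bound[OF f]) blast
    obtain F where F: "\<forall>i. simple_function circ (F i)" "\<forall>x\<in>space circ. (\<lambda>i. F i x) \<longlonglongrightarrow> f x"
      "\<forall>i. \<forall>x\<in>space circ. dist (F i x) 0 \<le> 2 * dist (f x) 0"
      using borel_measurable_implies_sequence_metric[OF bdd_measurable[OF f], of 0] by blast
    have "norm (F i x) \<le> 2 * B" if "x \<in> space circ" for i x
      using F(3)[rule_format, OF that, of i] B[OF that] by simp
    then show ?thesis using F(1,2) by blast
  qed
  obtain G A where G: "\<And>i. simple_function circ (G i)" "\<And>x. x \<in> space circ \<Longrightarrow> (\<lambda>i. G i x) \<longlonglongrightarrow> g x"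
    "\<And>i x. x \<in> space circ \<Longrightarrow> norm (G i x) \<le> A" using ex[OF g] by blast
  obtain H B where H: "\<And>i. simple_function circ (H i)" "\<And>x. x \<in> space circ \<Longrightarrow> (\<lambda>i. H i x) \<longlonglongrightarrow> h x"
    "\<And>i x. x \<in> space circ \<Longrightarrow> norm (H i x) \<le> B" using ex[OF h] by blast
  have A0: "0 \<le> A" "0 \<le> B" using G(3)[of 0] H(3)[of 0] by (auto intro: order_trans[OF norm_ge_zero])
  have bG: "bdd circ (G i)" and bH: "bdd circ (H i)" for i by (rule simple_bdd[OF G(1)], rule simple_bdd[OF H(1)])
  have op: "(\<lambda>i. szego_op r (G i) t) \<longlonglongrightarrow> szego_op r g t" for t
    unfolding szego_op_def
  proof (rule integral_dominated_convergence[where w="\<lambda>_. 1 / (1 - r) * A"])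
    show "AE u in circ. (\<lambda>i. szego r (t - u) * G i u) \<longlonglongrightarrow> szego r (t - u) * g u"
      by (intro AE_I2 tendsto_intros G(2))
    show "AE u in circ. norm (szego r (t - u) * G i u) \<le> 1 / (1 - r) * A" for i
      using r norm_szego_le[OF r] G(3) by (intro AE_I2) (auto simp: norm_mult simp del: times_divide_eq_left intro!: mult_mono)
  qed (intro bdd_measurable bdd_mult bdd_szego[OF r] g bG finite_measure.integrable_const circ.finite_measure_axioms)+
  have nop: "norm (szego_op r (G i) t) \<le> 1 / (1 - r) * A" for i t
    unfolding szego_op_def using r norm_szego_le[OF r] G(3) A0
    by (intro circ.integral_bound) (auto simp: norm_mult simp del: times_divide_eq_left intro!: mult_mono)
  have "(\<lambda>i. szego_form r (G i) (H i)) \<longlonglongrightarrow> szego_form r g h"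
    unfolding szego_form_def
  proof (rule integral_dominated_convergence[where w="\<lambda>_. B * (1 / (1 - r) * A)"])
    show "AE u in circ. (\<lambda>i. H i u * szego_op r (G i) u) \<longlonglongrightarrow> h u * szego_op r g u"
      by (intro AE_I2 tendsto_intros H(2) op)
    show "AE u in circ. norm (H i u * szego_op r (G i) u) \<le> B * (1 / (1 - r) * A)" for i
      unfolding norm_mult using A0 H(3) nop by (intro AE_I2 mult_mono) auto
  qed (intro bdd_measurable bdd_mult bdd_szego_op[OF r] g h bG bH finite_measure.integrable_const circ.finite_measure_axioms)+
  then have "(\<lambda>i. cmod (szego_form r (G i) (H i))) \<longlonglongrightarrow> cmod (szego_form r g h)" by (rule tendsto_norm)
  moreover have "(\<lambda>i. Lpnorm circ a (G i) * Lpnorm circ b (H i)) \<longlonglongrightarrow> Lpnorm circ a g * Lpnorm circ b h"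
    by (intro tendsto_mult Lpnorm_simple_approx[OF G] Lpnorm_simple_approx[OF H] pos)
  ultimately show ?thesis
    by (rule LIMSEQ_le) (use riesz_thorin_simple[OF G(1) H(1) th ab] in auto)
qed

end

text \<open>The exponents Q n of the overview; \<open>crit_exp d\<close> is the upper bound of the
  theorem.\<close>

definition crit_exp :: "nat \<Rightarrow> real" where "crit_exp n = 2 / (1 + 2 powr (1 - real n))"

lemma crit_exp_inverse: "1 / crit_exp n = 1 / 2 + 2 powr (- real n)"
  by (simp add: crit_exp_def powr_diff powr_minus field_simps)

lemma crit_exp_1: "crit_exp 1 = 1" and crit_exp_2: "crit_exp 2 = 4 / 3"
  by (simp_all add: crit_exp_def powr_minus)

lemma crit_exp_pos: "crit_exp n > 0"
  by (simp add: crit_exp_def add_pos_pos)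

lemma crit_exp_mono: "crit_exp n \<le> crit_exp (Suc n)"
  unfolding crit_exp_def by (intro divide_left_mono add_mono powr_mono) (auto intro!: mult_pos_pos add_pos_pos)

text \<open>With \<theta> = 2^{1-n} the exponents are those of Riesz-Thorin: 1/2 + \<theta>/4 on the
  right and 1/2 + \<theta>/2 on the left. The case n = 1 is the endpoint \<theta> = 1, where the
  bound from L^{4/3} to L^1 applies without interpolation.\<close>

lemma szego_op_contraction:
  assumes r: "0 \<le> r" "r < 1" and g: "bdd circ g" and n: "n \<ge> 1"
  shows "Lpnorm circ (crit_exp n) (szego_op r g) \<le> Lpnorm circ (crit_exp (Suc n)) g"
proof (cases "n = 1")
  case True
  then have "crit_exp (Suc n) = 4 / 3" "crit_exp n = 1" using crit_exp_1 crit_exp_2 by (metis Suc_1)+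
  then show ?thesis using szego_op_43_1[OF r g] by (simp only:)
next
  case False
  define \<theta> where "\<theta> = 2 powr (1 - real n)"
  have th: "0 < \<theta>" "\<theta> < 1" using False n by (auto simp: \<theta>_def powr_less_one)
  define b where "b = 2 / (1 - \<theta>)"
  have a: "1 / crit_exp (Suc n) = 1 / 2 + \<theta> / 4"
    unfolding crit_exp_inverse \<theta>_def by (simp add: powr_diff powr_minus field_simps powr_add)
  have b: "1 / b = (1 - \<theta>) / 2" by (simp add: b_def)
  have p: "1 / crit_exp n + 1 / b = 1"
    unfolding crit_exp_inverse b \<theta>_def by (simp add: powr_diff powr_minus field_simps)
  have "1 / crit_exp n = 1 / 2 + \<theta> / 2" unfolding crit_exp_inverse \<theta>_def by (simp add: powr_diff powr_minus field_simps)
  then have "1 / crit_exp n < 1" using th by simp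
  then have "crit_exp n > 1" using crit_exp_pos[of n] by (simp add: field_simps)
  then show ?thesis
    by (rule circ.dual_p[OF bdd_szego_op[OF r g] _ p])
       (use riesz_thorin[OF r g _ th a b] in \<open>auto simp: szego_form_def Lpnorm_nonneg\<close>)
qed

section \<open>The geometric mean on the circle\<close>

text \<open>The harmonic extension of z is z itself. This computes the mean square distance between
  \<open>cis2pi u\<close> and \<open>cis2pi t\<close> under the Poisson kernel, namely 2 -
  2s.\<close>

lemma int_poisson_cis2pi:
  assumes s: "0 < s" "s < 1"
  shows "poisson_op s cis2pi t = of_real s * cis2pi t"
proof -
  have s': "0 \<le> s" "s < 1" using s by auto
  let ?a = "of_real s * cis2pi t"
  have a: "cmod ?a < 1" "?a \<noteq> 0" using s by (auto simp: norm_mult)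
  have b: "bdd circ cis2pi" "bdd circ (\<lambda>u. cis2pi (- u))" by (auto intro!: continuous_bdd_circ continuous_intros)
  have 1: "szego_op s cis2pi t = ?a"
    using circle_cauchy[of "\<lambda>z. z" 2 ?a] a by (simp add: szego_op_eq_cauchy_trans cauchy_trans_def)
  have m: "(\<integral>u. cis2pi u \<partial>circ) = 0" using circle_mean[of "\<lambda>z. z" 2] by simp
  have bk: "bdd circ (\<lambda>u. szego s (t - u) * cis2pi (- u))" by (intro bdd_mult bdd_szego[OF s'] b)
  have "?a * (\<integral>u. szego s (t - u) * cis2pi (- u) \<partial>circ) = (\<integral>u. ?a * (szego s (t - u) * cis2pi (- u)) \<partial>circ)" by simp
  also have "\<dots> = (\<integral>u. szego s (t - u) - 1 \<partial>circ)"
  proof (rule Bochner_Integration.integral_cong[OF refl])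
    fix u show "?a * (szego s (t - u) * cis2pi (- u)) = szego s (t - u) - 1"
      unfolding szego_eq using one_minus_cis2pi_nz[OF a(1), of "- u"] by (simp add: field_simps)
  qed
  also have "\<dots> = 0" using bdd_circ_int[OF bdd_szego[OF s', of t]] by (simp add: int_szego[OF s'] circ.prob_space[unfolded space_circ])
  finally have 2: "(\<integral>u. szego s (t - u) * cis2pi (- u) \<partial>circ) = 0" using a(2) by simp
  have "conj_ext s cis2pi (cis2pi t) = 0"
  proof -
    have "szego_ext s (\<lambda>u. cnj (cis2pi u)) (cis2pi t) = 0" unfolding szego_ext_cis2pi[OF s'] using 2 by (simp add: szego_op_def cnj_cis2pi)
    moreover have "szego_ext s (\<lambda>u. cnj (cis2pi u)) 0 = 0" unfolding szego_ext_def[OF s'] cauchy_trans_def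
      using m by simp
    ultimately show ?thesis by (simp add: conj_ext_def[OF s'])
  qed
  then show ?thesis using poisson_op_split[OF s' b(1), of t] 1 by simp
qed

text \<open>A quantitative approximate identity for Lipschitz functions. The increment L y is at
  most \<eta> + L^2 y^2 / (4 \<eta>) by the inequality of arithmetic and geometric means, and the
  Poisson mean of y^2 is 2 - 2s for the chordal distance y.\<close>

lemma poisson_approx:
  fixes w :: "real \<Rightarrow> real"
  assumes s: "0 < s" "s < 1" and w: "bdd circ w"
    and L: "\<And>u. \<bar>w u - w t\<bar> \<le> L * cmod (cis2pi u - cis2pi t)" and eta: "\<eta> > 0"
  shows "\<bar>poisson_avg s w t - w t\<bar> \<le> \<eta> + L\<^sup>2 / (4 * \<eta>) * (2 - 2 * s)"
proof -
  have s': "0 \<le> s" "s < 1" using s by auto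
  have b: "bdd circ cis2pi" by (auto intro!: continuous_bdd_circ continuous_intros)
  note bp = bdd_poisson[OF s', of t]
  let ?K = "L\<^sup>2 / (4 * \<eta>)"
  let ?c = "\<lambda>u. Re (cis2pi u * cis2pi (- t))"
  let ?d = "\<lambda>u. poisson s (t - u) * w u - poisson s (t - u) * w t"
  have sq: "(cmod (cis2pi u - cis2pi t))\<^sup>2 = 2 - 2 * ?c u" for u
  proof -
    have "(cmod (cis2pi u - cis2pi t))\<^sup>2 = (cmod (cis2pi u))\<^sup>2 + (cmod (cis2pi t))\<^sup>2 - 2 * Re (cis2pi u * cnj (cis2pi t))"
      unfolding cmod_power2 by (simp add: power2_eq_square algebra_simps)
    then show ?thesis by (simp add: cnj_cis2pi)
  qed
  have be: "bdd circ (\<lambda>u. ?c u)" by (intro bdd_Re bdd_mult b bdd_const)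
  have I: "poisson_avg s (\<lambda>u. ?c u) t = s"
  proof -
    have re: "Re (of_real x * z) = x * Re z" for x z by simp
    have "poisson_avg s (\<lambda>u. ?c u) t = (\<integral>u. Re (of_real (poisson s (t - u)) * cis2pi u * cis2pi (- t)) \<partial>circ)"
      unfolding poisson_avg_def[OF s'] by (rule Bochner_Integration.integral_cong[OF refl]) (simp only: mult.assoc re)
    also have "\<dots> = Re (\<integral>u. of_real (poisson s (t - u)) * cis2pi u * cis2pi (- t) \<partial>circ)"
      by (intro integral_Re bdd_circ_int bdd_mult bdd_of_real bp b bdd_const)
    also have "(\<integral>u. of_real (poisson s (t - u)) * cis2pi u * cis2pi (- t) \<partial>circ) = poisson_op s cis2pi t * cis2pi (- t)"
      by (simp add: poisson_op_def[OF s'])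
    also have "poisson_op s cis2pi t * cis2pi (- t) = of_real s" by (simp add: int_poisson_cis2pi[OF s] cis2pi_minus)
    finally show ?thesis by (simp only: Re_complex_of_real)
  qed
  have "poisson_avg s w t - w t = (\<integral>u. poisson s (t - u) * w u \<partial>circ) - (\<integral>u. poisson s (t - u) * w t \<partial>circ)"
    by (simp add: poisson_avg_def[OF s'] int_poisson[OF s'])
  also have "\<dots> = (\<integral>u. ?d u \<partial>circ)"
    by (intro Bochner_Integration.integral_diff[symmetric] bdd_circ_int bdd_mult bp w bdd_const)
  finally have "\<bar>poisson_avg s w t - w t\<bar> \<le> (\<integral>u. \<bar>?d u\<bar> \<partial>circ)"
    by (simp only: integral_abs_bound)
  also have "\<dots> \<le> (\<integral>u. poisson s (t - u) * (\<eta> + ?K * (2 - 2 * ?c u)) \<partial>circ)"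
  proof (rule integral_mono)
    show "integrable circ (\<lambda>u. \<bar>?d u\<bar>)"
      using bdd_norm[OF bdd_diff[OF bdd_mult[OF bp w] bdd_mult[OF bp bdd_const[of _ "w t"]]]] by (intro bdd_circ_int) simp
    show "integrable circ (\<lambda>u. poisson s (t - u) * (\<eta> + ?K * (2 - 2 * ?c u)))"
      by (intro bdd_circ_int bdd_mult bdd_add bdd_diff bdd_const bp be)
    fix u
    define x where "x = cmod (cis2pi u - cis2pi t)"
    have "0 \<le> (2 * \<eta> - L * x)\<^sup>2" by simp
    then have "4 * \<eta> * (L * x) \<le> 4 * \<eta>\<^sup>2 + L\<^sup>2 * x\<^sup>2" by (simp add: power2_eq_square algebra_simps)
    then have "L * x \<le> \<eta> + ?K * x\<^sup>2" using eta by (simp add: field_simps power2_eq_square)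
    then have "\<bar>w u - w t\<bar> \<le> \<eta> + ?K * (2 - 2 * ?c u)"
      using L[of u] sq[of u] unfolding x_def by simp
    then have "poisson s (t - u) * \<bar>w u - w t\<bar> \<le> poisson s (t - u) * (\<eta> + ?K * (2 - 2 * ?c u))"
      by (rule mult_left_mono) (rule poisson_nonneg[OF s'])
    moreover have "\<bar>?d u\<bar> = poisson s (t - u) * \<bar>w u - w t\<bar>"
      using poisson_nonneg[OF s', of "t - u"] by (simp add: abs_mult flip: right_diff_distrib)
    ultimately show "\<bar>?d u\<bar> \<le> poisson s (t - u) * (\<eta> + ?K * (2 - 2 * ?c u))"
      by simp
  qed
  also have "\<dots> = (\<integral>u. (\<eta> + ?K * 2) * poisson s (t - u) - ?K * 2 * (poisson s (t - u) * ?c u) \<partial>circ)"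
    by (rule Bochner_Integration.integral_cong) (auto simp: algebra_simps simp del: times_complex.sel)
  also have "\<dots> = (\<integral>u. (\<eta> + ?K * 2) * poisson s (t - u) \<partial>circ) - (\<integral>u. ?K * 2 * (poisson s (t - u) * ?c u) \<partial>circ)"
    by (intro Bochner_Integration.integral_diff bdd_circ_int bdd_mult bdd_const bp be)
  also have "\<dots> = (\<eta> + ?K * 2) * 1 - ?K * 2 * s"
    unfolding integral_mult_right_zero int_poisson[OF s'] I[unfolded poisson_avg_def[OF s']] ..
  also have "(\<eta> + K * 2) * 1 - K * 2 * s = \<eta> + K * (2 - 2 * s)" for K :: real by (simp add: algebra_simps)
  finally show ?thesis .
qed

lemma ln_lipschitz:
  fixes a b \<epsilon> :: real
  assumes "\<epsilon> > 0" "a \<ge> 0" "b \<ge> 0"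
  shows "\<bar>ln (a + \<epsilon>) - ln (b + \<epsilon>)\<bar> \<le> \<bar>a - b\<bar> / \<epsilon>"
proof -
  have *: "ln (a + \<epsilon>) - ln (b + \<epsilon>) \<le> \<bar>a - b\<bar> / \<epsilon>" if "a \<ge> 0" "b \<ge> 0" for a b :: real
  proof -
    have "ln (a + \<epsilon>) - ln (b + \<epsilon>) \<le> ((a + \<epsilon>) - (b + \<epsilon>)) / (b + \<epsilon>)"
      using that assms by (intro ln_diff_le) auto
    also have "\<dots> \<le> \<bar>a - b\<bar> / \<epsilon>" using that assms by (intro frac_le) auto
    finally show ?thesis .
  qed
  show ?thesis using *[of a b] *[of b a] assms by (simp add: abs_minus_commute abs_le_iff)
qed

text \<open>Let A extend the projection analytically, w = ln (|A| + \<epsilon>), and m be the mean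
  of w. Take U outer with modulus close to |A| + \<epsilon> on the circle and U(0) = e^m, and put h
  = A / U. The pairing I of A with h is evaluated twice. As h is analytic and almost bounded by 1,
  self-adjointness gives |I| \<le> e^\<delta> times the L^1 norm of \<phi>. As A cnj h = |A|^2 / cnj
  U is close to U, I is close to the mean of U, which is e^m.\<close>

lemma szego_op_geo_mean:
  assumes r: "0 \<le> r" "r < 1" and phi: "bdd circ \<phi>" and eps: "\<epsilon> > 0"
  shows "exp (\<integral>t. ln (cmod (szego_op r \<phi> t) + \<epsilon>) \<partial>circ) \<le> (\<integral>u. cmod (\<phi> u) \<partial>circ) + 2 * \<epsilon>"
proof -
  define A where "A = szego_ext r \<phi>"
  have A: "A holomorphic_on ball 0 (ext_radius r)" unfolding A_def by (rule szego_ext_holomorphic[OF r phi])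
  note ext_radius = ext_radius_gt[OF r]
  have Aee: "A (cis2pi t) = szego_op r \<phi> t" for t by (simp add: A_def szego_ext_cis2pi[OF r])
  have sub: "cball 0 1 \<subseteq> ball (0::complex) (ext_radius r)" using ext_radius by auto
  have "compact (A ` cball 0 1)"
    by (intro compact_continuous_image compact_cball continuous_on_subset[OF holomorphic_on_imp_continuous_on[OF A] sub])
  moreover have "compact (deriv A ` cball 0 1)"
    by (intro compact_continuous_image compact_cball
      continuous_on_subset[OF holomorphic_on_imp_continuous_on[OF holomorphic_deriv[OF A open_ball]] sub])
  ultimately have "\<exists>M>0. \<forall>z\<in>cball 0 1. cmod (A z) \<le> M" "\<exists>L>0. \<forall>z\<in>cball 0 1. cmod (deriv A z) \<le> L"
    unfolding compact_eq_bounded_closed bounded_pos by auto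
  then obtain M L where M: "M > 0" "\<And>z. cmod z \<le> 1 \<Longrightarrow> cmod (A z) \<le> M"
    and L: "L > 0" "\<And>z. cmod z \<le> 1 \<Longrightarrow> cmod (deriv A z) \<le> L" by auto
  have lip: "cmod (A z - A z') \<le> L * cmod (z - z')" if "cmod z \<le> 1" "cmod z' \<le> 1" for z z'
  proof (rule field_differentiable_bound[of "cball 0 1" A "deriv A" L])
    show "(A has_field_derivative deriv A x) (at x within cball 0 1)" if "x \<in> cball 0 1" for x
      using that sub by (intro holomorphic_derivI[OF A open_ball]) auto
    show "cmod (deriv A x) \<le> L" if "x \<in> cball 0 1" for x using L(2)[of x] that by simp
  qed (use that in simp_all)
  define w where "w t = ln (cmod (A (cis2pi t)) + \<epsilon>)" for t
  have wlip: "\<bar>w u - w t\<bar> \<le> (L / \<epsilon>) * cmod (cis2pi u - cis2pi t)" for u t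
  proof -
    have "\<bar>w u - w t\<bar> \<le> \<bar>cmod (A (cis2pi u)) - cmod (A (cis2pi t))\<bar> / \<epsilon>"
      unfolding w_def by (rule ln_lipschitz[OF eps]) auto
    also have "\<dots> \<le> (L * cmod (cis2pi u - cis2pi t)) / \<epsilon>"
      using norm_triangle_ineq3[of "A (cis2pi u)" "A (cis2pi t)"] lip[of "cis2pi u" "cis2pi t"] eps by (intro divide_right_mono) auto
    finally show ?thesis by simp
  qed
  have bw: "bdd circ w"
    unfolding w_def using ext_radius eps
    by (intro continuous_bdd_circ continuous_intros continuous_on_compose2[OF holomorphic_on_imp_continuous_on[OF A]])
       (auto simp: add_nonneg_eq_0_iff)
  have expw: "exp (w t) = cmod (A (cis2pi t)) + \<epsilon>" for t
    unfolding w_def using eps by (simp add: add_nonneg_pos)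
  define m where "m = (\<integral>t. w t \<partial>circ)"
  \<comment> \<open>Bound for the distance of U and A cnj h on the circle: the first factor bounds
    the difference of |U| and |A|, the second bounds 1 + |h|. It tends to 2 \<epsilon> as \<delta>
    tends to 0.\<close>
  let ?E = "\<lambda>\<delta>. ((M + \<epsilon>) * (exp \<delta> - 1) + \<epsilon>) * (1 + exp \<delta>)"
  let ?N = "\<integral>u. cmod (\<phi> u) \<partial>circ"
  have main: "exp m \<le> exp \<delta> * ?N + ?E \<delta>"
    if delta: "\<delta> > 0" for \<delta>
  proof -
    \<comment> \<open>\<open>c\<close> is the constant of \<open>poisson_approx\<close> for the
      tolerance \<delta>/2; \<open>s\<close> is then so close to 1 that the second error term is at
      most \<delta>/2 too. The minimum keeps \<open>s\<close> positive.\<close>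
    define c where "c = (L / \<epsilon>)\<^sup>2 / (4 * (\<delta> / 2))"
    have c: "c > 0" using L eps delta by (simp add: c_def)
    define s where "s = 1 - min (1/2) (\<delta> / (4 * c))"
    have s: "0 < s" "s < 1" using c delta by (auto simp: s_def)
    then have s': "0 \<le> s" "s < 1" by auto
    have "c * (2 - 2 * s) \<le> \<delta> / 2"
    proof -
      have "2 - 2 * s \<le> \<delta> / (2 * c)" by (simp add: s_def min_le_iff_disj)
      then show ?thesis using c by (simp add: field_simps)
    qed
    then have ws: "\<bar>poisson_avg s w t - w t\<bar> \<le> \<delta>" for t
      using poisson_approx[OF s bw wlip, of "\<delta> / 2" t] delta unfolding c_def by linarith
    define w' where "w' t = complex_of_real (w t)" for t
    have bw': "bdd circ w'" unfolding w'_def by (rule bdd_of_real[OF bw])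
    \<comment> \<open>Twice the Szego integral minus the mean has the Poisson integral of
      \<open>w\<close> as its real part, so \<open>U\<close> is outer. Dilating by
      \<open>s < 1\<close> makes it analytic across the unit circle.\<close>
    define U where "U z = exp (2 * szego_ext s w' z - of_real m)" for z
    have U: "U holomorphic_on ball 0 (ext_radius s)"
      unfolding U_def by (intro holomorphic_intros szego_ext_holomorphic[OF s' bw'])
    have Unz: "U z \<noteq> 0" for z by (simp add: U_def)
    have U0: "U 0 = of_real (exp m)"
    proof -
      have "szego_ext s w' 0 = of_real m" by (simp add: szego_ext_def[OF s'] cauchy_trans_def w'_def m_def)
      then show ?thesis by (simp add: U_def exp_of_real)
    qed
    have nU: "cmod (U (cis2pi t)) = exp (poisson_avg s w t)" for t
    proof -
      have "poisson_avg s w t = (\<integral>u. 2 * Re (szego s (t - u) * w' u) - w u \<partial>circ)"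
        unfolding poisson_avg_def[OF s'] by (rule Bochner_Integration.integral_cong) (auto simp: poisson_def w'_def algebra_simps)
      also have "\<dots> = (\<integral>u. 2 * Re (szego s (t - u) * w' u) \<partial>circ) - m"
        unfolding m_def by (intro Bochner_Integration.integral_diff bdd_circ_int bdd_mult bdd_const bdd_Re bdd_szego s' bw bw')
      also have "(\<integral>u. 2 * Re (szego s (t - u) * w' u) \<partial>circ) = 2 * Re (szego_op s w' t)"
        unfolding szego_op_def integral_mult_right_zero
        by (subst integral_Re) (auto intro!: bdd_circ_int bdd_mult bdd_szego s' bw')
      finally show ?thesis by (simp add: U_def szego_ext_cis2pi[OF s'])
    qed
    define R where "R = min (ext_radius r) (ext_radius s)"
    have R: "R > 1" using ext_radius ext_radius_gt[OF s'] by (simp add: R_def)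
    define h where "h z = A z / U z" for z
    have h: "h holomorphic_on ball 0 R"
      unfolding h_def R_def
      by (intro holomorphic_intros holomorphic_on_subset[OF A] holomorphic_on_subset[OF U] Unz) auto
    have AU: "cmod (A (cis2pi t)) \<le> exp \<delta> * cmod (U (cis2pi t))" for t
    proof -
      have "cmod (A (cis2pi t)) \<le> exp (w t)" using expw eps by simp
      also have "\<dots> \<le> exp (\<delta> + poisson_avg s w t)" using ws[of t] by (subst exp_le_cancel_iff) linarith
      finally show ?thesis by (simp add: exp_add nU)
    qed
    have hle: "cmod (h z) \<le> exp \<delta>" if z: "cmod z \<le> 1" for z
    proof (rule maximum_modulus_frontier[of h "cball 0 1"])
      show "h holomorphic_on interior (cball 0 1)" by (rule holomorphic_on_subset[OF h]) (use R in auto)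
      show "continuous_on (closure (cball 0 1)) h"
        by (rule continuous_on_subset[OF holomorphic_on_imp_continuous_on[OF h]]) (use R in auto)
      fix z :: complex assume "z \<in> frontier (cball 0 1)"
      then have "cmod z = 1" by simp
      then obtain x where x: "z = cis x" by (metis complex_norm_eq_1_exp cis_conv_exp)
      have "z = cis2pi (x / (2 * pi))" unfolding x cis2pi_def by simp
      then show "cmod (h z) \<le> exp \<delta>" using AU[of "x / (2 * pi)"] Unz[of z]
        by (simp add: h_def norm_divide divide_le_eq)
    qed (use z in auto)
    define hh where "hh t = h (cis2pi t)" for t
    have bA: "bdd circ (\<lambda>t. A (cis2pi t))" unfolding Aee by (rule bdd_szego_op[OF r phi])
    have cont: "continuous_on UNIV (\<lambda>t. F (cis2pi t))" if "F holomorphic_on ball 0 R" for F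
      by (intro continuous_on_compose2[OF holomorphic_on_imp_continuous_on[OF that]] continuous_intros) (use R in auto)
    have bh: "bdd circ hh" unfolding hh_def by (rule continuous_bdd_circ[OF cont[OF h]])
    have bU: "bdd circ (\<lambda>t. U (cis2pi t))" 
      by (rule continuous_bdd_circ[OF cont]) (rule holomorphic_on_subset[OF U], auto simp: R_def)
    \<comment> \<open>As \<open>h\<close> is analytic, projecting its boundary values merely dilates
      it, and the maximum principle still bounds the result.\<close>
    have oph: "szego_op r hh u = h (of_real r * cis2pi u)" for u
      using circle_cauchy[OF h R, of "of_real r * cis2pi u"] r by (simp add: szego_op_eq_cauchy_trans cauchy_trans_def hh_def norm_mult)
    define I where "I = (\<integral>t. A (cis2pi t) * cnj (hh t) \<partial>circ)"
    have "I = szego_form r \<phi> (\<lambda>t. cnj (hh t))"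
      unfolding I_def szego_form_def Aee by (simp add: mult.commute)
    also have "\<dots> = (\<integral>u. \<phi> u * cnj (h (of_real r * cis2pi u)) \<partial>circ)"
      by (subst szego_form_swap[OF r phi bdd_cnj[OF bh]]) (simp add: oph)
    also have "cmod \<dots> \<le> (\<integral>u. cmod (\<phi> u * cnj (h (of_real r * cis2pi u))) \<partial>circ)"
      by (rule integral_norm_bound)
    also have "\<dots> \<le> (\<integral>u. exp \<delta> * cmod (\<phi> u) \<partial>circ)"
    proof (rule integral_mono')
      show "integrable circ (\<lambda>u. exp \<delta> * cmod (\<phi> u))" by (intro bdd_circ_int bdd_mult bdd_const bdd_norm phi)
      show "cmod (\<phi> u * cnj (h (of_real r * cis2pi u))) \<le> exp \<delta> * cmod (\<phi> u)" for u
        using hle[of "of_real r * cis2pi u"] r by (simp add: norm_mult mult.commute[of "exp \<delta>"] mult_left_mono)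
    qed simp
    finally have I1: "cmod I \<le> exp \<delta> * ?N" by simp
    have "(\<integral>t. U (cis2pi t) \<partial>circ) = of_real (exp m)"
      using circle_mean[OF U ext_radius_gt[OF s']] U0 by simp
    then have "of_real (exp m) - I = (\<integral>t. U (cis2pi t) - A (cis2pi t) * cnj (hh t) \<partial>circ)"
      unfolding I_def by (subst Bochner_Integration.integral_diff) (auto intro!: bdd_circ_int bU bdd_mult bA bdd_cnj bh)
    also have "cmod \<dots> \<le> ?E \<delta>"
    proof (rule circ.integral_bound)
      show "0 \<le> ?E \<delta>"
        using M eps delta by (intro mult_nonneg_nonneg add_nonneg_nonneg) auto
      fix t
      define a v where "a = cmod (A (cis2pi t))" and "v = cmod (U (cis2pi t))"
      have v: "v > 0" using Unz by (simp add: v_def)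
      \<comment> \<open>Both terms are put over cnj U: U = |U|^2 / cnj U and A cnj h = |A|^2 / cnj
        U.\<close>
      have "U (cis2pi t) - A (cis2pi t) * cnj (hh t) = (U (cis2pi t) * cnj (U (cis2pi t)) - A (cis2pi t) * cnj (A (cis2pi t))) / cnj (U (cis2pi t))"
        using Unz[of "cis2pi t"] by (simp add: hh_def h_def field_simps)
      also have "\<dots> = of_real (v\<^sup>2 - a\<^sup>2) / cnj (U (cis2pi t))"
        unfolding v_def a_def by (simp only: of_real_diff complex_norm_square)
      finally have "cmod (U (cis2pi t) - A (cis2pi t) * cnj (hh t)) = \<bar>v\<^sup>2 - a\<^sup>2\<bar> / v"
        by (simp only: norm_divide norm_of_real complex_mod_cnj v_def)
      also have "\<dots> = \<bar>v - a\<bar> * (1 + a / v)"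
      proof -
        have "v\<^sup>2 - a\<^sup>2 = (v - a) * (v + a)" by (simp add: power2_eq_square algebra_simps)
        moreover have "v + a \<ge> 0" using v by (simp add: a_def)
        ultimately have "\<bar>v\<^sup>2 - a\<^sup>2\<bar> = \<bar>v - a\<bar> * (v + a)" by (simp only: abs_mult abs_of_nonneg)
        then show ?thesis using v by (simp add: field_simps)
      qed
      also have "\<dots> \<le> ?E \<delta>"
      proof (rule mult_mono)
        show "1 + a / v \<le> 1 + exp \<delta>" using AU[of t] v by (simp add: a_def v_def divide_le_eq)
        have aM: "a \<le> M" unfolding a_def by (rule M) simp
        have ve: "v = exp (w t) * exp (poisson_avg s w t - w t)" by (simp add: v_def nU flip: exp_add)
        have "exp (poisson_avg s w t - w t) \<le> exp \<delta>" "exp (- \<delta>) \<le> exp (poisson_avg s w t - w t)"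
          using ws[of t] by (auto simp: abs_le_iff)
        \<comment> \<open>Equivalent to cosh \<delta> \<ge> 1; one bound then serves for deviations
          of the exponential in both directions.\<close>
        moreover have "1 - exp (- \<delta>) \<le> exp \<delta> - 1"
        proof -
          have "0 \<le> (exp (\<delta> / 2) - exp (- \<delta> / 2))\<^sup>2" by simp
          then show ?thesis by (simp add: power2_eq_square algebra_simps flip: exp_add)
        qed
        ultimately have "\<bar>exp (poisson_avg s w t - w t) - 1\<bar> \<le> exp \<delta> - 1" by linarith
        then have "exp (w t) * \<bar>exp (poisson_avg s w t - w t) - 1\<bar> \<le> (M + \<epsilon>) * (exp \<delta> - 1)"
          using expw[of t] aM M eps by (intro mult_mono) (auto simp: a_def)
        moreover have "\<bar>v - exp (w t)\<bar> = exp (w t) * \<bar>exp (poisson_avg s w t - w t) - 1\<bar>"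
        proof -
          have "v - exp (w t) = exp (w t) * (exp (poisson_avg s w t - w t) - 1)" unfolding ve by (simp add: algebra_simps)
          then show ?thesis by (simp add: abs_mult)
        qed
        moreover have "exp (w t) = a + \<epsilon>" using expw by (simp add: a_def)
        ultimately show "\<bar>v - a\<bar> \<le> (M + \<epsilon>) * (exp \<delta> - 1) + \<epsilon>" using eps by linarith
        show "0 \<le> (M + \<epsilon>) * (exp \<delta> - 1) + \<epsilon>" using M eps delta by (intro add_nonneg_nonneg mult_nonneg_nonneg) auto
        show "0 \<le> 1 + a / v" using v by (simp add: a_def)
      qed
      finally show "cmod (U (cis2pi t) - A (cis2pi t) * cnj (hh t)) \<le> ?E \<delta>" .
    qed
    finally have I2: "cmod (of_real (exp m) - I) \<le> ?E \<delta>" .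
    have "exp m = cmod (complex_of_real (exp m))" by simp
    also have "\<dots> \<le> cmod I + cmod (of_real (exp m) - I)"
      by (rule norm_triangle_sub)
    finally show ?thesis using I1 I2 by linarith
  qed
  have "((\<lambda>\<delta>. exp \<delta> * ?N + ?E \<delta>) \<longlongrightarrow>
     exp 0 * ?N + ((M + \<epsilon>) * (exp 0 - 1) + \<epsilon>) * (1 + exp 0)) (at_right 0)"
    by (intro tendsto_intros)
  moreover have "\<forall>\<^sub>F \<delta> in at_right 0. exp m \<le> exp \<delta> * ?N + ?E \<delta>"
    using eventually_at_right_less[of "0::real"] by (rule eventually_mono) (rule main)
  ultimately have "exp m \<le> exp 0 * ?N + ((M + \<epsilon>) * (exp 0 - 1) + \<epsilon>) * (1 + exp 0)"
    by (intro tendsto_lowerbound) auto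
  then show ?thesis by (simp add: m_def w_def Aee)
qed

section \<open>Iteration over the coordinates\<close>

definition coord_op :: "nat \<Rightarrow> real \<Rightarrow> ((nat \<Rightarrow> real) \<Rightarrow> complex) \<Rightarrow> (nat \<Rightarrow> real) \<Rightarrow> complex" where
  "coord_op j r g t = szego_op r (\<lambda>u. g (t(j := u))) (t j)"

lemma coord_op_slice: "coord_op j r g (t(j := s)) = szego_op r (\<lambda>u. g (t(j := u))) s"
  by (simp add: coord_op_def)

fun iter_op :: "nat \<Rightarrow> real \<Rightarrow> ((nat \<Rightarrow> real) \<Rightarrow> complex) \<Rightarrow> (nat \<Rightarrow> real) \<Rightarrow> complex" where
  "iter_op 0 r g = g"
| "iter_op (Suc n) r g = coord_op n r (iter_op n r g)"

lemma bdd_slice_torus: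
  assumes "j < d" "bdd (torus d) g" "t \<in> space (torus d)"
  shows "bdd circ (\<lambda>u. g (t(j := u)))"
  using bdd_slice[OF bdd_upd_torus[OF assms(1,2)] assms(3)] .

text \<open>A concave power lies below its tangent at \<open>m\<close>; this is weighted Young,
  multiplied by a power of \<open>m\<close>. Integrating it with \<open>m\<close> the mean is
  Jensen's inequality in the next lemma.\<close>

lemma powr_jensen:
  fixes x m c :: real
  assumes "x \<ge> 0" "m > 0" "0 < c" "c \<le> 1"
  shows "x powr c \<le> m powr c + c * m powr (c - 1) * (x - m)"
proof (cases "x = 0 \<or> c = 1")
  case True
  have "m powr (c - 1) * m = m powr c" using assms by (simp add: powr_diff)
  then have "c * m powr (c - 1) * m = c * m powr c" by simp
  moreover have "c * m powr c \<le> m powr c" using assms by (simp add: mult_left_le_one_le)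
  ultimately show ?thesis using True assms by (auto simp: algebra_simps)
next
  case False
  have "x powr c * m powr (1 - c) \<le> c * x + (1 - c) * m"
    using assms False by (intro Youngs_inequality_0) auto
  then have "x powr c * m powr (1 - c) * m powr (c - 1) \<le> (c * x + (1 - c) * m) * m powr (c - 1)"
    by (intro mult_right_mono) auto
  moreover have "x powr c * m powr (1 - c) * m powr (c - 1) = x powr c" using assms
    by (simp add: mult.assoc flip: powr_add)
  moreover have "m powr (c - 1) * m = m powr c" using assms by (simp add: powr_diff)
  then have "(c * x + (1 - c) * m) * m powr (c - 1) = m powr c + c * m powr (c - 1) * (x - m)"
    by (simp add: algebra_simps)
  ultimately show ?thesis by simp
qed

lemma (in prob_space) powr_integral_le:
  fixes X :: "'a \<Rightarrow> real"
  assumes X: "bdd M X" "\<And>x. x \<in> space M \<Longrightarrow> X x \<ge> 0" and c: "0 < c" "c \<le> 1"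
  shows "(\<integral>x. X x powr c \<partial>M) \<le> (\<integral>x. X x \<partial>M) powr c"
proof -
  define m where "m = (\<integral>x. X x \<partial>M)"
  have m0: "m \<ge> 0" unfolding m_def by (rule integral_nonneg_AE) (use X in auto)
  have eq: "(\<integral>x. X x powr c \<partial>M) = (\<integral>x. norm (X x) powr c \<partial>M)"
    by (rule Bochner_Integration.integral_cong) (use X(2) in auto)
  show ?thesis
  proof (cases "m = 0")
    case True
    then have "AE x in M. X x = 0"
      using integral_nonneg_eq_0_iff_AE[OF bdd_int[OF X(1)]] X(2) by (simp add: m_def)
    then have "Lpnorm M c X = 0" by (rule AE_0_Lpnorm[OF _ X(1) c(1)])
    then show ?thesis unfolding eq by (simp add: Lpnorm_def)
  next
    case False
    then have m: "m > 0" using m0 by simp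
    have "(\<integral>x. norm (X x) powr c \<partial>M) \<le> (\<integral>x. m powr c + c * m powr (c - 1) * (X x - m) \<partial>M)"
    proof (rule integral_mono)
      show "integrable M (\<lambda>x. norm (X x) powr c)" by (intro bdd_int bdd_powr X) (use c in auto)
      show "integrable M (\<lambda>x. m powr c + c * m powr (c - 1) * (X x - m))"
        by (intro bdd_int bdd_add bdd_mult bdd_diff bdd_const X)
      show "norm (X x) powr c \<le> m powr c + c * m powr (c - 1) * (X x - m)" if "x \<in> space M" for x
        using powr_jensen[OF X(2)[OF that] m c] X(2)[OF that] by simp
    qed
    also have "\<dots> = (\<integral>x. m powr c \<partial>M) + c * m powr (c - 1) * ((\<integral>x. X x \<partial>M) - (\<integral>x. m \<partial>M))"
      using bdd_int[OF X(1)] by simp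
    also have "\<dots> = m powr c" by (simp add: prob_space m_def[symmetric])
    finally show ?thesis unfolding eq m_def .
  qed
qed

lemma (in prob_space) Lpnorm_mono_exponent:
  assumes "bdd M f" "0 < p" "p \<le> q"
  shows "Lpnorm M p f \<le> Lpnorm M q f"
proof -
  have "(\<integral>x. norm (f x) powr p \<partial>M) = (\<integral>x. (norm (f x) powr q) powr (p / q) \<partial>M)"
    using assms by (simp add: powr_powr)
  also have "\<dots> \<le> (\<integral>x. norm (f x) powr q \<partial>M) powr (p / q)"
    using assms by (intro powr_integral_le bdd_powr) auto
  also have "\<dots> = Lpnorm M q f powr p"
    using assms by (simp add: Lpnorm_def powr_powr)
  finally show ?thesis using assms by (subst Lpnorm_le_iff) (auto simp: Lpnorm_nonneg)
qed

context
  fixes r :: real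
  assumes r: "0 \<le> r" "r < 1"
begin

lemma bdd_coord_op:
  assumes j: "j < d" and g: "bdd (torus d) g"
  shows "bdd (torus d) (coord_op j r g)"
proof -
  have k: "(\<lambda>(t, u). szego r (t j - u)) \<in> borel_measurable (torus d \<Otimes>\<^sub>M circ)"
    using j by measurable
  have "bdd (torus d \<Otimes>\<^sub>M circ) (\<lambda>(t, u). szego r (t j - u))"
    by (rule bddI[OF k, of "1 / (1 - r)"]) (auto simp: norm_szego_le[OF r])
  from bdd_mult[OF this bdd_upd_torus[OF j g]]
  have "bdd (torus d \<Otimes>\<^sub>M circ) (\<lambda>(t, u). szego r (t j - u) * g (t(j := u)))"
    by (simp add: case_prod_unfold)
  then show ?thesis unfolding coord_op_def[abs_def] szego_op_def by (rule circ.bdd_integral_snd)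
qed

lemma bdd_iter_op: "bdd (torus d) g \<Longrightarrow> n \<le> d \<Longrightarrow> bdd (torus d) (iter_op n r g)"
  by (induction n) (auto intro!: bdd_coord_op)

text \<open>The one-variable bound on slices produces slice means raised to the power
  \<open>p / q \<le> 1\<close>. Jensen's inequality over the remaining variables pulls this power
  outside, so the exponent changes for all variables at once and no mixed norms arise.\<close>

lemma coord_op_Lpnorm:
  assumes j: "j < d" and g: "bdd (torus d) g" and pq: "0 < p" "p \<le> q" and C: "C \<ge> 0"
    and op: "\<And>\<phi>. bdd circ \<phi> \<Longrightarrow> Lpnorm circ p (szego_op r \<phi>) \<le> C * Lpnorm circ q \<phi>"
  shows "Lpnorm (torus d) p (coord_op j r g) \<le> C * Lpnorm (torus d) q g"
proof -
  have q: "q > 0" using pq by simp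
  define X where "X t = (\<integral>u. norm (g (t(j := u))) powr q \<partial>circ)" for t
  have bq: "bdd (torus d) (\<lambda>t. norm (g t) powr q)" by (rule bdd_powr[OF g]) (use q in auto)
  have bX: "bdd (torus d) X"
    unfolding X_def by (rule circ.bdd_integral_snd[OF bdd_upd_torus[OF j bq]])
  have X0: "X t \<ge> 0" for t unfolding X_def by (rule integral_nonneg_AE) simp
  have bp: "bdd (torus d) (\<lambda>t. norm (coord_op j r g t) powr p)"
    by (rule bdd_powr[OF bdd_coord_op[OF j g]]) (use pq in auto)
  have "(\<integral>t. norm (coord_op j r g t) powr p \<partial>torus d) = (\<integral>t. (\<integral>s. norm (coord_op j r g (t(j := s))) powr p \<partial>circ) \<partial>torus d)"
    by (rule torus_average[OF j bp])
  also have "\<dots> \<le> (\<integral>t. C powr p * norm (X t) powr (p / q) \<partial>torus d)"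
  proof (rule integral_mono)
    show "integrable (torus d) (\<lambda>t. \<integral>s. norm (coord_op j r g (t(j := s))) powr p \<partial>circ)"
      by (intro torus.bdd_int circ.bdd_integral_snd bdd_upd_torus[OF j bp])
    show "integrable (torus d) (\<lambda>t. C powr p * norm (X t) powr (p / q))"
      by (intro torus.bdd_int bdd_mult bdd_const bdd_powr bX) (use pq in auto)
    fix t assume t: "t \<in> space (torus d)"
    let ?\<phi> = "\<lambda>u. g (t(j := u))"
    have "(\<integral>s. norm (szego_op r ?\<phi> s) powr p \<partial>circ) \<le> (C * Lpnorm circ q ?\<phi>) powr p"
      using op[OF bdd_slice_torus[OF j g t]] pq C by (subst (asm) Lpnorm_le_iff) (auto simp: Lpnorm_nonneg)
    also have "\<dots> = C powr p * X t powr (p / q)"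
      using C pq X0[of t] by (simp add: powr_mult Lpnorm_nonneg) (simp add: Lpnorm_def X_def powr_powr)
    finally show "(\<integral>s. norm (coord_op j r g (t(j := s))) powr p \<partial>circ) \<le> C powr p * norm (X t) powr (p / q)"
      using X0[of t] by (simp add: coord_op_slice)
  qed
  also have "\<dots> = C powr p * (\<integral>t. norm (X t) powr (p / q) \<partial>torus d)" by simp
  also have "\<dots> \<le> C powr p * (\<integral>t. norm (X t) \<partial>torus d) powr (p / q)"
    using pq by (intro mult_left_mono torus.powr_integral_le bdd_norm bX) auto
  also have "(\<integral>t. norm (X t) \<partial>torus d) = (\<integral>t. norm (g t) powr q \<partial>torus d)"
    using torus_average[OF j bq] X0 by (simp add: X_def)
  also have "C powr p * (\<integral>t. norm (g t) powr q \<partial>torus d) powr (p / q) = (C * Lpnorm (torus d) q g) powr p"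
    using C pq by (simp add: powr_mult Lpnorm_nonneg) (simp add: Lpnorm_def powr_powr)
  finally show ?thesis
    using pq C by (subst Lpnorm_le_iff) (auto simp: Lpnorm_nonneg)
qed

text \<open>The coordinate treated last takes the exponent from \<open>crit_exp (m + 1)\<close> to
  \<open>crit_exp m\<close>, so the earlier ones must end at \<open>m + 1\<close> instead of
  \<open>m\<close>; hence the induction over all \<open>m\<close>.\<close>

lemma iter_op_contraction:
  assumes "bdd (torus d) g" "n \<le> d" "m \<ge> 1"
  shows "Lpnorm (torus d) (crit_exp m) (iter_op n r g) \<le> Lpnorm (torus d) (crit_exp (m + n)) g"
  using assms(2,3)
proof (induction n arbitrary: m)
  case (Suc n)
  have "Lpnorm (torus d) (crit_exp m) (iter_op (Suc n) r g) \<le> 1 * Lpnorm (torus d) (crit_exp (Suc m)) (iter_op n r g)"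
    unfolding iter_op.simps using Suc.prems szego_op_contraction[OF r]
    by (intro coord_op_Lpnorm bdd_iter_op assms(1) crit_exp_pos crit_exp_mono) auto
  also have "\<dots> \<le> Lpnorm (torus d) (crit_exp (Suc m + n)) g" using Suc.IH[of "Suc m"] Suc.prems by simp
  finally show ?case by simp
qed simp

text \<open>The exponent stays fixed at the price of a constant, which does no harm because this
  bound serves boundedness and convergence of the dilations only.\<close>

lemma iter_op_bounded:
  assumes "bdd (torus d) g" "n \<le> d"
  shows "Lpnorm (torus d) (4/3) (iter_op n r g) \<le> 2 ^ n * Lpnorm (torus d) (4/3) g"
  using assms(2)
proof (induction n)
  case (Suc n)
  have "Lpnorm (torus d) (4/3) (iter_op (Suc n) r g) \<le> 2 * Lpnorm (torus d) (4/3) (iter_op n r g)"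
    unfolding iter_op.simps using Suc.prems szego_op_43_43[OF r]
    by (intro coord_op_Lpnorm bdd_iter_op assms(1)) auto
  also have "\<dots> \<le> 2 * (2 ^ n * Lpnorm (torus d) (4/3) g)" using Suc by (intro mult_left_mono) auto
  finally show ?case by simp
qed simp

text \<open>\<open>szego_op_geo_mean\<close> handles the slices. Jensen's inequality for the
  logarithm handles the other variables, through the tangent at \<open>m\<close>, the mean of
  \<open>N t + 2 * \<epsilon>\<close>.\<close>

lemma coord_op_geo:
  assumes j: "j < d" and g: "bdd (torus d) g" and eps: "\<epsilon> > 0"
  shows "exp (\<integral>t. ln (cmod (coord_op j r g t) + \<epsilon>) \<partial>torus d) \<le> Lpnorm (torus d) 1 g + 2 * \<epsilon>"
proof -
  define N where "N t = (\<integral>u. cmod (g (t(j := u))) \<partial>circ)" for t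
  have N0: "N t \<ge> 0" for t unfolding N_def by (rule integral_nonneg_AE) simp
  have bN: "bdd (torus d) N"
    unfolding N_def by (rule circ.bdd_integral_snd[OF bdd_upd_torus[OF j bdd_norm[OF g]]])
  define m where "m = (\<integral>t. N t \<partial>torus d) + 2 * \<epsilon>"
  have m: "m > 0" unfolding m_def using eps N0 by (intro add_nonneg_pos integral_nonneg_AE) auto
  have bl: "bdd (torus d) (\<lambda>t. ln (cmod (coord_op j r g t) + \<epsilon>))"
  proof -
    obtain B where B: "\<And>x. x \<in> space (torus d) \<Longrightarrow> norm (coord_op j r g x) \<le> B" by (rule bdd_bound[OF bdd_coord_op[OF j g]]) blast
    note bdd_measurable[OF bdd_coord_op[OF j g], measurable]
    have m: "(\<lambda>t. ln (cmod (coord_op j r g t) + \<epsilon>)) \<in> borel_measurable (torus d)" by measurable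
    show ?thesis
    proof (rule bddI[OF m])
      fix t assume "t \<in> space (torus d)"
      then have "ln (cmod (coord_op j r g t) + \<epsilon>) \<le> ln (B + \<epsilon>)" "ln (0 + \<epsilon>) \<le> ln (cmod (coord_op j r g t) + \<epsilon>)"
        using B eps by (auto simp: add_nonneg_pos intro!: ln_mono)
      then show "norm (ln (cmod (coord_op j r g t) + \<epsilon>)) \<le> max \<bar>ln (B + \<epsilon>)\<bar> \<bar>ln \<epsilon>\<bar>" by auto
    qed
  qed
  have "(\<integral>t. ln (cmod (coord_op j r g t) + \<epsilon>) \<partial>torus d) = (\<integral>t. (\<integral>s. ln (cmod (coord_op j r g (t(j := s))) + \<epsilon>) \<partial>circ) \<partial>torus d)"
    by (rule torus_average[OF j bl])
  also have "\<dots> \<le> (\<integral>t. ln m + inverse m * (N t + 2 * \<epsilon> - m) \<partial>torus d)"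
  proof (rule integral_mono)
    show "integrable (torus d) (\<lambda>t. \<integral>s. ln (cmod (coord_op j r g (t(j := s))) + \<epsilon>) \<partial>circ)"
      by (intro torus.bdd_int circ.bdd_integral_snd bdd_upd_torus[OF j bl])
    show "integrable (torus d) (\<lambda>t. ln m + inverse m * (N t + 2 * \<epsilon> - m))"
      by (intro torus.bdd_int bdd_add bdd_mult bdd_diff bdd_const bN)
    fix t assume t: "t \<in> space (torus d)"
    have p: "N t + 2 * \<epsilon> > 0" using N0[of t] eps by linarith
    have "exp (\<integral>s. ln (cmod (coord_op j r g (t(j := s))) + \<epsilon>) \<partial>circ) \<le> N t + 2 * \<epsilon>"
      unfolding coord_op_slice N_def by (rule szego_op_geo_mean[OF r bdd_slice_torus[OF j g t] eps])
    then have "(\<integral>s. ln (cmod (coord_op j r g (t(j := s))) + \<epsilon>) \<partial>circ) \<le> ln (N t + 2 * \<epsilon>)"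
      using p by (simp add: ln_ge_iff)
    also have "\<dots> \<le> ln m + (N t + 2 * \<epsilon> - m) / m" using ln_diff_le[OF p m] by simp
    finally show "(\<integral>s. ln (cmod (coord_op j r g (t(j := s))) + \<epsilon>) \<partial>circ) \<le> ln m + inverse m * (N t + 2 * \<epsilon> - m)"
      by (simp add: divide_inverse mult.commute)
  qed
  also have "\<dots> = ln m + inverse m * ((\<integral>t. N t \<partial>torus d) + 2 * \<epsilon> - m)"
    using torus.bdd_int[OF bN] by (simp add: torus.prob_space)
  also have "\<dots> = ln m" by (simp add: m_def)
  finally have "exp (\<integral>t. ln (cmod (coord_op j r g t) + \<epsilon>) \<partial>torus d) \<le> m" using m by (simp add: ln_ge_iff)
  moreover have "(\<integral>t. N t \<partial>torus d) = Lpnorm (torus d) 1 g"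
    unfolding N_def torus_average[OF j bdd_norm[OF g], symmetric]
    by (simp add: Lpnorm_def integral_nonneg_AE)
  ultimately show ?thesis unfolding m_def by simp
qed

lemma iter_op_geo:
  assumes d: "d \<ge> 1" and g: "bdd (torus d) g" and eps: "\<epsilon> > 0"
  shows "exp (\<integral>t. ln (cmod (iter_op d r g t) + \<epsilon>) \<partial>torus d) \<le> Lpnorm (torus d) (crit_exp d) g + 2 * \<epsilon>"
proof -
  obtain k where k: "d = Suc k" using d by (cases d) auto
  have "exp (\<integral>t. ln (cmod (iter_op d r g t) + \<epsilon>) \<partial>torus d) \<le> Lpnorm (torus d) 1 (iter_op k r g) + 2 * \<epsilon>"
    unfolding k iter_op.simps by (rule coord_op_geo) (use k eps bdd_iter_op[OF g, of k] in auto)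
  also have "Lpnorm (torus d) 1 (iter_op k r g) \<le> Lpnorm (torus d) (crit_exp (1 + k)) g"
    using iter_op_contraction[OF g, of k 1] k crit_exp_1 by simp
  finally show ?thesis using k by simp
qed

end

section \<open>The kernel of the dilated Riesz projection\<close>

definition total_deg :: "nat \<Rightarrow> (nat \<Rightarrow> nat) \<Rightarrow> nat" where "total_deg d \<alpha> = (\<Sum>j<d. \<alpha> j)"

definition idx_box :: "nat \<Rightarrow> nat \<Rightarrow> (nat \<Rightarrow> nat) set" where
  "idx_box d N = {\<alpha> \<in> multi_idx d. \<forall>j<d. \<alpha> j \<le> N}"

text \<open>Multi-indices are 0 outside \<open>{..<d}\<close>, members of \<open>PiE\<close> are
  \<open>undefined\<close> there. Restriction passes between the two, so that sums over
  multi-indices factor into one-variable sums.\<close>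

lemma bij_multi_idx:
  "bij_betw (\<lambda>\<alpha>. restrict \<alpha> {..<d}) (multi_idx d) (PiE {..<d} (\<lambda>_. UNIV))"
  "bij_betw (\<lambda>\<alpha>. restrict \<alpha> {..<d}) (idx_box d N) (PiE {..<d} (\<lambda>_. {..N}))"
proof -
  let ?g = "\<lambda>\<alpha> j. if j < d then \<alpha> j else 0 :: nat"
  have 1: "?g (restrict \<alpha> {..<d}) = \<alpha>" if "\<alpha> \<in> multi_idx d" for \<alpha>
  proof
    fix j show "?g (restrict \<alpha> {..<d}) j = \<alpha> j"
      using that by (cases "j < d") (auto simp: multi_idx_def)
  qed
  have 2: "restrict (?g \<alpha>) {..<d} = \<alpha>" if "\<alpha> \<in> PiE {..<d} B" for \<alpha> and B :: "nat \<Rightarrow> nat set"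
  proof
    fix j
    have "j \<notin> {..<d} \<Longrightarrow> \<alpha> j = undefined" by (rule PiE_arb[OF that])
    then show "restrict (?g \<alpha>) {..<d} j = \<alpha> j" by (simp add: restrict_def)
  qed
  have 3: "?g \<alpha> \<in> multi_idx d" for \<alpha> by (simp add: multi_idx_def)
  show "bij_betw (\<lambda>\<alpha>. restrict \<alpha> {..<d}) (multi_idx d) (PiE {..<d} (\<lambda>_. UNIV))"
    by ((rule bij_betwI[where g="?g"]; simp_all only: 1 2 3 Pi_iff restrict_PiE_iff UNIV_I ball_simps simp_thms ball_triv); simp)
  show "bij_betw (\<lambda>\<alpha>. restrict \<alpha> {..<d}) (idx_box d N) (PiE {..<d} (\<lambda>_. {..N}))"
  proof (rule bij_betwI[where g="?g"])
    show "(\<lambda>\<alpha>. restrict \<alpha> {..<d}) \<in> idx_box d N \<rightarrow> PiE {..<d} (\<lambda>_. {..N})"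
      by (simp add: Pi_iff idx_box_def)
    show "?g \<in> PiE {..<d} (\<lambda>_. {..N}) \<rightarrow> idx_box d N"
      using 3 by (simp add: Pi_iff idx_box_def PiE_iff)
    show "?g (restrict \<alpha> {..<d}) = \<alpha>" if "\<alpha> \<in> idx_box d N" for \<alpha> using 1 that by (simp add: idx_box_def)
    show "restrict (?g \<alpha>) {..<d} = \<alpha>" if "\<alpha> \<in> PiE {..<d} (\<lambda>_. {..N})" for \<alpha> using 2 that .
  qed
qed

lemma finite_idx_box: "finite (idx_box d N)"
  using bij_betw_finite[OF bij_multi_idx(2)[of d N]] by (auto intro: finite_PiE)

lemma finite_subset_idx_box:
  assumes "finite F" "F \<subseteq> multi_idx d" obtains N where "F \<subseteq> idx_box d N"
proof
  show "F \<subseteq> idx_box d (\<Sum>\<alpha>\<in>F. total_deg d \<alpha>)"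
  proof
    fix \<alpha> assume a: "\<alpha> \<in> F"
    have "\<alpha> j \<le> (\<Sum>\<alpha>\<in>F. total_deg d \<alpha>)" if "j < d" for j
    proof -
      have "\<alpha> j \<le> total_deg d \<alpha>" unfolding total_deg_def using that by (intro member_le_sum) auto
      also have "\<dots> \<le> (\<Sum>\<alpha>\<in>F. total_deg d \<alpha>)" using a assms(1) by (intro member_le_sum) auto
      finally show ?thesis .
    qed
    then show "\<alpha> \<in> idx_box d (\<Sum>\<alpha>\<in>F. total_deg d \<alpha>)" using a assms(2) by (auto simp: idx_box_def)
  qed
qed

lemma power_total_deg: "r ^ total_deg d \<alpha> = (\<Prod>j<d. r ^ \<alpha> j)"
  by (simp add: total_deg_def power_sum)

text \<open>Over a box the sum is a product of \<open>d\<close> geometric sums, each at most 1 / (1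
  - r), and boxes exhaust the multi-indices.\<close>

lemma summable_power_total_deg:
  fixes r :: real assumes r: "0 \<le> r" "r < 1"
  shows "(\<lambda>\<alpha>. r ^ total_deg d \<alpha>) summable_on multi_idx d"
proof (rule nonneg_bdd_above_summable_on)
  show "bdd_above (sum (\<lambda>\<alpha>. r ^ total_deg d \<alpha>) ` {F. F \<subseteq> multi_idx d \<and> finite F})"
  proof (rule bdd_aboveI2)
    fix F assume "F \<in> {F. F \<subseteq> multi_idx d \<and> finite F}"
    then obtain N where N: "F \<subseteq> idx_box d N" using finite_subset_idx_box by auto
    have "(\<Sum>\<alpha>\<in>F. r ^ total_deg d \<alpha>) \<le> (\<Sum>\<alpha>\<in>idx_box d N. r ^ total_deg d \<alpha>)"
      using N r by (intro sum_mono2 finite_idx_box) auto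
    also have "\<dots> = (\<Sum>\<alpha>\<in>idx_box d N. (\<Prod>j<d. r ^ (restrict \<alpha> {..<d} j)))"
      by (simp add: power_total_deg)
    also have "\<dots> = (\<Sum>g\<in>PiE {..<d} (\<lambda>_. {..N}). (\<Prod>j<d. r ^ g j))"
      by (rule sum.reindex_bij_betw[OF bij_multi_idx(2)])
    also have "\<dots> = (\<Prod>j<d. \<Sum>k\<le>N. r ^ k)"
      by (rule prod_sum_PiE[symmetric]) auto
    also have "\<dots> \<le> (\<Prod>j<d. 1 / (1 - r))"
    proof (rule prod_mono)
      have "(\<Sum>k\<le>N. r ^ k) \<le> (\<Sum>k. r ^ k)" using r by (intro sum_le_suminf summable_geometric) auto
      then show "0 \<le> (\<Sum>k\<le>N. r ^ k) \<and> (\<Sum>k\<le>N. r ^ k) \<le> 1 / (1 - r)" for j :: nat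
        using r by (auto simp: suminf_geometric intro!: sum_nonneg)
    qed
    finally show "(\<Sum>\<alpha>\<in>F. r ^ total_deg d \<alpha>) \<le> (\<Prod>j<d. 1 / (1 - r))" .
  qed
qed (use r in auto)

lemma cis_sum: "cis (\<Sum>j\<in>A. f j) = (\<Prod>j\<in>A. cis (f j))"
  by (induction A rule: infinite_finite_induct) (auto simp: cis_mult[symmetric])

lemma chr_prod: "chr d \<alpha> t = (\<Prod>j<d. cis2pi (of_int (\<alpha> j) * t j))"
  by (simp add: chr_def cis2pi_def sum_distrib_left cis_sum mult_ac)

lemma norm_chr[simp]: "cmod (chr d \<alpha> t) = 1"
  by (simp add: chr_def)

lemma cis2pi_power: "cis2pi (of_nat k * x) = cis2pi x ^ k"
  unfolding cis2pi_def Complex.DeMoivre by (rule arg_cong[where f=cis]) simp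

definition szego_prod :: "nat \<Rightarrow> real \<Rightarrow> (nat \<Rightarrow> real) \<Rightarrow> (nat \<Rightarrow> real) \<Rightarrow> complex" where
  "szego_prod d r t s = (\<Prod>j<d. szego r (t j - s j))"

definition szego_term :: "nat \<Rightarrow> real \<Rightarrow> (nat \<Rightarrow> real) \<Rightarrow> (nat \<Rightarrow> real) \<Rightarrow> (nat \<Rightarrow> nat) \<Rightarrow> complex" where
  "szego_term d r t s \<alpha> = of_real (r ^ total_deg d \<alpha>) * chr d (int \<circ> \<alpha>) t * cnj (chr d (int \<circ> \<alpha>) s)"

lemma szego_term_prod: "szego_term d r t s \<alpha> = (\<Prod>j<d. (of_real r * cis2pi (t j - s j)) ^ \<alpha> j)"
proof -
  have e: "of_real (r ^ k) * cis2pi (real k * x) * cnj (cis2pi (real k * y)) = (of_real r * cis2pi (x - y)) ^ k" for k x y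
    unfolding power_mult_distrib cis2pi_power[symmetric] cnj_cis2pi mult.assoc cis2pi_add[symmetric]
    by (simp add: algebra_simps)
  have "szego_term d r t s \<alpha> = (\<Prod>j<d. of_real (r ^ \<alpha> j) * cis2pi (real (\<alpha> j) * t j) * cnj (cis2pi (real (\<alpha> j) * s j)))"
    unfolding szego_term_def chr_prod power_total_deg by (simp add: prod.distrib)
  then show ?thesis by (simp only: e)
qed

lemma norm_szego_term: "0 \<le> r \<Longrightarrow> cmod (szego_term d r t s \<alpha>) = r ^ total_deg d \<alpha>"
  by (simp add: szego_term_def norm_mult norm_power)

lemma szego_term_abs_summable: "0 \<le> r \<Longrightarrow> r < 1 \<Longrightarrow> (\<lambda>\<alpha>. norm (szego_term d r t s \<alpha>)) summable_on multi_idx d"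
  using summable_power_total_deg[of r d] by (simp add: norm_szego_term)

lemma infsum_szego_term:
  assumes r: "0 \<le> r" "r < 1"
  shows "infsum (szego_term d r t s) (multi_idx d) = szego_prod d r t s"
proof -
  define f where "f j k = (of_real r * cis2pi (t j - s j)) ^ k" for j k :: nat
  have nf: "norm (of_real r * cis2pi (t j - s j)) < 1" for j using r by (simp add: norm_mult)
  have "infsum (szego_term d r t s) (multi_idx d) = (\<Sum>\<^sub>\<infinity>\<alpha>\<in>multi_idx d. (\<Prod>j<d. f j (restrict \<alpha> {..<d} j)))"
    by (rule infsum_cong) (simp add: szego_term_prod f_def)
  also have "\<dots> = (\<Sum>\<^sub>\<infinity>g\<in>PiE {..<d} (\<lambda>_. UNIV). (\<Prod>j<d. f j (g j)))"
    by (rule infsum_reindex_bij_betw[OF bij_multi_idx(1)])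
  also have "\<dots> = (\<Prod>j<d. infsum (f j) UNIV)"
  proof (rule infsum_prod_PiE_abs)
    show "(\<lambda>k. norm (f j k)) summable_on UNIV" for j
      unfolding f_def using nf[of j] by (intro norm_summable_imp_summable_on) (simp add: norm_power norm_mult summable_geometric)
  qed simp
  also have "\<dots> = (\<Prod>j<d. szego r (t j - s j))"
  proof (rule prod.cong[OF refl], rule infsumI[OF norm_summable_imp_has_sum])
    fix j
    show "summable (\<lambda>n. norm (f j n))" unfolding f_def using nf[of j] by (simp add: norm_power norm_mult summable_geometric)
    show "f j sums szego r (t j - s j)" unfolding f_def szego_def by (rule geometric_sums[OF nf])
  qed
  finally show ?thesis by (simp add: szego_prod_def)
qed

lemma norm_szego_prod_le:
  assumes r: "0 \<le> r" "r < 1" shows "cmod (szego_prod d r t s) \<le> (1 / (1 - r)) ^ d"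
proof -
  have "cmod (szego_prod d r t s) = (\<Prod>j<d. cmod (szego r (t j - s j)))" by (simp add: szego_prod_def prod_norm)
  also have "\<dots> \<le> (\<Prod>j<d. 1 / (1 - r))" using norm_szego_le[OF r] by (intro prod_mono) auto
  finally show ?thesis by simp
qed

lemma measurable_chr[measurable]: "chr d \<alpha> \<in> borel_measurable (torus d)"
  unfolding chr_prod[abs_def] by measurable

lemma measurable_szego_prod[measurable]: "szego_prod d r t \<in> borel_measurable (torus d)"
  unfolding szego_prod_def[abs_def] by measurable

lemma measurable_kprod2[measurable]: "(\<lambda>(t, s). szego_prod d r t s) \<in> borel_measurable (torus d \<Otimes>\<^sub>M torus d)"
  unfolding szego_prod_def by measurable

text \<open>The unordered Fourier sum and the integral may be interchanged: the tail of the kernel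
  expansion is bounded, uniformly in both variables, by the tail of the numerical series of
  \<open>r ^ total_deg d \<alpha>\<close>.\<close>

lemma riesz_dil_kernel:
  assumes r: "0 \<le> r" "r < 1" and psi: "integrable (torus d) \<psi>"
  shows "riesz_dil d \<psi> r t = (\<integral>s. szego_prod d r t s * \<psi> s \<partial>torus d)"
proof -
  define c where "c \<alpha> = r ^ total_deg d \<alpha>" for \<alpha>
  have c: "c summable_on multi_idx d" unfolding c_def by (rule summable_power_total_deg[OF r])
  have c0: "c \<alpha> \<ge> 0" for \<alpha> using r by (simp add: c_def)
  define A where "A = multi_idx d"
  note psi_m = borel_measurable_integrable[OF psi, measurable]
  define I where "I = (\<integral>s. szego_prod d r t s * \<psi> s \<partial>torus d)"
  define T where "T \<alpha> = fourier d \<psi> (int \<circ> \<alpha>) * of_real (r ^ (\<Sum>j<d. \<alpha> j)) * chr d (int \<circ> \<alpha>) t" for \<alpha>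
  define P where "P = (\<integral>s. cmod (\<psi> s) \<partial>torus d)"
  have P0: "P \<ge> 0" unfolding P_def by (rule integral_nonneg_AE) simp
  have kt[measurable]: "(\<lambda>s. szego_term d r t s \<alpha>) \<in> borel_measurable (torus d)" for \<alpha>
    unfolding szego_term_def by (measurable, rule measurable_compose[OF _ borel_measurable_continuous_onI[of cnj]]) (auto intro: continuous_intros)
  have int: "integrable (torus d) (\<lambda>s. szego_term d r t s \<alpha> * \<psi> s)" for \<alpha>
    by (rule Bochner_Integration.integrable_bound[OF integrable_mult_right[OF integrable_norm[OF psi], of "c \<alpha>"]])
       (use r c0 in \<open>auto simp: norm_mult norm_szego_term c_def\<close>)
  have intk: "integrable (torus d) (\<lambda>s. szego_prod d r t s * \<psi> s)"
    by (rule Bochner_Integration.integrable_bound[OF integrable_mult_right[OF integrable_norm[OF psi], of "(1 / (1 - r)) ^ d"]])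
       (use r norm_szego_prod_le[OF r] in \<open>auto simp: norm_mult abs_mult simp del: times_divide_eq_left intro!: mult_right_mono\<close>)
  have T: "T \<alpha> = (\<integral>s. szego_term d r t s \<alpha> * \<psi> s \<partial>torus d)" for \<alpha>
  proof -
    have "(\<integral>s. szego_term d r t s \<alpha> * \<psi> s \<partial>torus d) = (\<integral>s. of_real (r ^ total_deg d \<alpha>) * chr d (int \<circ> \<alpha>) t * (\<psi> s * cnj (chr d (int \<circ> \<alpha>) s)) \<partial>torus d)"
      by (rule Bochner_Integration.integral_cong) (auto simp: szego_term_def)
    then show ?thesis by (simp add: T_def fourier_def total_deg_def)
  qed
  have est: "cmod (sum T F - I) \<le> P * (infsum c A - sum c F)" if F: "finite F" "F \<subseteq> A" for F
  proof -
    have "sum T F = (\<integral>s. (\<Sum>\<alpha>\<in>F. szego_term d r t s \<alpha> * \<psi> s) \<partial>torus d)"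
      unfolding T by (rule Bochner_Integration.integral_sum[symmetric]) (rule int)
    then have "sum T F - I = (\<integral>s. (\<Sum>\<alpha>\<in>F. szego_term d r t s \<alpha> * \<psi> s) - szego_prod d r t s * \<psi> s \<partial>torus d)"
      unfolding I_def using int intk by (subst Bochner_Integration.integral_diff) auto
    also have "cmod \<dots> \<le> (\<integral>s. cmod ((\<Sum>\<alpha>\<in>F. szego_term d r t s \<alpha> * \<psi> s) - szego_prod d r t s * \<psi> s) \<partial>torus d)"
      by (rule integral_norm_bound)
    also have "\<dots> \<le> (\<integral>s. (infsum c A - sum c F) * cmod (\<psi> s) \<partial>torus d)"
    proof (rule integral_mono)
      show "integrable (torus d) (\<lambda>s. cmod ((\<Sum>\<alpha>\<in>F. szego_term d r t s \<alpha> * \<psi> s) - szego_prod d r t s * \<psi> s))"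
        using int intk by auto
      show "integrable (torus d) (\<lambda>s. (infsum c A - sum c F) * cmod (\<psi> s))" using psi by auto
      fix s
      have ks: "szego_term d r t s summable_on A" unfolding A_def by (rule abs_summable_summable[OF szego_term_abs_summable[OF r]])
      have "szego_prod d r t s - sum (szego_term d r t s) F = infsum (szego_term d r t s) (A - F)"
        using infsum_Diff[OF ks _ F(2)] F by (simp add: infsum_szego_term[OF r] A_def)
      also have "cmod \<dots> \<le> infsum (\<lambda>\<alpha>. cmod (szego_term d r t s \<alpha>)) (A - F)"
        by (rule norm_infsum_bound) (use szego_term_abs_summable[OF r, of d t s] in \<open>auto simp: A_def intro: summable_on_subset_banach\<close>)
      also have "\<dots> = infsum c A - sum c F"
        using infsum_Diff[of c A F] F c r by (simp add: norm_szego_term c_def[symmetric] A_def)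
      finally have "cmod (sum (szego_term d r t s) F - szego_prod d r t s) \<le> infsum c A - sum c F"
        by (simp add: norm_minus_commute)
      then show "cmod ((\<Sum>\<alpha>\<in>F. szego_term d r t s \<alpha> * \<psi> s) - szego_prod d r t s * \<psi> s) \<le> (infsum c A - sum c F) * cmod (\<psi> s)"
        by (simp add: norm_mult mult_right_mono flip: sum_distrib_right left_diff_distrib)
    qed
    also have "\<dots> = P * (infsum c A - sum c F)" by (simp add: P_def)
    finally show ?thesis .
  qed
  have "(sum c \<longlongrightarrow> infsum c A) (finite_subsets_at_top A)"
    using c unfolding A_def[symmetric] by (simp add: infsum_tendsto)
  then have lim: "((\<lambda>F. P * (infsum c A - sum c F)) \<longlongrightarrow> P * (infsum c A - infsum c A)) (finite_subsets_at_top A)"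
    by (intro tendsto_intros)
  have "((\<lambda>F. sum T F - I) \<longlongrightarrow> 0) (finite_subsets_at_top A)"
  proof (rule Lim_null_comparison)
    show "\<forall>\<^sub>F F in finite_subsets_at_top A. cmod (sum T F - I) \<le> P * (infsum c A - sum c F)"
      using est by (rule eventually_finite_subsets_at_top_weakI) 
    show "((\<lambda>F. P * (infsum c A - sum c F)) \<longlongrightarrow> 0) (finite_subsets_at_top A)" using lim by simp
  qed
  then have "(T has_sum I) A" unfolding has_sum_def by (rule Lim_null[THEN iffD2])
  then have "infsum T A = I" by (rule infsumI)
  then show ?thesis by (simp add: riesz_dil_def T_def[abs_def] A_def I_def)
qed

lemma space_torus: "space (torus d) = PiE {..<d} (\<lambda>_. {0..1})"
  by (simp add: torus_eq space_PiM)

lemma merge_torus: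
  assumes t: "t \<in> space (torus d)" and n: "n \<le> d"
  shows "(\<lambda>s j. if j < n then s j else t j) \<in> torus d \<rightarrow>\<^sub>M torus d"
proof -
  have "(\<lambda>s j. if j < n then s j else t j) \<in> torus d \<rightarrow>\<^sub>M PiM {..<d} (\<lambda>_. circ)"
  proof (rule measurable_PiM_single')
    fix i assume "i \<in> {..<d}"
    then show "(\<lambda>s. if i < n then s i else t i) \<in> torus d \<rightarrow>\<^sub>M circ"
      using t n by (cases "i < n") (auto simp: space_torus)
  qed (use t n in \<open>auto simp: space_torus PiE_iff extensional_def\<close>)
  then show ?thesis by (simp add: torus_eq)
qed

text \<open>In the induction step the new one-dimensional integral is absorbed by
  \<open>torus_average\<close>: the integral over the torus ignores its coordinate \<open>n\<close>
  until that coordinate is overwritten by the new variable.\<close>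

lemma iter_op_kernel:
  assumes r: "0 \<le> r" "r < 1" and g: "bdd (torus d) g" and n: "n \<le> d" and t: "t \<in> space (torus d)"
  shows "iter_op n r g t = (\<integral>s. (\<Prod>j<n. szego r (t j - s j)) * g (\<lambda>j. if j < n then s j else t j) \<partial>torus d)"
  using n t
proof (induction n arbitrary: t)
  case 0
  then show ?case by (simp add: torus.prob_space)
next
  case (Suc n)
  note t = Suc.prems(2)
  have nd: "n < d" using Suc.prems by simp
  define H where "H s = (\<Prod>j<Suc n. szego r (t j - s j)) * g (\<lambda>j. if j < Suc n then s j else t j)" for s
  have bH: "bdd (torus d) H"
  proof -
    have m: "(\<lambda>s. \<Prod>j<Suc n. szego r (t j - s j)) \<in> borel_measurable (torus d)"
      using nd by (intro borel_measurable_prod) auto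
    have "bdd (torus d) (\<lambda>s. \<Prod>j<Suc n. szego r (t j - s j))"
      by (rule bddI[OF m, of "(\<Prod>j<Suc n. 1 / (1 - r))"])
         (use norm_szego_le[OF r] in \<open>auto simp: norm_mult prod_norm[symmetric] simp del: prod.lessThan_Suc prod_constant intro!: prod_mono\<close>)
    from bdd_mult[OF this bdd_compose[OF g merge_torus[OF t Suc.prems(1)]]] show ?thesis
      by (simp add: H_def[abs_def])
  qed
  have "iter_op (Suc n) r g t = (\<integral>u. szego r (t n - u) * iter_op n r g (t(n := u)) \<partial>circ)"
    by (simp add: coord_op_def szego_op_def)
  also have "\<dots> = (\<integral>u. (\<integral>s. H (s(n := u)) \<partial>torus d) \<partial>circ)"
  proof (rule Bochner_Integration.integral_cong[OF refl])
    fix u assume u: "u \<in> space circ"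
    have tu: "t(n := u) \<in> space (torus d)" using t u nd by (auto simp: space_torus PiE_iff extensional_def)
    have "szego r (t n - u) * iter_op n r g (t(n := u)) =
        (\<integral>s. szego r (t n - u) * ((\<Prod>j<n. szego r ((t(n := u)) j - s j)) * g (\<lambda>j. if j < n then s j else (t(n := u)) j)) \<partial>torus d)"
      by (subst Suc.IH[OF _ tu]) (use nd in simp_all)
    also have "\<dots> = (\<integral>s. H (s(n := u)) \<partial>torus d)"
    proof (rule Bochner_Integration.integral_cong[OF refl])
      fix s
      have "(\<lambda>j. if j < n then s j else (t(n := u)) j) = (\<lambda>j. if j < Suc n then (s(n := u)) j else t j)"
        by (auto simp: fun_eq_iff)
      moreover have "(\<Prod>j<n. szego r ((t(n := u)) j - s j)) = (\<Prod>j<n. szego r (t j - (s(n := u)) j))"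
        by (rule prod.cong) auto
      ultimately show "szego r (t n - u) * ((\<Prod>j<n. szego r ((t(n := u)) j - s j)) * g (\<lambda>j. if j < n then s j else (t(n := u)) j)) = H (s(n := u))"
        unfolding H_def prod.lessThan_Suc by (simp only: fun_upd_same mult_ac)
    qed
    finally show "szego r (t n - u) * iter_op n r g (t(n := u)) = (\<integral>s. H (s(n := u)) \<partial>torus d)" .
  qed
  also have "\<dots> = (\<integral>s. (\<integral>u. H (s(n := u)) \<partial>circ) \<partial>torus d)"
    by (rule bdd_Fubini[OF prob_torus prob_circ bdd_upd_torus[OF nd bH], symmetric])
  also have "\<dots> = (\<integral>s. H s \<partial>torus d)" by (rule torus_average[OF nd bH, symmetric])
  finally show ?case by (simp only: H_def)
qed

text \<open>The bridge from the Fourier series of the definitions to the one-variable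
  operators.\<close>

lemma riesz_dil_iter_op:
  assumes r: "0 \<le> r" "r < 1" and g: "bdd (torus d) g" and t: "t \<in> space (torus d)"
  shows "riesz_dil d g r t = iter_op d r g t"
proof -
  have "riesz_dil d g r t = (\<integral>s. szego_prod d r t s * g s \<partial>torus d)"
    by (rule riesz_dil_kernel[OF r torus.bdd_int[OF g]])
  also have "\<dots> = (\<integral>s. (\<Prod>j<d. szego r (t j - s j)) * g (\<lambda>j. if j < d then s j else t j) \<partial>torus d)"
  proof (rule Bochner_Integration.integral_cong[OF refl])
    fix s assume s: "s \<in> space (torus d)"
    have "(\<lambda>j. if j < d then s j else t j) = s"
      using s t by (auto simp: space_torus PiE_iff extensional_def fun_eq_iff)
    then show "szego_prod d r t s * g s = (\<Prod>j<d. szego r (t j - s j)) * g (\<lambda>j. if j < d then s j else t j)"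
      by (simp add: szego_prod_def)
  qed
  finally show ?thesis using iter_op_kernel[OF r g order_refl t] by simp
qed

section \<open>Unbounded functions\<close>

lemma in_Lq_iff:
  assumes "q > 0"
  shows "in_Lq d q \<psi> \<longleftrightarrow> \<psi> \<in> borel_measurable (torus d) \<and> integrable (torus d) (\<lambda>t. cmod (\<psi> t) powr q)"
  unfolding in_Lq_def integrable_iff_bounded by auto

lemma Lq_norm_eq:
  assumes "in_Lq d q \<psi>" "q > 0"
  shows "Lq_norm d q \<psi> = Lpnorm (torus d) q \<psi>"
  using assms unfolding in_Lq_iff[OF assms(2)] Lq_norm_def Lpnorm_def
  by (subst integral_eq_nn_integral) auto

lemma in_Lq_mono:
  assumes "in_Lq d q \<psi>" "0 < p" "p \<le> q" shows "in_Lq d p \<psi>"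
proof -
  have q: "q > 0" using assms by simp
  have m[measurable]: "\<psi> \<in> borel_measurable (torus d)" and i: "integrable (torus d) (\<lambda>t. cmod (\<psi> t) powr q)"
    using assms(1) unfolding in_Lq_iff[OF q] by auto
  have "integrable (torus d) (\<lambda>t. cmod (\<psi> t) powr p)"
  proof (rule Bochner_Integration.integrable_bound[of _ "\<lambda>t. 1 + cmod (\<psi> t) powr q"])
    show "integrable (torus d) (\<lambda>t. 1 + cmod (\<psi> t) powr q)" using i by simp
    have "x powr p \<le> 1 + x powr q" if "x \<ge> 0" for x :: real
    proof (cases "x \<le> 1")
      case True
      then have "x powr p \<le> 1" using that assms by (simp add: powr_le1)
      then show ?thesis by (simp add: add_increasing2)
    next
      case False
      then have "x powr p \<le> x powr q" using assms by (intro powr_mono) auto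
      then show ?thesis by simp
    qed
    then show "AE t in torus d. norm (cmod (\<psi> t) powr p) \<le> norm (1 + cmod (\<psi> t) powr q)"
      by (intro AE_I2) (simp add: abs_of_nonneg)
  qed simp
  then show ?thesis unfolding in_Lq_iff[OF assms(2)] using m by simp
qed

lemma in_Lq_1: "in_Lq d 1 \<psi> \<longleftrightarrow> integrable (torus d) \<psi>"
  using integrable_norm_iff[of \<psi> "torus d"] by (auto simp: in_Lq_iff)

text \<open>Large values are replaced by 0, not scaled down, so the sequence at each point is
  eventually constant and the remainder is either 0 or \<open>\<psi> t\<close>.\<close>

definition trunc :: "nat \<Rightarrow> ('a \<Rightarrow> complex) \<Rightarrow> 'a \<Rightarrow> complex" where
  "trunc N \<psi> t = (if cmod (\<psi> t) \<le> real N then \<psi> t else 0)"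

lemma trunc_lim: "(\<lambda>N. trunc N \<psi> t) \<longlonglongrightarrow> \<psi> t"
proof (rule tendsto_eventually)
  obtain N0 where "cmod (\<psi> t) \<le> real N0" using real_arch_simple by blast
  then show "\<forall>\<^sub>F N in sequentially. trunc N \<psi> t = \<psi> t"
    by (intro eventually_sequentiallyI[of N0]) (simp add: trunc_def)
qed

lemma norm_trunc_le: "cmod (trunc N \<psi> t) \<le> cmod (\<psi> t)"
  by (simp add: trunc_def)

lemma measurable_trunc[measurable]:
  assumes [measurable]: "\<psi> \<in> borel_measurable M" shows "trunc N \<psi> \<in> borel_measurable M"
  unfolding trunc_def[abs_def] by measurable

lemma bdd_trunc: "\<psi> \<in> borel_measurable M \<Longrightarrow> bdd M (trunc N \<psi>)"
  by (rule bddI[of _ _ "real N"]) (auto simp: trunc_def)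

lemma riesz_dil_diff:
  assumes "0 \<le> r" "r < 1" "integrable (torus d) \<psi>" "integrable (torus d) \<phi>"
  shows "riesz_dil d (\<lambda>t. \<psi> t - \<phi> t) r t = riesz_dil d \<psi> r t - riesz_dil d \<phi> r t"
proof -
  have i: "integrable (torus d) (\<lambda>s. szego_prod d r t s * \<psi> s)" if "integrable (torus d) \<psi>" for \<psi>
    by (rule Bochner_Integration.integrable_bound[OF integrable_mult_right[OF integrable_norm[OF that], of "(1 / (1 - r)) ^ d"]])
       (use that assms(1,2) norm_szego_prod_le[OF assms(1,2)] borel_measurable_integrable[OF that] in
        \<open>auto simp: norm_mult abs_mult simp del: times_divide_eq_left intro!: mult_right_mono\<close>)
  show ?thesis using assms i[OF assms(3)] i[OF assms(4)] by (simp add: riesz_dil_kernel right_diff_distrib)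
qed

lemma norm_riesz_dil_le:
  assumes r: "0 \<le> r" "r < 1" and psi: "integrable (torus d) \<psi>"
  shows "cmod (riesz_dil d \<psi> r t) \<le> (1 / (1 - r)) ^ d * (\<integral>s. cmod (\<psi> s) \<partial>torus d)"
proof -
  have "cmod (riesz_dil d \<psi> r t) \<le> (\<integral>s. cmod (szego_prod d r t s * \<psi> s) \<partial>torus d)"
    unfolding riesz_dil_kernel[OF r psi] by (rule integral_norm_bound)
  also have "\<dots> \<le> (\<integral>s. (1 / (1 - r)) ^ d * cmod (\<psi> s) \<partial>torus d)"
    using psi r norm_szego_prod_le[OF r] by (intro integral_mono') (auto simp: norm_mult simp del: power_divide intro!: mult_right_mono)
  finally show ?thesis by simp
qed

lemma bdd_riesz_dil:
  assumes r: "0 \<le> r" "r < 1" and psi: "integrable (torus d) \<psi>"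
  shows "bdd (torus d) (riesz_dil d \<psi> r)"
proof (rule bddI[OF _ norm_riesz_dil_le[OF r psi]])
  note borel_measurable_integrable[OF psi, measurable]
  have "(\<lambda>t. \<integral>s. szego_prod d r t s * \<psi> s \<partial>torus d) \<in> borel_measurable (torus d)"
    by (intro torus.borel_measurable_lebesgue_integral) measurable
  then show "riesz_dil d \<psi> r \<in> borel_measurable (torus d)"
    using riesz_dil_kernel[OF r psi] by (simp add: fun_eq_iff cong: measurable_cong)
qed

lemma riesz_dil_trunc_lim:
  assumes r: "0 \<le> r" "r < 1" and psi: "integrable (torus d) \<psi>"
  shows "(\<lambda>N. riesz_dil d (trunc N \<psi>) r t) \<longlonglongrightarrow> riesz_dil d \<psi> r t"
proof -
  note m = borel_measurable_integrable[OF psi, measurable]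
  have i: "integrable (torus d) (trunc N \<psi>)" for N by (rule torus.bdd_int[OF bdd_trunc[OF m]])
  have "(\<lambda>N. \<integral>s. szego_prod d r t s * trunc N \<psi> s \<partial>torus d) \<longlonglongrightarrow> (\<integral>s. szego_prod d r t s * \<psi> s \<partial>torus d)"
  proof (rule integral_dominated_convergence[where w="\<lambda>s. (1 / (1 - r)) ^ d * cmod (\<psi> s)"])
    show "AE s in torus d. (\<lambda>N. szego_prod d r t s * trunc N \<psi> s) \<longlonglongrightarrow> szego_prod d r t s * \<psi> s"
      by (intro AE_I2 tendsto_intros trunc_lim)
    show "AE s in torus d. norm (szego_prod d r t s * trunc N \<psi> s) \<le> (1 / (1 - r)) ^ d * cmod (\<psi> s)" for N
      unfolding norm_mult using norm_szego_prod_le[OF r] norm_trunc_le r by (intro AE_I2 mult_mono) auto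
  qed (use psi in auto)
  then show ?thesis by (simp only: riesz_dil_kernel[OF r i] riesz_dil_kernel[OF r psi])
qed

lemma Lpnorm_trunc_le:
  assumes p: "p > 0" and psi: "in_Lq d p \<psi>"
  shows "Lpnorm (torus d) p (trunc N \<psi>) \<le> Lpnorm (torus d) p \<psi>"
proof (subst Lpnorm_le_iff[OF p Lpnorm_nonneg], subst Lpnorm_powr[OF p], rule integral_mono')
  show "integrable (torus d) (\<lambda>x. cmod (\<psi> x) powr p)" using psi unfolding in_Lq_iff[OF p] by simp
  show "cmod (trunc N \<psi> x) powr p \<le> cmod (\<psi> x) powr p" for x
    using p norm_trunc_le by (intro powr_mono2) auto
qed simp

text \<open>The last bound is free of \<open>N\<close>; it is the dominating constant when the
  truncation is removed at fixed \<open>r\<close>.\<close>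

lemma trunc_props:
  assumes r: "0 \<le> r" "r < 1" and psi: "integrable (torus d) \<psi>"
  shows "bdd (torus d) (trunc N \<psi>)"
    and "t \<in> space (torus d) \<Longrightarrow> riesz_dil d (trunc N \<psi>) r t = iter_op d r (trunc N \<psi>) t"
    and "cmod (riesz_dil d (trunc N \<psi>) r t) \<le> (1 / (1 - r)) ^ d * (\<integral>s. cmod (\<psi> s) \<partial>torus d)"
proof -
  show b: "bdd (torus d) (trunc N \<psi>)" by (rule bdd_trunc[OF borel_measurable_integrable[OF psi]])
  then show "t \<in> space (torus d) \<Longrightarrow> riesz_dil d (trunc N \<psi>) r t = iter_op d r (trunc N \<psi>) t"
    by (rule riesz_dil_iter_op[OF r])
  have "(\<integral>s. cmod (trunc N \<psi> s) \<partial>torus d) \<le> (\<integral>s. cmod (\<psi> s) \<partial>torus d)"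
    using psi norm_trunc_le by (intro integral_mono') auto
  then have "(1 / (1 - r)) ^ d * (\<integral>s. cmod (trunc N \<psi> s) \<partial>torus d) \<le> (1 / (1 - r)) ^ d * (\<integral>s. cmod (\<psi> s) \<partial>torus d)"
    using r by (intro mult_left_mono) auto
  then show "cmod (riesz_dil d (trunc N \<psi>) r t) \<le> (1 / (1 - r)) ^ d * (\<integral>s. cmod (\<psi> s) \<partial>torus d)"
    by (rule order_trans[OF norm_riesz_dil_le[OF r torus.bdd_int[OF b]]])
qed

text \<open>Dominated convergence removes the truncation at fixed \<open>r\<close>, while the
  resulting bound does not depend on \<open>r\<close>. This uniformity drives the convergence as
  \<open>r\<close> tends to 1.\<close>

lemma riesz_dil_bounded:
  assumes r: "0 \<le> r" "r < 1" and psi: "in_Lq d (4/3) \<psi>"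
  shows "(\<integral>t. cmod (riesz_dil d \<psi> r t) \<partial>torus d) \<le> 2 ^ d * Lpnorm (torus d) (4/3) \<psi>"
proof -
  let ?B = "(1 / (1 - r)) ^ d * (\<integral>s. cmod (\<psi> s) \<partial>torus d)"
  have i: "integrable (torus d) \<psi>" using in_Lq_mono[OF psi, of 1] by (simp add: in_Lq_1)
  note tp = trunc_props[OF r i]
  have le: "(\<integral>t. cmod (riesz_dil d (trunc N \<psi>) r t) \<partial>torus d) \<le> 2 ^ d * Lpnorm (torus d) (4/3) \<psi>" for N
  proof -
    have "(\<integral>t. cmod (riesz_dil d (trunc N \<psi>) r t) \<partial>torus d) = Lpnorm (torus d) 1 (iter_op d r (trunc N \<psi>))"
      by (simp add: Lpnorm_def integral_nonneg_AE tp(2) cong: Bochner_Integration.integral_cong)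
    also have "\<dots> \<le> Lpnorm (torus d) (4/3) (iter_op d r (trunc N \<psi>))"
      by (rule torus.Lpnorm_mono_exponent[OF bdd_iter_op[OF r tp(1) order_refl]]) auto
    also have "\<dots> \<le> 2 ^ d * Lpnorm (torus d) (4/3) (trunc N \<psi>)"
      by (rule iter_op_bounded[OF r tp(1) order_refl])
    also have "\<dots> \<le> 2 ^ d * Lpnorm (torus d) (4/3) \<psi>"
      using psi by (intro mult_left_mono Lpnorm_trunc_le) auto
    finally show ?thesis .
  qed
  have "(\<lambda>N. \<integral>t. cmod (riesz_dil d (trunc N \<psi>) r t) \<partial>torus d) \<longlonglongrightarrow> (\<integral>t. cmod (riesz_dil d \<psi> r t) \<partial>torus d)"
  proof (rule integral_dominated_convergence[where w="\<lambda>_. ?B"])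
    show "AE t in torus d. (\<lambda>N. cmod (riesz_dil d (trunc N \<psi>) r t)) \<longlonglongrightarrow> cmod (riesz_dil d \<psi> r t)"
      by (intro AE_I2 tendsto_norm riesz_dil_trunc_lim[OF r i])
    show "AE t in torus d. norm (cmod (riesz_dil d (trunc N \<psi>) r t)) \<le> ?B" for N
      using tp(3) by (intro AE_I2) simp
  qed (intro bdd_measurable bdd_norm bdd_riesz_dil r i torus.bdd_int tp bdd_const)+
  then show ?thesis by (rule LIMSEQ_le_const2) (use le in auto)
qed

text \<open>The summand \<epsilon> bounds the logarithm from below, so dominated convergence also
  applies where the dilation is close to 0.\<close>

lemma riesz_dil_geo:
  assumes d: "d \<ge> 1" and r: "0 \<le> r" "r < 1" and psi: "in_Lq d (crit_exp d) \<psi>" and eps: "\<epsilon> > 0"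
  shows "exp (\<integral>t. ln (cmod (riesz_dil d \<psi> r t) + \<epsilon>) \<partial>torus d) \<le> Lpnorm (torus d) (crit_exp d) \<psi> + 2 * \<epsilon>"
proof -
  have Q1: "1 \<le> crit_exp d"
  proof -
    have "2 powr (1 - real d) \<le> 2 powr 0" using d by (intro powr_mono) auto
    then show ?thesis by (simp add: crit_exp_def add_pos_pos le_divide_eq)
  qed
  have i: "integrable (torus d) \<psi>" using in_Lq_mono[OF psi, of 1] Q1 by (simp add: in_Lq_1)
  note tp = trunc_props[OF r i]
  let ?l = "\<lambda>g t. ln (cmod (riesz_dil d g r t) + \<epsilon>)"
  define B where "B = (1 / (1 - r)) ^ d * (\<integral>s. cmod (\<psi> s) \<partial>torus d)"
  have le: "exp (\<integral>t. ?l (trunc N \<psi>) t \<partial>torus d) \<le> Lpnorm (torus d) (crit_exp d) \<psi> + 2 * \<epsilon>" for N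
  proof -
    have "(\<integral>t. ?l (trunc N \<psi>) t \<partial>torus d) = (\<integral>t. ln (cmod (iter_op d r (trunc N \<psi>) t) + \<epsilon>) \<partial>torus d)"
      by (rule Bochner_Integration.integral_cong[OF refl]) (simp add: tp(2))
    then show ?thesis
      using iter_op_geo[OF r d tp(1)[of N] eps] Lpnorm_trunc_le[OF crit_exp_pos psi, of N] by simp
  qed
  have lnb: "\<bar>ln (x + \<epsilon>)\<bar> \<le> max \<bar>ln (B + \<epsilon>)\<bar> \<bar>ln \<epsilon>\<bar>" if "0 \<le> x" "x \<le> B" for x
  proof -
    have "ln (x + \<epsilon>) \<le> ln (B + \<epsilon>)" "ln \<epsilon> \<le> ln (x + \<epsilon>)" using that eps by (auto simp: add_nonneg_pos)
    then show ?thesis by auto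
  qed
  have "(\<lambda>N. \<integral>t. ?l (trunc N \<psi>) t \<partial>torus d) \<longlonglongrightarrow> (\<integral>t. ?l \<psi> t \<partial>torus d)"
  proof (rule integral_dominated_convergence[where w="\<lambda>_. max \<bar>ln (B + \<epsilon>)\<bar> \<bar>ln \<epsilon>\<bar>"])
    show "AE t in torus d. (\<lambda>N. ?l (trunc N \<psi>) t) \<longlonglongrightarrow> ?l \<psi> t"
      using eps by (intro AE_I2 tendsto_intros riesz_dil_trunc_lim[OF r i]) (simp add: add_nonneg_eq_0_iff)
    show "AE t in torus d. norm (?l (trunc N \<psi>) t) \<le> max \<bar>ln (B + \<epsilon>)\<bar> \<bar>ln \<epsilon>\<bar>" for N
      unfolding real_norm_def using tp(3) by (intro AE_I2 lnb) (auto simp: B_def)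
    note bdd_measurable[OF bdd_riesz_dil[OF r i], measurable]
    note bdd_measurable[OF bdd_riesz_dil[OF r torus.bdd_int[OF tp(1)]], measurable]
    show "(\<lambda>t. ?l \<psi> t) \<in> borel_measurable (torus d)" by measurable
    show "(\<lambda>t. ?l (trunc N \<psi>) t) \<in> borel_measurable (torus d)" for N by measurable
  qed simp
  then have "(\<lambda>N. exp (\<integral>t. ?l (trunc N \<psi>) t \<partial>torus d)) \<longlonglongrightarrow> exp (\<integral>t. ?l \<psi> t \<partial>torus d)"
    by (rule tendsto_exp)
  then show ?thesis by (rule LIMSEQ_le_const2) (use le in auto)
qed

section \<open>Mean convergence of the dilations\<close>

lemma integral_cis2pi_power: "(\<integral>x. cis2pi (of_int k * x) \<partial>circ) = (if k = 0 then 1 else 0)"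
proof -
  have pos: "(\<integral>x. cis2pi (real n * x) \<partial>circ) = 0" if "n > 0" for n
    using circle_mean[of "\<lambda>z. z ^ n" 2] that by (simp add: cis2pi_power holomorphic_on_power)
  consider "k = 0" | "k > 0" | "k < 0" by linarith
  then show ?thesis
  proof cases
    case 1 then show ?thesis using circ.prob_space by (simp add: cis2pi_def)
  next
    case 2 then show ?thesis using pos[of "nat k"] by simp
  next
    case 3
    have "(\<integral>x. cis2pi (of_int k * x) \<partial>circ) = (\<integral>x. cnj (cis2pi (real (nat (- k)) * x)) \<partial>circ)"
      using 3 by (intro Bochner_Integration.integral_cong) (auto simp: cnj_cis2pi)
    also have "\<dots> = cnj (\<integral>x. cis2pi (real (nat (- k)) * x) \<partial>circ)" by (rule Bochner_Integration.integral_cnj)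
    finally show ?thesis using pos[of "nat (- k)"] 3 by simp
  qed
qed

lemma integral_chr: "(\<integral>t. chr d \<alpha> t \<partial>torus d) = (if \<forall>j<d. \<alpha> j = 0 then 1 else 0)"
proof -
  interpret P: product_sigma_finite "\<lambda>_::nat. circ" by unfold_locales
  have "(\<integral>t. chr d \<alpha> t \<partial>torus d) = (\<Prod>j<d. \<integral>x. cis2pi (of_int (\<alpha> j) * x) \<partial>circ)"
    unfolding chr_prod torus_eq
    by (rule P.product_integral_prod) (auto intro!: bdd_circ_int continuous_bdd_circ continuous_intros)
  also have "\<dots> = (\<Prod>j<d. if \<alpha> j = 0 then 1 else 0)" by (simp only: integral_cis2pi_power)
  also have "\<dots> = (if \<forall>j<d. \<alpha> j = 0 then 1 else 0)"
  proof (cases "\<forall>j<d. \<alpha> j = 0")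
    case False
    then obtain j where "j < d" "\<alpha> j \<noteq> 0" by auto
    then show ?thesis using False by (subst prod_zero) auto
  qed simp
  finally show ?thesis .
qed

lemma chr_mult_cnj: "chr d \<alpha> t * cnj (chr d \<beta> t) = chr d (\<lambda>j. \<alpha> j - \<beta> j) t"
  unfolding chr_def by (simp add: cis_cnj cis_mult sum_subtractf left_diff_distrib right_diff_distrib)

lemma chr_orthonormal:
  "(\<integral>t. chr d \<alpha> t * cnj (chr d \<beta> t) \<partial>torus d) = (if \<forall>j<d. \<alpha> j = \<beta> j then 1 else 0)"
  unfolding chr_mult_cnj integral_chr by simp

lemma chr_orthonormal_multi_idx:
  assumes "\<alpha> \<in> multi_idx d" "\<beta> \<in> multi_idx d"
  shows "(\<integral>t. chr d (int \<circ> \<alpha>) t * cnj (chr d (int \<circ> \<beta>) t) \<partial>torus d) = (if \<alpha> = \<beta> then 1 else 0)"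
proof -
  have "(\<forall>j<d. (int \<circ> \<alpha>) j = (int \<circ> \<beta>) j) \<longleftrightarrow> \<alpha> = \<beta>"
  proof
    assume a: "\<forall>j<d. (int \<circ> \<alpha>) j = (int \<circ> \<beta>) j"
    show "\<alpha> = \<beta>"
    proof
      fix j show "\<alpha> j = \<beta> j" using a assms by (cases "j < d") (auto simp: multi_idx_def)
    qed
  qed auto
  then show ?thesis unfolding chr_orthonormal by simp
qed

lemma bdd_chr: "bdd (torus d) (chr d \<alpha>)"
  by (rule bddI[of _ _ 1]) auto

lemma parseval_finite:
  assumes F: "finite F" "F \<subseteq> multi_idx d"
  shows "(\<integral>t. (cmod (\<Sum>\<alpha>\<in>F. a \<alpha> * chr d (int \<circ> \<alpha>) t))\<^sup>2 \<partial>torus d) = (\<Sum>\<alpha>\<in>F. (cmod (a \<alpha>))\<^sup>2)"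
proof -
  let ?S = "\<lambda>t. \<Sum>\<alpha>\<in>F. a \<alpha> * chr d (int \<circ> \<alpha>) t"
  have "complex_of_real (\<integral>t. (cmod (?S t))\<^sup>2 \<partial>torus d) = (\<integral>t. ?S t * cnj (?S t) \<partial>torus d)"
    by (simp only: complex_norm_square flip: integral_complex_of_real)
  also have "\<dots> = (\<integral>t. (\<Sum>\<alpha>\<in>F. \<Sum>\<beta>\<in>F. (a \<alpha> * cnj (a \<beta>)) * (chr d (int \<circ> \<alpha>) t * cnj (chr d (int \<circ> \<beta>) t))) \<partial>torus d)"
    by (rule Bochner_Integration.integral_cong[OF refl]) (simp add: sum_product mult_ac)
  also have "\<dots> = (\<Sum>\<alpha>\<in>F. \<Sum>\<beta>\<in>F. (a \<alpha> * cnj (a \<beta>)) * (\<integral>t. chr d (int \<circ> \<alpha>) t * cnj (chr d (int \<circ> \<beta>) t) \<partial>torus d))"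
    by (subst Bochner_Integration.integral_sum, (intro torus.bdd_int bdd_sum bdd_mult bdd_const bdd_cnj bdd_chr)+,
        subst Bochner_Integration.integral_sum, (intro torus.bdd_int bdd_sum bdd_mult bdd_const bdd_cnj bdd_chr)+, simp)
  also have "\<dots> = (\<Sum>\<alpha>\<in>F. \<Sum>\<beta>\<in>F. if \<beta> = \<alpha> then a \<alpha> * cnj (a \<beta>) else 0)"
    using F by (intro sum.cong refl) (auto simp: chr_orthonormal_multi_idx subset_iff)
  also have "\<dots> = (\<Sum>\<alpha>\<in>F. a \<alpha> * cnj (a \<alpha>))" using F by (simp add: sum.delta')
  also have "\<dots> = complex_of_real (\<Sum>\<alpha>\<in>F. (cmod (a \<alpha>))\<^sup>2)"
    by (simp only: of_real_sum complex_norm_square)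
  finally show ?thesis by (simp only: of_real_eq_iff)
qed

lemma bessel:
  assumes psi: "bdd (torus d) \<psi>" and F: "finite F" "F \<subseteq> multi_idx d"
  shows "(\<Sum>\<alpha>\<in>F. (cmod (fourier d \<psi> (int \<circ> \<alpha>)))\<^sup>2) \<le> (\<integral>t. (cmod (\<psi> t))\<^sup>2 \<partial>torus d)"
proof -
  define a where "a \<alpha> = fourier d \<psi> (int \<circ> \<alpha>)" for \<alpha>
  define S where "S t = (\<Sum>\<alpha>\<in>F. a \<alpha> * chr d (int \<circ> \<alpha>) t)" for t
  have bS: "bdd (torus d) S" unfolding S_def by (intro bdd_sum bdd_mult bdd_const bdd_chr)
  have "(\<integral>t. \<psi> t * cnj (S t) \<partial>torus d) = (\<integral>t. (\<Sum>\<alpha>\<in>F. cnj (a \<alpha>) * (\<psi> t * cnj (chr d (int \<circ> \<alpha>) t))) \<partial>torus d)"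
    by (rule Bochner_Integration.integral_cong[OF refl]) (simp add: S_def sum_distrib_left mult_ac)
  also have "\<dots> = (\<Sum>\<alpha>\<in>F. cnj (a \<alpha>) * a \<alpha>)"
    unfolding a_def fourier_def
    by (subst Bochner_Integration.integral_sum, (intro torus.bdd_int bdd_sum bdd_mult bdd_const bdd_cnj bdd_chr psi)+, simp)
  also have "\<dots> = complex_of_real (\<Sum>\<alpha>\<in>F. (cmod (a \<alpha>))\<^sup>2)"
    by (simp only: of_real_sum complex_norm_square mult.commute)
  finally have 1: "(\<integral>t. \<psi> t * cnj (S t) \<partial>torus d) = complex_of_real (\<Sum>\<alpha>\<in>F. (cmod (a \<alpha>))\<^sup>2)" .
  have 2: "(\<integral>t. (cmod (S t))\<^sup>2 \<partial>torus d) = (\<Sum>\<alpha>\<in>F. (cmod (a \<alpha>))\<^sup>2)"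
    unfolding S_def by (rule parseval_finite[OF F])
  have ip: "(cmod (x - y))\<^sup>2 = (cmod x)\<^sup>2 + (cmod y)\<^sup>2 - 2 * Re (x * cnj y)" for x y :: complex
    unfolding cmod_power2 by (simp add: power2_eq_square algebra_simps)
  have "0 \<le> (\<integral>t. (cmod (\<psi> t - S t))\<^sup>2 \<partial>torus d)" by (rule integral_nonneg_AE) simp
  also have "\<dots> = (\<integral>t. (cmod (\<psi> t))\<^sup>2 + (cmod (S t))\<^sup>2 - 2 * Re (\<psi> t * cnj (S t)) \<partial>torus d)"
    by (simp only: ip)
  also have "\<dots> = (\<integral>t. (cmod (\<psi> t))\<^sup>2 + (cmod (S t))\<^sup>2 \<partial>torus d) - (\<integral>t. 2 * Re (\<psi> t * cnj (S t)) \<partial>torus d)"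
    by (intro Bochner_Integration.integral_diff torus.bdd_int bdd_add bdd_mult[OF bdd_const] bdd_Re bdd_mult[OF psi] bdd_power2 bdd_norm psi bS bdd_cnj)
  also have "(\<integral>t. (cmod (\<psi> t))\<^sup>2 + (cmod (S t))\<^sup>2 \<partial>torus d) = (\<integral>t. (cmod (\<psi> t))\<^sup>2 \<partial>torus d) + (\<integral>t. (cmod (S t))\<^sup>2 \<partial>torus d)"
    by (intro Bochner_Integration.integral_add torus.bdd_int bdd_power2 bdd_norm psi bS)
  also have "(\<integral>t. 2 * Re (\<psi> t * cnj (S t)) \<partial>torus d) = 2 * Re (\<integral>t. \<psi> t * cnj (S t) \<partial>torus d)"
    by (subst integral_Re[symmetric]) (auto intro!: torus.bdd_int bdd_mult psi bdd_cnj bS simp del: times_complex.sel)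
  finally show ?thesis unfolding 1 2 by (simp add: a_def)
qed

text \<open>Turns the unordered sum into the limit of a sequence, to which dominated convergence
  applies.\<close>

lemma idx_box_at_top: "filterlim (idx_box d) (finite_subsets_at_top (multi_idx d)) sequentially"
  unfolding filterlim_finite_subsets_at_top
proof (intro allI impI)
  fix X assume X: "finite X \<and> X \<subseteq> multi_idx d"
  then obtain N where N: "X \<subseteq> idx_box d N" using finite_subset_idx_box by blast
  have "idx_box d N \<subseteq> idx_box d M" if "M \<ge> N" for M using that by (auto simp: idx_box_def intro: order_trans)
  moreover have "idx_box d M \<subseteq> multi_idx d" for M by (auto simp: idx_box_def)
  ultimately show "\<forall>\<^sub>F y in sequentially. finite (idx_box d y) \<and> X \<subseteq> idx_box d y \<and> idx_box d y \<subseteq> multi_idx d"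
    using N by (intro eventually_sequentiallyI[of N] conjI finite_idx_box) blast+
qed

lemma riesz_dil_idx_box:
  assumes r: "0 \<le> r" "r < 1" and psi: "integrable (torus d) \<psi>"
  shows "(\<lambda>N. \<Sum>\<alpha>\<in>idx_box d N. fourier d \<psi> (int \<circ> \<alpha>) * of_real (r ^ total_deg d \<alpha>) * chr d (int \<circ> \<alpha>) t) \<longlonglongrightarrow> riesz_dil d \<psi> r t"
    and "cmod (\<Sum>\<alpha>\<in>idx_box d N. fourier d \<psi> (int \<circ> \<alpha>) * of_real (r ^ total_deg d \<alpha>) * chr d (int \<circ> \<alpha>) t)
      \<le> (\<integral>s. cmod (\<psi> s) \<partial>torus d) * infsum (\<lambda>\<alpha>. r ^ total_deg d \<alpha>) (multi_idx d)"
proof -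
  let ?Q = "infsum (\<lambda>\<alpha>. r ^ total_deg d \<alpha>) (multi_idx d)"
  define T where "T \<alpha> = fourier d \<psi> (int \<circ> \<alpha>) * of_real (r ^ total_deg d \<alpha>) * chr d (int \<circ> \<alpha>) t" for \<alpha>
  define P where "P = (\<integral>s. cmod (\<psi> s) \<partial>torus d)"
  have P0: "P \<ge> 0" unfolding P_def by (rule integral_nonneg_AE) simp
  have nT: "cmod (T \<alpha>) \<le> P * r ^ total_deg d \<alpha>" for \<alpha>
  proof -
    have "cmod (fourier d \<psi> (int \<circ> \<alpha>)) \<le> (\<integral>s. cmod (\<psi> s * cnj (chr d (int \<circ> \<alpha>) s)) \<partial>torus d)"
      unfolding fourier_def by (rule integral_norm_bound)
    then have "cmod (fourier d \<psi> (int \<circ> \<alpha>)) \<le> P" by (simp add: norm_mult P_def)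
    then show ?thesis using r by (simp add: T_def norm_mult norm_power mult_right_mono)
  qed
  have s: "(\<lambda>\<alpha>. P * r ^ total_deg d \<alpha>) summable_on multi_idx d"
    by (rule summable_on_cmult_right) (rule summable_power_total_deg[OF r])
  have "(\<lambda>\<alpha>. cmod (T \<alpha>)) summable_on multi_idx d"
    by (rule Infinite_Sum.abs_summable_on_comparison_test'[OF s]) (rule nT)
  then have "T summable_on multi_idx d" by (rule abs_summable_summable)
  then have "(sum T \<longlongrightarrow> infsum T (multi_idx d)) (finite_subsets_at_top (multi_idx d))"
    by (rule infsum_tendsto)
  from filterlim_compose[OF this idx_box_at_top]
  show "(\<lambda>N. \<Sum>\<alpha>\<in>idx_box d N. fourier d \<psi> (int \<circ> \<alpha>) * of_real (r ^ total_deg d \<alpha>) * chr d (int \<circ> \<alpha>) t) \<longlonglongrightarrow> riesz_dil d \<psi> r t"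
    by (simp add: riesz_dil_def T_def[abs_def] total_deg_def)
  have "cmod (sum T (idx_box d N)) \<le> (\<Sum>\<alpha>\<in>idx_box d N. P * r ^ total_deg d \<alpha>)"
    by (rule sum_norm_le) (rule nT)
  also have "\<dots> = P * (\<Sum>\<alpha>\<in>idx_box d N. r ^ total_deg d \<alpha>)" by (simp add: sum_distrib_left)
  also have "\<dots> \<le> P * ?Q"
    by (intro mult_left_mono finite_sum_le_infsum summable_power_total_deg r finite_idx_box P0) (use r in \<open>auto simp: idx_box_def\<close>)
  finally show "cmod (\<Sum>\<alpha>\<in>idx_box d N. fourier d \<psi> (int \<circ> \<alpha>) * of_real (r ^ total_deg d \<alpha>) * chr d (int \<circ> \<alpha>) t)
      \<le> (\<integral>s. cmod (\<psi> s) \<partial>torus d) * ?Q"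
    by (simp add: T_def P_def)
qed

lemma power_diff_le:
  fixes r s :: real
  assumes "0 \<le> r" "r < 1" "0 \<le> s" "s < 1"
  shows "(r ^ m - s ^ m)\<^sup>2 \<le> 1" "(r ^ m - s ^ m)\<^sup>2 \<le> (1 - r ^ m) + (1 - s ^ m)"
proof -
  have p: "0 \<le> r ^ m" "r ^ m \<le> 1" "0 \<le> s ^ m" "s ^ m \<le> 1" using assms by (auto simp: power_le_one)
  then have a: "\<bar>r ^ m - s ^ m\<bar> \<le> 1" by linarith
  then show "(r ^ m - s ^ m)\<^sup>2 \<le> 1" by (simp add: abs_square_le_1)
  have "(r ^ m - s ^ m)\<^sup>2 = \<bar>r ^ m - s ^ m\<bar> * \<bar>r ^ m - s ^ m\<bar>" by (simp add: power2_eq_square)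
  also have "\<dots> \<le> \<bar>r ^ m - s ^ m\<bar> * 1" using a by (intro mult_left_mono) auto
  also have "\<dots> \<le> (1 - r ^ m) + (1 - s ^ m)" using p by (auto intro!: abs_leI)
  finally show "(r ^ m - s ^ m)\<^sup>2 \<le> (1 - r ^ m) + (1 - s ^ m)" .
qed

text \<open>A bounded function has square summable coefficients, so the claim can be proved in L^2,
  where Parseval gives the difference of two dilations as the sum of \<open>c \<alpha> * (r ^
  total_deg d \<alpha> - s ^ total_deg d \<alpha>)\<^sup>2\<close>. A finite set of indices carries
  almost all of the mass, and on it the factors are small near 1.\<close>

lemma riesz_dil_cauchy_bdd:
  assumes psi: "bdd (torus d) \<psi>" and eps: "\<epsilon> > 0"
  shows "\<exists>b<1. 0 \<le> b \<and> (\<forall>r s. b < r \<longrightarrow> r < 1 \<longrightarrow> b < s \<longrightarrow> s < 1 \<longrightarrow>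
    (\<integral>t. cmod (riesz_dil d \<psi> r t - riesz_dil d \<psi> s t) \<partial>torus d) \<le> \<epsilon>)"
proof -
  define c where "c \<alpha> = (cmod (fourier d \<psi> (int \<circ> \<alpha>)))\<^sup>2" for \<alpha>
  have c0: "c \<alpha> \<ge> 0" for \<alpha> by (simp add: c_def)
  have cs: "c summable_on multi_idx d"
  proof (rule nonneg_bdd_above_summable_on)
    show "bdd_above (sum c ` {F. F \<subseteq> multi_idx d \<and> finite F})"
      by (rule bdd_aboveI2) (auto simp: c_def intro: bessel[OF psi])
  qed (rule c0)
  \<comment> \<open>Three contributions of size \<open>e\<close> are added: the tail outside
    \<open>F0\<close>, and on \<open>F0\<close> the defects of \<open>r\<close> and of
    \<open>s\<close>.\<close>
  define e where "e = \<epsilon>\<^sup>2 / 3"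
  have e: "e > 0" using eps by (simp add: e_def)
  obtain F0 where F0: "finite F0" "F0 \<subseteq> multi_idx d" "dist (sum c F0) (infsum c (multi_idx d)) \<le> e"
    using infsum_finite_approximation[OF cs e] by blast
  have tail: "sum c F \<le> e" if "finite F" "F \<subseteq> multi_idx d - F0" for F
  proof -
    have "sum c F + sum c F0 = sum c (F \<union> F0)"
      using that F0 by (intro sum.union_disjoint[symmetric]) auto
    also have "\<dots> \<le> infsum c (multi_idx d)"
      using that F0 c0 by (intro finite_sum_le_infsum cs) auto
    finally show ?thesis using F0(3) by (simp add: dist_real_def abs_le_iff)
  qed
  have "((\<lambda>r. \<Sum>\<alpha>\<in>F0. c \<alpha> * (1 - r ^ total_deg d \<alpha>)) \<longlongrightarrow> (\<Sum>\<alpha>\<in>F0. c \<alpha> * (1 - 1 ^ total_deg d \<alpha>))) (at_left (1::real))"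
    by (intro tendsto_intros)
  then have "\<forall>\<^sub>F r in at_left 1. (\<Sum>\<alpha>\<in>F0. c \<alpha> * (1 - r ^ total_deg d \<alpha>)) < e"
    using e by (intro order_tendstoD(2)) auto
  then obtain b where b: "b < 1" "\<And>r. b < r \<Longrightarrow> r < 1 \<Longrightarrow> (\<Sum>\<alpha>\<in>F0. c \<alpha> * (1 - r ^ total_deg d \<alpha>)) < e"
    unfolding eventually_at_left_field by blast
  have main: "(\<integral>t. cmod (riesz_dil d \<psi> r t - riesz_dil d \<psi> s t) \<partial>torus d) \<le> \<epsilon>"
    if rs: "max b 0 < r" "r < 1" "max b 0 < s" "s < 1" for r s
  proof -
    have r: "0 \<le> r" "r < 1" and s: "0 \<le> s" "s < 1" using rs by auto
    note ipsi = torus.bdd_int[OF psi]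
    define D where "D t = riesz_dil d \<psi> r t - riesz_dil d \<psi> s t" for t
    have bD: "bdd (torus d) D" unfolding D_def by (intro bdd_diff bdd_riesz_dil r s ipsi)
    define S where "S N t = (\<Sum>\<alpha>\<in>idx_box d N. (fourier d \<psi> (int \<circ> \<alpha>) * of_real (r ^ total_deg d \<alpha> - s ^ total_deg d \<alpha>)) * chr d (int \<circ> \<alpha>) t)" for N t
    have S_eq: "S N t = (\<Sum>\<alpha>\<in>idx_box d N. fourier d \<psi> (int \<circ> \<alpha>) * of_real (r ^ total_deg d \<alpha>) * chr d (int \<circ> \<alpha>) t)
        - (\<Sum>\<alpha>\<in>idx_box d N. fourier d \<psi> (int \<circ> \<alpha>) * of_real (s ^ total_deg d \<alpha>) * chr d (int \<circ> \<alpha>) t)" for N t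
      unfolding S_def sum_subtractf[symmetric] by (rule sum.cong) (auto simp: algebra_simps)
    define B where "B = (\<integral>s. cmod (\<psi> s) \<partial>torus d) * infsum (\<lambda>\<alpha>. r ^ total_deg d \<alpha>) (multi_idx d)
      + (\<integral>s. cmod (\<psi> s) \<partial>torus d) * infsum (\<lambda>\<alpha>. s ^ total_deg d \<alpha>) (multi_idx d)"
    have lim: "(\<lambda>N. \<integral>t. (cmod (S N t))\<^sup>2 \<partial>torus d) \<longlonglongrightarrow> (\<integral>t. (cmod (D t))\<^sup>2 \<partial>torus d)"
    proof (rule integral_dominated_convergence[where w="\<lambda>_. B\<^sup>2"])
      show "AE t in torus d. (\<lambda>N. (cmod (S N t))\<^sup>2) \<longlonglongrightarrow> (cmod (D t))\<^sup>2"
        unfolding S_eq D_def by (intro AE_I2 tendsto_intros riesz_dil_idx_box r s ipsi)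
      have "cmod (S N t) \<le> B" for N t
        unfolding S_eq B_def
        by (rule order_trans[OF norm_triangle_ineq4 add_mono[OF riesz_dil_idx_box(2)[OF r ipsi] riesz_dil_idx_box(2)[OF s ipsi]]])
      then show "AE t in torus d. norm ((cmod (S N t))\<^sup>2) \<le> B\<^sup>2" for N
        by (intro AE_I2) (simp add: power_mono)
      have "bdd (torus d) (S N)" for N unfolding S_def by (intro bdd_sum bdd_mult bdd_const bdd_chr)
      then show "(\<lambda>t. (cmod (S N t))\<^sup>2) \<in> borel_measurable (torus d)" for N
        by (intro bdd_measurable bdd_power2 bdd_norm)
      show "(\<lambda>t. (cmod (D t))\<^sup>2) \<in> borel_measurable (torus d)" by (intro bdd_measurable bdd_power2 bdd_norm bD)
    qed simp
    have le: "(\<integral>t. (cmod (S N t))\<^sup>2 \<partial>torus d) \<le> \<epsilon>\<^sup>2" for N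
    proof -
      have "(\<integral>t. (cmod (S N t))\<^sup>2 \<partial>torus d) = (\<Sum>\<alpha>\<in>idx_box d N. (cmod (fourier d \<psi> (int \<circ> \<alpha>) * of_real (r ^ total_deg d \<alpha> - s ^ total_deg d \<alpha>)))\<^sup>2)"
        unfolding S_def by (rule parseval_finite[OF finite_idx_box]) (auto simp: idx_box_def)
      also have "\<dots> = (\<Sum>\<alpha>\<in>idx_box d N. c \<alpha> * (r ^ total_deg d \<alpha> - s ^ total_deg d \<alpha>)\<^sup>2)"
        by (intro sum.cong refl) (simp only: c_def norm_mult power_mult_distrib norm_of_real power2_abs)
      also have "\<dots> = (\<Sum>\<alpha>\<in>idx_box d N \<inter> F0. c \<alpha> * (r ^ total_deg d \<alpha> - s ^ total_deg d \<alpha>)\<^sup>2) + (\<Sum>\<alpha>\<in>idx_box d N - F0. c \<alpha> * (r ^ total_deg d \<alpha> - s ^ total_deg d \<alpha>)\<^sup>2)"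
        by (rule sum.Int_Diff[OF finite_idx_box])
      also have "(\<Sum>\<alpha>\<in>idx_box d N - F0. c \<alpha> * (r ^ total_deg d \<alpha> - s ^ total_deg d \<alpha>)\<^sup>2) \<le> (\<Sum>\<alpha>\<in>idx_box d N - F0. c \<alpha>)"
        using power_diff_le(1)[OF r s] c0 by (intro sum_mono) (simp add: mult_left_le)
      also have "\<dots> \<le> e" by (rule tail[OF finite_Diff[OF finite_idx_box]]) (auto simp: idx_box_def)
      also have "(\<Sum>\<alpha>\<in>idx_box d N \<inter> F0. c \<alpha> * (r ^ total_deg d \<alpha> - s ^ total_deg d \<alpha>)\<^sup>2) \<le> (\<Sum>\<alpha>\<in>F0. c \<alpha> * (r ^ total_deg d \<alpha> - s ^ total_deg d \<alpha>)\<^sup>2)"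
        using F0 c0 by (intro sum_mono2) auto
      also have "\<dots> \<le> (\<Sum>\<alpha>\<in>F0. c \<alpha> * (1 - r ^ total_deg d \<alpha>) + c \<alpha> * (1 - s ^ total_deg d \<alpha>))"
        using power_diff_le(2)[OF r s] c0 by (intro sum_mono) (simp add: mult_left_mono flip: distrib_left)
      also have "\<dots> = (\<Sum>\<alpha>\<in>F0. c \<alpha> * (1 - r ^ total_deg d \<alpha>)) + (\<Sum>\<alpha>\<in>F0. c \<alpha> * (1 - s ^ total_deg d \<alpha>))"
        by (rule sum.distrib)
      finally show ?thesis using b(2)[of r] b(2)[of s] rs by (simp add: e_def)
    qed
    have "(\<integral>t. (cmod (D t))\<^sup>2 \<partial>torus d) \<le> \<epsilon>\<^sup>2" by (rule LIMSEQ_le_const2[OF lim]) (use le in auto)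
    then have "Lpnorm (torus d) 2 D \<le> \<epsilon>" unfolding Lpnorm_2 using eps by (simp add: real_le_lsqrt)
    then have "Lpnorm (torus d) 1 D \<le> \<epsilon>" using torus.Lpnorm_mono_exponent[OF bD, of 1 2] by simp
    then show ?thesis by (simp add: Lpnorm_def integral_nonneg_AE D_def)
  qed
  show ?thesis by (rule exI[of _ "max b 0"]) (use b(1) main in auto)
qed

lemma Lpnorm_trunc_diff_lim:
  assumes p: "p > 0" and psi: "in_Lq d p \<psi>"
  shows "(\<lambda>N. Lpnorm (torus d) p (\<lambda>t. \<psi> t - trunc N \<psi> t)) \<longlonglongrightarrow> 0"
proof -
  have m[measurable]: "\<psi> \<in> borel_measurable (torus d)" and i: "integrable (torus d) (\<lambda>t. cmod (\<psi> t) powr p)"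
    using psi unfolding in_Lq_iff[OF p] by auto
  have "(\<lambda>N. \<integral>t. cmod (\<psi> t - trunc N \<psi> t) powr p \<partial>torus d) \<longlonglongrightarrow> (\<integral>t. 0 \<partial>torus d)"
  proof (rule integral_dominated_convergence[where w="\<lambda>t. cmod (\<psi> t) powr p"])
    have "(\<lambda>N. cmod (\<psi> t - trunc N \<psi> t) powr p) \<longlonglongrightarrow> cmod (\<psi> t - \<psi> t) powr p" for t
      using p by (intro tendsto_powr2 tendsto_norm tendsto_diff trunc_lim tendsto_const always_eventually) auto
    then show "AE t in torus d. (\<lambda>N. cmod (\<psi> t - trunc N \<psi> t) powr p) \<longlonglongrightarrow> 0" by simp
    show "AE t in torus d. norm (cmod (\<psi> t - trunc N \<psi> t) powr p) \<le> cmod (\<psi> t) powr p" for N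
      using p by (intro AE_I2) (auto simp: trunc_def intro!: powr_mono2)
  qed (use i in auto)
  then have l: "(\<lambda>N. \<integral>t. cmod (\<psi> t - trunc N \<psi> t) powr p \<partial>torus d) \<longlonglongrightarrow> 0" by simp
  have "(\<lambda>N. Lpnorm (torus d) p (\<lambda>t. \<psi> t - trunc N \<psi> t)) \<longlonglongrightarrow> 0 powr (1 / p)"
    unfolding Lpnorm_def
    by (rule tendsto_powr2[OF l tendsto_const]) (use p in \<open>auto intro!: always_eventually integral_nonneg_AE\<close>)
  then show ?thesis by simp
qed

text \<open>Truncation reduces to the bounded case. Its error is controlled for all dilations
  simultaneously, since the constant in \<open>riesz_dil_bounded\<close> does not depend on
  \<open>r\<close>.\<close>

lemma riesz_dil_cauchy:
  assumes psi: "in_Lq d (4/3) \<psi>" and eps: "\<epsilon> > 0"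
  shows "\<exists>b<1. 0 \<le> b \<and> (\<forall>r s. b < r \<longrightarrow> r < 1 \<longrightarrow> b < s \<longrightarrow> s < 1 \<longrightarrow>
    (\<integral>t. cmod (riesz_dil d \<psi> r t - riesz_dil d \<psi> s t) \<partial>torus d) \<le> \<epsilon>)"
proof -
  let ?F = "riesz_dil d"
  let ?J = "\<lambda>f g. \<integral>t. cmod (f t - g t :: complex) \<partial>torus d"
  have i: "integrable (torus d) \<psi>" using in_Lq_mono[OF psi, of 1] by (simp add: in_Lq_1)
  have m[measurable]: "\<psi> \<in> borel_measurable (torus d)" using i by auto
  have "(\<lambda>N. 2 ^ d * Lpnorm (torus d) (4/3) (\<lambda>t. \<psi> t - trunc N \<psi> t)) \<longlonglongrightarrow> 0"
    by (intro tendsto_mult_right_zero Lpnorm_trunc_diff_lim psi) simp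
  then have "\<forall>\<^sub>F N in sequentially. 2 ^ d * Lpnorm (torus d) (4/3) (\<lambda>t. \<psi> t - trunc N \<psi> t) < \<epsilon> / 3"
    using eps by (elim order_tendstoD(2)) auto
  then obtain N where N: "2 ^ d * Lpnorm (torus d) (4/3) (\<lambda>t. \<psi> t - trunc N \<psi> t) < \<epsilon> / 3"
    unfolding eventually_sequentially by blast
  define \<phi> where "\<phi> = trunc N \<psi>"
  have bphi: "bdd (torus d) \<phi>" unfolding \<phi>_def by (rule bdd_trunc[OF m])
  note iphi = torus.bdd_int[OF bphi]
  have L: "in_Lq d (4/3) (\<lambda>t. \<psi> t - \<phi> t)"
  proof -
    have "integrable (torus d) (\<lambda>t. cmod (\<psi> t - \<phi> t) powr (4/3))"
    proof (rule Bochner_Integration.integrable_bound)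
      show "integrable (torus d) (\<lambda>t. cmod (\<psi> t) powr (4/3))" using psi by (simp add: in_Lq_iff)
      show "AE t in torus d. norm (cmod (\<psi> t - \<phi> t) powr (4/3)) \<le> norm (cmod (\<psi> t) powr (4/3))"
        by (intro AE_I2) (auto simp: \<phi>_def trunc_def)
    qed (simp add: \<phi>_def)
    then show ?thesis by (simp add: in_Lq_iff \<phi>_def)
  qed
  have near: "?J (?F \<psi> r) (?F \<phi> r) \<le> \<epsilon> / 3" if r: "0 \<le> r" "r < 1" for r
    using riesz_dil_bounded[OF r L] N[folded \<phi>_def] unfolding riesz_dil_diff[OF r i iphi] by linarith
  obtain b where b: "b < 1" "0 \<le> b" "\<And>r s. b < r \<Longrightarrow> r < 1 \<Longrightarrow> b < s \<Longrightarrow> s < 1 \<Longrightarrow>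
    ?J (?F \<phi> r) (?F \<phi> s) \<le> \<epsilon> / 3"
    using riesz_dil_cauchy_bdd[OF bphi, of "\<epsilon> / 3"] eps by auto
  have "?J (?F \<psi> r) (?F \<psi> s) \<le> \<epsilon>"
    if rs: "b < r" "r < 1" "b < s" "s < 1" for r s
  proof -
    have r: "0 \<le> r" "r < 1" and s: "0 \<le> s" "s < 1" using rs b by auto
    note bd = bdd_riesz_dil[OF r i] bdd_riesz_dil[OF r iphi] bdd_riesz_dil[OF s i] bdd_riesz_dil[OF s iphi]
    note I = torus.bdd_int[OF bdd_norm[OF bdd_diff[OF bd(1) bd(2)]]] torus.bdd_int[OF bdd_norm[OF bdd_diff[OF bd(2) bd(4)]]]
      torus.bdd_int[OF bdd_norm[OF bdd_diff[OF bd(3) bd(4)]]] torus.bdd_int[OF bdd_norm[OF bdd_diff[OF bd(1) bd(3)]]]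
    have "?J (?F \<psi> r) (?F \<psi> s) \<le>
      (\<integral>t. cmod (?F \<psi> r t - ?F \<phi> r t) + cmod (?F \<phi> r t - ?F \<phi> s t)
         + cmod (?F \<psi> s t - ?F \<phi> s t) \<partial>torus d)"
    proof (rule integral_mono)
      fix t
      have "cmod (x - z) \<le> cmod (x - y) + cmod (y - w) + cmod (z - w)" for x y z w :: complex
        by (smt (verit) norm_minus_commute norm_triangle_sub diff_add_cancel diff_diff_eq2 norm_triangle_ineq add_diff_eq)
      then show "cmod (?F \<psi> r t - ?F \<psi> s t) \<le> cmod (?F \<psi> r t - ?F \<phi> r t) + cmod (?F \<phi> r t - ?F \<phi> s t)
         + cmod (?F \<psi> s t - ?F \<phi> s t)" .
    qed (use I in auto)
    also have "\<dots> = ?J (?F \<psi> r) (?F \<phi> r) + ?J (?F \<phi> r) (?F \<phi> s)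
         + ?J (?F \<psi> s) (?F \<phi> s)"
      using I by simp
    also have "\<dots> \<le> \<epsilon>" using near[OF r] near[OF s] b(3)[OF rs] by linarith
    finally show ?thesis .
  qed
  then show ?thesis using b(1,2) by blast
qed

section \<open>The upper bound\<close>

text \<open>The rate makes the telescoping series of the differences absolutely convergent almost
  everywhere; its sum is the limit, and the geometric tail bounds the error.\<close>

lemma L1_complete:
  fixes F :: "nat \<Rightarrow> 'a \<Rightarrow> complex"
  assumes int: "\<And>n. integrable M (F n)"
    and cau: "\<And>n. (\<integral>x. norm (F (Suc n) x - F n x) \<partial>M) \<le> (1 / 2) ^ n"
  shows "\<exists>f. integrable M f \<and> (\<lambda>n. \<integral>x. norm (F n x - f x) \<partial>M) \<longlonglongrightarrow> 0"
proof -
  define D where "D n x = F (Suc n) x - F n x" for n x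
  have iD: "integrable M (D n)" for n unfolding D_def using int by auto
  note borel_measurable_integrable[OF iD, measurable]
  define J where "J n = (\<integral>x. norm (D n x) \<partial>M)" for n
  have J: "0 \<le> J n" "J n \<le> (1 / 2) ^ n" for n
    using cau unfolding J_def D_def by (auto intro: integral_nonneg_AE)
  have sJ: "summable J"
    by (rule summable_comparison_test'[where g="\<lambda>n. (1 / 2) ^ n" and N=0]) (use J in \<open>auto simp: summable_geometric\<close>)
  have ae: "AE x in M. summable (\<lambda>n. norm (D n x))"
  proof -
    have "(\<integral>\<^sup>+x. (\<Sum>n. ennreal (norm (D n x))) \<partial>M) = (\<Sum>n. \<integral>\<^sup>+x. ennreal (norm (D n x)) \<partial>M)"
      by (rule nn_integral_suminf) auto
    also have "\<dots> = (\<Sum>n. ennreal (J n))"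
      unfolding J_def using iD by (simp add: nn_integral_eq_integral)
    also have "\<dots> = ennreal (\<Sum>n. J n)" by (rule suminf_ennreal2[OF J(1) sJ])
    finally have "(\<integral>\<^sup>+x. (\<Sum>n. ennreal (norm (D n x))) \<partial>M) \<noteq> \<infinity>" by simp
    then have "AE x in M. (\<Sum>n. ennreal (norm (D n x))) \<noteq> \<infinity>"
      by (intro nn_integral_PInf_AE) auto
    then show ?thesis
      by (rule AE_mp) (auto intro!: AE_I2 summable_suminf_not_top)
  qed
  define f where "f x = F 0 x + (\<Sum>n. D n x)" for x
  have isum: "integrable M (\<lambda>x. \<Sum>n. D n x)"
    by (rule integrable_suminf[OF iD ae]) (use sJ in \<open>simp add: J_def[abs_def]\<close>)
  have iff: "integrable M f" unfolding f_def using isum int by auto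
  have bd: "norm (\<integral>x. norm (F n x - f x) \<partial>M) \<le> 2 * (1 / 2) ^ n" for n
  proof -
    have ae': "AE x in M. summable (\<lambda>k. norm (norm (D (k + n) x)))"
      by (rule AE_mp[OF ae]) (auto intro!: AE_I2 summable_ignore_initial_segment)
    have sJ': "summable (\<lambda>k. \<integral>x. norm (norm (D (k + n) x)) \<partial>M)"
      using summable_ignore_initial_segment[OF sJ, of n] by (simp add: J_def)
    have iN: "integrable M (\<lambda>x. norm (D (k + n) x))" for k using iD by auto
    have "(\<integral>x. norm (F n x - f x) \<partial>M) \<le> (\<integral>x. (\<Sum>k. norm (D (k + n) x)) \<partial>M)"
    proof (rule integral_mono_AE)
      show "integrable M (\<lambda>x. norm (F n x - f x))" using int iff by auto
      show "integrable M (\<lambda>x. \<Sum>k. norm (D (k + n) x))" by (rule integrable_suminf[OF iN ae' sJ'])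
      show "AE x in M. norm (F n x - f x) \<le> (\<Sum>k. norm (D (k + n) x))"
      proof (rule AE_mp[OF ae], rule AE_I2, rule impI)
        fix x assume s: "summable (\<lambda>n. norm (D n x))"
        have "F n x = F 0 x + (\<Sum>k<n. D k x)" by (induction n) (auto simp: D_def)
        moreover have "(\<Sum>k. D k x) = (\<Sum>k. D (k + n) x) + (\<Sum>k<n. D k x)"
          by (rule suminf_split_initial_segment[OF summable_norm_cancel[OF s]])
        ultimately have "F n x - f x = - (\<Sum>k. D (k + n) x)" by (simp add: f_def)
        then show "norm (F n x - f x) \<le> (\<Sum>k. norm (D (k + n) x))"
          using summable_norm[OF summable_ignore_initial_segment[OF s, of n]] by simp
      qed
    qed
    also have "\<dots> = (\<Sum>k. J (k + n))"
      unfolding J_def by (rule integral_suminf[OF iN ae' sJ'])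
    also have "\<dots> \<le> (\<Sum>k. (1 / 2) ^ n * (1 / 2) ^ k)"
      using J(2) by (intro suminf_le summable_ignore_initial_segment sJ summable_mult summable_geometric)
        (auto simp flip: power_add simp: add.commute)
    also have "\<dots> = (1 / 2) ^ n * 2" by (subst suminf_mult) (auto simp: suminf_geometric summable_geometric)
    finally show ?thesis by (simp add: abs_of_nonneg integral_nonneg_AE)
  qed
  have "(\<lambda>n. 2 * (1 / 2 :: real) ^ n) \<longlonglongrightarrow> 0"
    by (intro tendsto_mult_right_zero LIMSEQ_power_zero) simp
  then have "(\<lambda>n. \<integral>x. norm (F n x - f x) \<partial>M) \<longlonglongrightarrow> 0"
    by (rule Lim_null_comparison[OF always_eventually[OF allI[OF bd]]])
  then show ?thesis using iff by blast
qed

lemma riesz_boundary: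
  assumes psi: "in_Lq d (4/3) \<psi>"
  shows "\<exists>f. integrable (torus d) f \<and>
    ((\<lambda>r. \<integral>t. cmod (riesz_dil d \<psi> r t - f t) \<partial>torus d) \<longlongrightarrow> 0) (at_left 1)"
proof -
  let ?F = "riesz_dil d \<psi>"
  let ?J = "\<lambda>f g. \<integral>t. cmod (f t - g t :: complex) \<partial>torus d"
  have i: "integrable (torus d) \<psi>" using in_Lq_mono[OF psi, of 1] by (simp add: in_Lq_1)
  have "\<forall>n. \<exists>b<1. 0 \<le> b \<and> (\<forall>r s. b < r \<longrightarrow> r < 1 \<longrightarrow> b < s \<longrightarrow> s < 1 \<longrightarrow>
    ?J (?F r) (?F s) \<le> (1 / 2) ^ n)"
    by (intro allI riesz_dil_cauchy[OF psi]) simp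
  then obtain b where b: "\<And>n. b n < 1" "\<And>n. 0 \<le> b n"
    "\<And>n r s. b n < r \<Longrightarrow> r < 1 \<Longrightarrow> b n < s \<Longrightarrow> s < 1 \<Longrightarrow> 
    ?J (?F r) (?F s) \<le> (1 / 2) ^ n"
    by metis
  \<comment> \<open>Since \<open>b\<close> need not be monotone, \<rho> n is placed beyond all of b
    0, ..., b n. Then \<rho> n and all later terms lie in the range where the n-th Cauchy estimate
    holds.\<close>
  define \<rho> where "\<rho> n = (1 + Max (b ` {..n})) / 2" for n
  have M1: "Max (b ` {..n}) < 1" for n using b(1) by simp
  have rb: "b k < \<rho> n" if "k \<le> n" for k n
  proof -
    have "b k \<le> Max (b ` {..n})" using that by simp
    moreover have "b k < (1 + x) / 2" if "b k \<le> x" "x < 1" for x using that by simp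
    ultimately show ?thesis using M1[of n] unfolding \<rho>_def by blast
  qed
  have r1: "\<rho> n < 1" for n
  proof -
    have "(1 + x) / 2 < 1" if "x < 1" for x :: real using that by simp
    then show ?thesis using M1[of n] unfolding \<rho>_def by blast
  qed
  have r0: "0 \<le> \<rho> n" for n using rb[of n n] b(2)[of n] by simp
  define F where "F n = riesz_dil d \<psi> (\<rho> n)" for n
  have iF: "integrable (torus d) (F n)" for n
    unfolding F_def by (rule torus.bdd_int[OF bdd_riesz_dil[OF r0 r1 i]])
  have "(\<integral>t. cmod (F (Suc n) t - F n t) \<partial>torus d) \<le> (1 / 2) ^ n" for n
    unfolding F_def by (rule b(3)) (auto intro!: rb r1)
  from L1_complete[OF iF this] obtain f where f: "integrable (torus d) f"
    "(\<lambda>n. \<integral>t. cmod (F n t - f t) \<partial>torus d) \<longlonglongrightarrow> 0" by blast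
  have le: "(?J (?F r) f) \<le> (1 / 2) ^ n" if r: "b n < r" "r < 1" for n r
  proof -
    have r0': "0 \<le> r" using r b(2)[of n] by simp
    have ir: "integrable (torus d) (?F r)" by (rule torus.bdd_int[OF bdd_riesz_dil[OF r0' r(2) i]])
    have "(?J (?F r) f) \<le> (1 / 2) ^ n + ?J (F m) f" if m: "m \<ge> n" for m
    proof -
      have "(?J (?F r) f) \<le> (\<integral>t. cmod (?F r t - F m t) + cmod (F m t - f t) \<partial>torus d)"
      proof (rule integral_mono)
        show "integrable (torus d) (\<lambda>t. cmod (?F r t - f t))" using ir f by auto
        show "integrable (torus d) (\<lambda>t. cmod (?F r t - F m t) + cmod (F m t - f t))" using ir f iF by auto
        show "cmod (?F r t - f t) \<le> cmod (?F r t - F m t) + cmod (F m t - f t)" for t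
          using norm_triangle_ineq[of "?F r t - F m t" "F m t - f t"] by simp
      qed
      also have "\<dots> = ?J (?F r) (F m) + ?J (F m) f"
        using ir f iF by (intro Bochner_Integration.integral_add) auto
      also have "?J (?F r) (F m) \<le> (1 / 2) ^ n"
        unfolding F_def by (rule b(3)) (use r m in \<open>auto intro!: rb r1\<close>)
      finally show ?thesis by simp
    qed
    moreover have "(\<lambda>m. (1 / 2) ^ n + ?J (F m) f) \<longlonglongrightarrow> (1 / 2) ^ n + 0"
      by (intro tendsto_intros f)
    ultimately show ?thesis by (intro LIMSEQ_le_const[of _ "(1 / 2) ^ n"]) auto
  qed
  have "((\<lambda>r. ?J (?F r) f) \<longlongrightarrow> 0) (at_left 1)"
  proof (rule tendstoI)
    fix e :: real assume "e > 0"
    then obtain n where n: "(1 / 2) ^ n < e" using real_arch_pow_inv[of e "1 / 2"] by auto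
    have "0 \<le> (?J (?F r) f)" for r by (rule integral_nonneg_AE) simp
    then have "dist (?J (?F r) f) 0 < e" if "b n < r" "r < 1" for r
      using le[OF that] n by simp
    then show "\<forall>\<^sub>F r in at_left 1. dist (?J (?F r) f) 0 < e"
      unfolding eventually_at_left_field using b(1)[of n] by blast
  qed
  then show ?thesis using f(1) by blast
qed

section \<open>The geometric mean of an integrable function and its behaviour under limits in
  L^1\<close>

lemma ennreal_max_0: "ennreal (max 0 x) = ennreal x"
  by (cases "x \<ge> 0") (auto simp: max_def ennreal_neg)

lemma geo_mean_eq:
  assumes nz: "AE t in torus d. f t \<noteq> 0" and int: "integrable (torus d) (\<lambda>t. ln (cmod (f t)))"
  shows "geo_mean d f = exp (\<integral>t. ln (cmod (f t)) \<partial>torus d)"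
proof -
  have "(\<integral>\<^sup>+ t. (if f t = 0 then \<infinity> else ennreal (max 0 (- ln (cmod (f t))))) \<partial>torus d) = (\<integral>\<^sup>+ t. ennreal (- ln (cmod (f t))) \<partial>torus d)"
    by (rule nn_integral_cong_AE) (rule AE_mp[OF nz], auto simp: ennreal_max_0)
  then show ?thesis
    using int unfolding geo_mean_def Let_def ennreal_max_0 real_integrable_def real_lebesgue_integral_def[OF int]
    by simp
qed

text \<open>If the negative part of the logarithm has infinite integral, the definition yields 0.
  Otherwise \<open>f\<close> has almost no zeros, and the logarithm is integrable because its
  positive part is at most |f|.\<close>

lemma geo_mean_cases:
  assumes f: "integrable (torus d) f"
  obtains "geo_mean d f = 0" | "AE t in torus d. f t \<noteq> 0" "integrable (torus d) (\<lambda>t. ln (cmod (f t)))"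
proof (cases "(\<integral>\<^sup>+ t. (if f t = 0 then \<infinity> else ennreal (max 0 (- ln (cmod (f t))))) \<partial>torus d) = \<infinity>")
  case True
  then show ?thesis using that(1) by (simp add: geo_mean_def)
next
  case False
  note borel_measurable_integrable[OF f, measurable]
  let ?n = "\<lambda>t. (if f t = 0 then \<infinity> else ennreal (max 0 (- ln (cmod (f t)))))"
  have "AE t in torus d. ?n t \<noteq> \<infinity>"
    by (rule nn_integral_PInf_AE[OF _ False]) measurable
  then have nz: "AE t in torus d. f t \<noteq> 0" by (rule AE_mp) auto
  have "(\<integral>\<^sup>+ t. ennreal (- ln (cmod (f t))) \<partial>torus d) \<le> (\<integral>\<^sup>+ t. ?n t \<partial>torus d)"
    by (rule nn_integral_mono) (auto simp: ennreal_max_0)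
  then have 1: "(\<integral>\<^sup>+ t. ennreal (- ln (cmod (f t))) \<partial>torus d) \<noteq> \<infinity>" using False by (auto simp: top_unique)
  \<comment> \<open>This includes x = 0, where \<open>ln 0 = 0\<close>.\<close>
  have "ln x \<le> x" if "x \<ge> 0" for x :: real using that ln_bound[of x] by (cases "x = 0") auto
  then have "(\<integral>\<^sup>+ t. ennreal (ln (cmod (f t))) \<partial>torus d) \<le> (\<integral>\<^sup>+ t. ennreal (cmod (f t)) \<partial>torus d)"
    by (intro nn_integral_mono ennreal_leI) auto
  also have "\<dots> < \<infinity>" using f unfolding integrable_iff_bounded by simp
  finally have "integrable (torus d) (\<lambda>t. ln (cmod (f t)))" using 1 by (simp add: real_integrable_def)
  then show ?thesis using that(2) nz by blast
qed

text \<open>The map ln (|z| + \<epsilon>) is Lipschitz with constant 1/\<epsilon>, so its mean is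
  continuous in L^1 although that of ln |z| is not. After the limit in \<open>r\<close>, ln |f|
  \<le> ln (|f| + \<epsilon>) and \<epsilon> is sent to 0.\<close>

lemma riesz_geo_mean:
  assumes d: "d \<ge> 1" and psi: "in_Lq d (crit_exp d) \<psi>" "integrable (torus d) \<psi>" and f: "integrable (torus d) f"
    and lim: "((\<lambda>r. \<integral>t. cmod (riesz_dil d \<psi> r t - f t) \<partial>torus d) \<longlongrightarrow> 0) (at_left 1)"
  shows "geo_mean d f \<le> Lpnorm (torus d) (crit_exp d) \<psi>"
  using f
proof (cases rule: geo_mean_cases)
  case 1
  then show ?thesis by (simp add: Lpnorm_nonneg)
next
  case 2
  note borel_measurable_integrable[OF f, measurable]
  let ?F = "riesz_dil d \<psi>"
  let ?l = "\<lambda>\<epsilon> g t. ln (cmod (g t :: complex) + \<epsilon>)"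
  let ?J = "\<lambda>f g. \<integral>t. cmod (f t - g t :: complex) \<partial>torus d"
  define c where "c = Lpnorm (torus d) (crit_exp d) \<psi>"
  have "exp (\<integral>t. ln (cmod (f t)) \<partial>torus d) \<le> c + 2 * \<epsilon>" if eps: "\<epsilon> > 0" for \<epsilon>
  proof -
    have lnle: "\<bar>ln (cmod z + \<epsilon>)\<bar> \<le> cmod z / \<epsilon> + \<bar>ln \<epsilon>\<bar>" for z :: complex
      using ln_lipschitz[OF eps, of "cmod z" 0] by auto
    have il: "integrable (torus d) (\<lambda>t. ?l \<epsilon> f t)"
    proof (rule Bochner_Integration.integrable_bound)
      show "integrable (torus d) (\<lambda>t. cmod (f t) / \<epsilon> + \<bar>ln \<epsilon>\<bar>)" using f by auto
      show "AE t in torus d. norm (?l \<epsilon> f t) \<le> norm (cmod (f t) / \<epsilon> + \<bar>ln \<epsilon>\<bar>)"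
        using lnle by (intro AE_I2) (metis real_norm_def order_trans abs_ge_self)
    qed measurable
    have near: "\<bar>(\<integral>t. ?l \<epsilon> (?F r) t \<partial>torus d) - (\<integral>t. ?l \<epsilon> f t \<partial>torus d)\<bar>
        \<le> ?J (?F r) f / \<epsilon>" if r: "0 \<le> r" "r < 1" for r
    proof -
      note br = bdd_riesz_dil[OF r psi(2)]
      note bdd_measurable[OF br, measurable]
      have ir: "integrable (torus d) (\<lambda>t. ?l \<epsilon> (?F r) t)"
      proof (rule Bochner_Integration.integrable_bound)
        show "integrable (torus d) (\<lambda>t. cmod (?F r t) / \<epsilon> + \<bar>ln \<epsilon>\<bar>)" using torus.bdd_int[OF br] by auto
        show "AE t in torus d. norm (?l \<epsilon> (?F r) t) \<le> norm (cmod (?F r t) / \<epsilon> + \<bar>ln \<epsilon>\<bar>)"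
          using lnle by (intro AE_I2) (metis real_norm_def order_trans abs_ge_self)
      qed measurable
      have "\<bar>(\<integral>t. ?l \<epsilon> (?F r) t - ?l \<epsilon> f t \<partial>torus d)\<bar>
        \<le> (\<integral>t. \<bar>?l \<epsilon> (?F r) t - ?l \<epsilon> f t\<bar> \<partial>torus d)" by (rule integral_abs_bound)
      also have "\<dots> \<le> (\<integral>t. cmod (?F r t - f t) / \<epsilon> \<partial>torus d)"
      proof (rule integral_mono)
        show "integrable (torus d) (\<lambda>t. \<bar>?l \<epsilon> (?F r) t - ?l \<epsilon> f t\<bar>)" using ir il by auto
        show "integrable (torus d) (\<lambda>t. cmod (?F r t - f t) / \<epsilon>)" using torus.bdd_int[OF br] f by auto
        show "\<bar>?l \<epsilon> (?F r) t - ?l \<epsilon> f t\<bar> \<le> cmod (?F r t - f t) / \<epsilon>" for t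
          by (rule order_trans[OF ln_lipschitz[OF eps]]) (use eps norm_triangle_ineq3 in \<open>auto intro!: divide_right_mono\<close>)
      qed
      finally show ?thesis using ir il by simp
    qed
    have "((\<lambda>r. ?J (?F r) f / \<epsilon>) \<longlongrightarrow> 0 / \<epsilon>) (at_left 1)"
      by (intro tendsto_divide lim tendsto_const) (use eps in auto)
    then have l0: "((\<lambda>r. ?J (?F r) f / \<epsilon>) \<longlongrightarrow> 0) (at_left 1)" by simp
    have ev: "\<forall>\<^sub>F r in at_left (1::real). 0 \<le> r \<and> r < 1"
      unfolding eventually_at_left_field by (rule exI[of _ 0]) auto
    have "((\<lambda>r. (\<integral>t. ?l \<epsilon> (?F r) t \<partial>torus d) - (\<integral>t. ?l \<epsilon> f t \<partial>torus d)) \<longlongrightarrow> 0) (at_left 1)"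
      by (rule Lim_null_comparison[OF _ l0]) (use ev near in \<open>auto elim!: eventually_mono\<close>)
    then have "((\<lambda>r. exp (\<integral>t. ?l \<epsilon> (?F r) t \<partial>torus d)) \<longlongrightarrow> exp (\<integral>t. ?l \<epsilon> f t \<partial>torus d)) (at_left 1)"
      by (intro tendsto_exp) (rule Lim_null[THEN iffD2])
    moreover have "\<forall>\<^sub>F r in at_left 1. exp (\<integral>t. ?l \<epsilon> (?F r) t \<partial>torus d) \<le> c + 2 * \<epsilon>"
      using ev by (rule eventually_mono) (use riesz_dil_geo[OF d _ _ psi(1) eps] in \<open>auto simp: c_def\<close>)
    ultimately have "exp (\<integral>t. ?l \<epsilon> f t \<partial>torus d) \<le> c + 2 * \<epsilon>"
      by (rule tendsto_upperbound) simp
    moreover have "(\<integral>t. ln (cmod (f t)) \<partial>torus d) \<le> (\<integral>t. ?l \<epsilon> f t \<partial>torus d)"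
      by (rule integral_mono_AE[OF 2(2) il], rule AE_mp[OF 2(1)], rule AE_I2, rule impI, subst ln_le_cancel_iff)
        (use eps in \<open>auto simp: add_pos_pos\<close>)
    ultimately show ?thesis by (meson exp_le_cancel_iff order_trans)
  qed
  note key = this
  have "exp (\<integral>t. ln (cmod (f t)) \<partial>torus d) \<le> c"
  proof (rule field_le_epsilon)
    fix e :: real assume "e > 0"
    then show "exp (\<integral>t. ln (cmod (f t)) \<partial>torus d) \<le> c + e"
      using key[of "e / 2"] by simp
  qed
  then show ?thesis by (simp add: geo_mean_eq[OF 2] c_def)
qed

lemma int_mean_1:
  assumes "integrable (torus d) f"
  shows "int_mean d 1 f = ennreal (\<integral>t. cmod (f t) \<partial>torus d)"
  using assms by (simp add: int_mean_def nn_integral_eq_integral)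

lemma qd_upper:
  assumes d: "d \<ge> 2" shows "qd d \<le> ereal (crit_exp d)"
proof -
  \<comment> \<open>Here \<open>d \<ge> 2\<close> enters: the critical exponent is at least 4/3, so
    the boundary function provided by the L^{4/3} theory exists.\<close>
  have Q: "4 / 3 \<le> crit_exp d"
  proof -
    have "2 powr (1 - real d) \<le> 2 powr (- 1)" using d by (intro powr_mono) auto
    also have "\<dots> = 1 / 2" by (simp add: powr_minus_divide)
    finally show ?thesis by (simp add: crit_exp_def add_pos_pos field_simps)
  qed
  have "riesz_bound d 0 \<psi> (Lq_norm d (crit_exp d) \<psi>)" if psi: "in_Lq d (crit_exp d) \<psi>" for \<psi>
  proof -
    have psi43: "in_Lq d (4/3) \<psi>" using in_Lq_mono[OF psi, of "4/3"] Q by simp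
    have i: "integrable (torus d) \<psi>" using in_Lq_mono[OF psi, of 1] Q by (simp add: in_Lq_1)
    obtain f where f: "integrable (torus d) f"
      "((\<lambda>r. \<integral>t. cmod (riesz_dil d \<psi> r t - f t) \<partial>torus d) \<longlongrightarrow> 0) (at_left 1)"
      using riesz_boundary[OF psi43] by blast
    have ir: "integrable (torus d) (riesz_dil d \<psi> r)" if "0 \<le> r" "r < 1" for r
      by (rule torus.bdd_int[OF bdd_riesz_dil[OF that i]])
    have ev: "\<forall>\<^sub>F r in at_left (1::real). 0 \<le> r \<and> r < 1"
      unfolding eventually_at_left_field by (rule exI[of _ 0]) auto
    have 1: "\<forall>r\<in>{0..<1}. int_mean d 1 (riesz_dil d \<psi> r) \<le> ennreal (2 ^ d * Lpnorm (torus d) (4/3) \<psi>)"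
      using riesz_dil_bounded[OF _ _ psi43] ir by (auto simp: int_mean_1 intro!: ennreal_leI)
    have "((\<lambda>r. ennreal (\<integral>t. cmod (riesz_dil d \<psi> r t - f t) \<partial>torus d)) \<longlongrightarrow> ennreal 0) (at_left 1)"
      by (rule tendsto_ennrealI[OF f(2)])
    moreover have "\<forall>\<^sub>F r in at_left 1. int_mean d 1 (\<lambda>t. riesz_dil d \<psi> r t - f t) = ennreal (\<integral>t. cmod (riesz_dil d \<psi> r t - f t) \<partial>torus d)"
      using ev by (rule eventually_mono) (use ir f(1) in \<open>auto intro!: int_mean_1\<close>)
    ultimately have 2: "((\<lambda>r. int_mean d 1 (\<lambda>t. riesz_dil d \<psi> r t - f t)) \<longlongrightarrow> 0) (at_left 1)"
      by (simp add: tendsto_cong)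
    have 3: "geo_mean d f \<le> Lq_norm d (crit_exp d) \<psi>"
      unfolding Lq_norm_eq[OF psi crit_exp_pos] by (rule riesz_geo_mean[OF _ psi i f]) (use d in simp)
    have "\<exists>s>0. \<exists>f. f \<in> borel_measurable (torus d) \<and>
              (\<exists>C. \<forall>r\<in>{0..<1}. int_mean d s (riesz_dil d \<psi> r) \<le> ennreal C) \<and>
              ((\<lambda>r. int_mean d s (\<lambda>t. riesz_dil d \<psi> r t - f t)) \<longlongrightarrow> 0) (at_left 1) \<and>
              geo_mean d f \<le> Lq_norm d (crit_exp d) \<psi>"
      by (intro exI[of _ "1::real"] exI[of _ f] exI[of _ "2 ^ d * Lpnorm (torus d) (4/3) \<psi>"] conjI 1 2 3
        borel_measurable_integrable[OF f(1)] zero_less_one)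
    then show ?thesis unfolding riesz_bound_def by simp
  qed
  then have "0 \<in> {p::real. p \<ge> 0 \<and> (\<forall>\<psi>. in_Lq d (crit_exp d) \<psi> \<longrightarrow> riesz_bound d p \<psi> (Lq_norm d (crit_exp d) \<psi>))}"
    by simp
  then have "pd d (crit_exp d) \<ge> 0"
    unfolding pd_def Let_def
    by (auto simp flip: zero_ereal_def intro!: Sup_upper2[of "ereal 0"])
  then show ?thesis unfolding qd_def using Q by (intro Inf_lower) auto
qed

section \<open>The lower bound\<close>

lemma riesz_dil_lin:
  assumes r: "0 \<le> r" "r < 1" and f: "bdd (torus d) f" and g: "bdd (torus d) g"
  shows "riesz_dil d (\<lambda>t. a * f t + g t) r t = a * riesz_dil d f r t + riesz_dil d g r t"
proof -
  have "bdd (torus d) (szego_prod d r t)"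
    by (rule bddI[OF measurable_szego_prod norm_szego_prod_le[OF r]])
  note b = torus.bdd_int[OF bdd_mult[OF this f]] torus.bdd_int[OF bdd_mult[OF this g]]
  have "riesz_dil d (\<lambda>t. a * f t + g t) r t = (\<integral>s. szego_prod d r t s * (a * f s + g s) \<partial>torus d)"
    by (intro riesz_dil_kernel[OF r] torus.bdd_int bdd_add bdd_mult bdd_const f g)
  also have "\<dots> = (\<integral>s. a * (szego_prod d r t s * f s) + szego_prod d r t s * g s \<partial>torus d)"
    by (rule Bochner_Integration.integral_cong) (auto simp: algebra_simps)
  also have "\<dots> = a * (\<integral>s. szego_prod d r t s * f s \<partial>torus d) + (\<integral>s. szego_prod d r t s * g s \<partial>torus d)"
    using b by simp
  finally show ?thesis by (simp only: riesz_dil_kernel[OF r torus.bdd_int[OF f]] riesz_dil_kernel[OF r torus.bdd_int[OF g]])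
qed

lemma riesz_dil_chr:
  assumes "\<alpha> \<in> multi_idx d"
  shows "riesz_dil d (chr d (int \<circ> \<alpha>)) r t = of_real (r ^ total_deg d \<alpha>) * chr d (int \<circ> \<alpha>) t"
proof -
  have "riesz_dil d (chr d (int \<circ> \<alpha>)) r t = (\<Sum>\<^sub>\<infinity>\<beta>\<in>{\<alpha>}. of_real (r ^ total_deg d \<alpha>) * chr d (int \<circ> \<alpha>) t)"
    unfolding riesz_dil_def
  proof (rule infsum_cong_neutral)
    show "fourier d (chr d (int \<circ> \<alpha>)) (int \<circ> \<beta>) * of_real (r ^ (\<Sum>j<d. \<beta> j)) * chr d (int \<circ> \<beta>) t = 0"
      if "\<beta> \<in> multi_idx d - {\<alpha>}" for \<beta>
      using that assms by (auto simp: fourier_def chr_orthonormal_multi_idx)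
  qed (use assms in \<open>auto simp: fourier_def chr_orthonormal_multi_idx total_deg_def\<close>)
  then show ?thesis by simp
qed

lemma riesz_dil_chr_neg:
  assumes "j < d" "\<beta> j < 0"
  shows "riesz_dil d (chr d \<beta>) r t = 0"
proof -
  have "fourier d (chr d \<beta>) (int \<circ> \<alpha>) = 0" for \<alpha>
    using assms unfolding fourier_def chr_orthonormal by (auto intro!: exI[of _ j])
  then show ?thesis by (simp add: riesz_dil_def)
qed

text \<open>Exponents of the monomials in the first two variables; an example on the two-dimensional
  torus thereby lives on every larger one.\<close>

definition idx_pair :: "'a::zero \<Rightarrow> 'a \<Rightarrow> nat \<Rightarrow> 'a" where
  "idx_pair m n j = (if j = 0 then m else if j = 1 then n else 0)"

lemma sum_idx_pair:
  fixes f :: "nat \<Rightarrow> 'b::comm_monoid_add"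
  assumes "d \<ge> 2" "\<And>j. j \<ge> 2 \<Longrightarrow> f j = 0"
  shows "(\<Sum>j<d. f j) = f 0 + f 1"
proof -
  have "(\<Sum>j<d. f j) = (\<Sum>j\<in>{0, 1}. f j)"
    using assms by (intro sum.mono_neutral_right) auto
  then show ?thesis by simp
qed

lemma chr_idx_pair: "d \<ge> 2 \<Longrightarrow> chr d (idx_pair m n) t = cis2pi (of_int m * t 0 + of_int n * t 1)"
  unfolding chr_def cis2pi_def by (subst sum_idx_pair) (auto simp: idx_pair_def)

lemma int_idx_pair: "int \<circ> idx_pair m n = idx_pair (int m) (int n)"
  by (auto simp: idx_pair_def)

lemma idx_pair_multi: "d \<ge> 2 \<Longrightarrow> idx_pair m n \<in> multi_idx d"
  by (auto simp: idx_pair_def multi_idx_def)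

lemma total_deg_idx_pair: "d \<ge> 2 \<Longrightarrow> total_deg d (idx_pair m n) = m + n"
  unfolding total_deg_def by (subst sum_idx_pair) (auto simp: idx_pair_def)

lemma riesz_dil_idx_pair:
  assumes d: "d \<ge> 2"
  shows "riesz_dil d (chr d (idx_pair (int m) (int n))) r t = of_real (r ^ (m + n)) * chr d (idx_pair (int m) (int n)) t"
  using riesz_dil_chr[OF idx_pair_multi[OF d, of m n], of r t] by (simp add: int_idx_pair total_deg_idx_pair[OF d])

text \<open>Jensen's formula without zeros: on the disc of radius 2 one has |c z| < 1, so Ln (1 + c
  z) is analytic there, and it vanishes at 0.\<close>

lemma ln_mean_zero:
  assumes c: "cmod c \<le> 1 / 2"
  shows "(\<integral>u. ln (cmod (1 + c * cis2pi u)) \<partial>circ) = 0"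
proof -
  have nz: "Re (1 + c * z) > 0" if "cmod z < 2" for z
  proof -
    have "cmod (c * z) < 1"
    proof (cases "c = 0")
      case False
      have "cmod c * cmod z < cmod c * 2" using that False by (intro mult_strict_left_mono) auto
      then show ?thesis using c by (simp add: norm_mult)
    qed simp
    then show ?thesis using abs_Re_le_cmod[of "c * z"] by (simp add: abs_le_iff)
  qed
  have h: "(\<lambda>z. Ln (1 + c * z)) holomorphic_on ball 0 2"
  proof (intro holomorphic_intros)
    fix z :: complex assume "z \<in> ball 0 2"
    then have "Re (1 + c * z) > 0" by (intro nz) simp
    then show "1 + c * z \<notin> \<real>\<^sub>\<le>\<^sub>0" by (auto simp: complex_nonpos_Reals_iff)
  qed
  have "(\<integral>u. Ln (1 + c * cis2pi u) \<partial>circ) = 0" using circle_mean[OF h] by simp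
  moreover have "bdd circ (\<lambda>u. Ln (1 + c * cis2pi u))"
    by (intro continuous_bdd_circ continuous_on_compose2[OF holomorphic_on_imp_continuous_on[OF h]] continuous_intros) auto
  ultimately have "(\<integral>u. Re (Ln (1 + c * cis2pi u)) \<partial>circ) = 0"
    by (subst integral_Re) (auto intro: bdd_circ_int)
  moreover have "Re (Ln (1 + c * cis2pi u)) = ln (cmod (1 + c * cis2pi u))" for u
  proof (rule Re_Ln)
    have "Re (1 + c * cis2pi u) > 0" by (rule nz) simp
    then show "1 + c * cis2pi u \<noteq> 0" by (metis less_irrefl zero_complex.sel(1))
  qed
  ultimately show ?thesis by simp
qed

lemma one_plus_bounds:
  assumes "cmod c \<le> 1 / 2" shows "1 / 2 \<le> cmod (1 + c * cis2pi u)" "cmod (1 + c * cis2pi u) \<le> 3 / 2"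
  using norm_triangle_ineq2[of 1 "- (c * cis2pi u)"] norm_triangle_ineq[of 1 "c * cis2pi u"] assms by (auto simp: norm_mult)

text \<open>With coordinate \<open>k\<close> frozen, averaging over coordinate \<open>j\<close> is
  the one-variable statement for \<open>c\<close> multiplied by a unimodular number.\<close>

lemma torus_ln_mean_zero:
  assumes c: "cmod c \<le> 1 / 2" and jk: "j < d" "k < d" "j \<noteq> k"
  shows "(\<integral>t. ln (cmod (1 + c * cis2pi (t j - t k))) \<partial>torus d) = 0"
    and "bdd (torus d) (\<lambda>t. ln (cmod (1 + c * cis2pi (t j - t k))))"
proof -
  have m: "(\<lambda>t. ln (cmod (1 + c * cis2pi (t j - t k)))) \<in> borel_measurable (torus d)"
    using jk by measurable
  show b: "bdd (torus d) (\<lambda>t. ln (cmod (1 + c * cis2pi (t j - t k))))"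
  proof (rule bddI[OF m])
    fix t
    have "ln (1 / 2) \<le> ln (cmod (1 + c * cis2pi (t j - t k)))" "ln (cmod (1 + c * cis2pi (t j - t k))) \<le> ln (3 / 2)"
      using one_plus_bounds[OF c, of "t j - t k"] by (intro ln_le_cancel_iff[THEN iffD2]; linarith)+
    then show "norm (ln (cmod (1 + c * cis2pi (t j - t k)))) \<le> max \<bar>ln (1 / 2)\<bar> \<bar>ln (3 / 2)\<bar>"
      by auto
  qed
  have "(\<integral>t. ln (cmod (1 + c * cis2pi (t j - t k))) \<partial>torus d) = (\<integral>t. (\<integral>u. ln (cmod (1 + (c * cis2pi (- t k)) * cis2pi u)) \<partial>circ) \<partial>torus d)"
    using torus_average[OF jk(1) b] jk(3) by (simp add: cis2pi_diff mult_ac)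
  also have "\<dots> = 0"
    by (subst ln_mean_zero) (use c in \<open>auto simp: norm_mult\<close>)
  finally show "(\<integral>t. ln (cmod (1 + c * cis2pi (t j - t k))) \<partial>torus d) = 0" .
qed

text \<open>Lagrange's remainder. For |t| \<le> 1/2 the third derivative is at most 2 * 8, from s (1
  - s) (2 - s) \<le> 2 and (1 + t)^{s-3} \<le> 2^3, and 16/6 \<le> 3.\<close>

lemma powr_taylor3:
  fixes s \<delta> :: real
  assumes s: "0 < s" "s < 1" and d: "\<bar>\<delta>\<bar> \<le> 1 / 2"
  shows "(1 + \<delta>) powr s \<le> 1 + s * \<delta> - s * (1 - s) / 2 * \<delta>\<^sup>2 + 3 * \<bar>\<delta>\<bar> ^ 3"
proof (cases "\<delta> = 0")
  case False
  define D where "D m x = (if m = 0 then (1 + x) powr s else if m = 1 then s * (1 + x) powr (s - 1)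
    else if m = 2 then s * (s - 1) * (1 + x) powr (s - 2) else s * (s - 1) * (s - 2) * (1 + x) powr (s - 3))" for m :: nat and x :: real
  have "\<exists>t. (if \<delta> < 0 then \<delta> < t \<and> t < 0 else 0 < t \<and> t < \<delta>) \<and>
    D 0 \<delta> = (\<Sum>m<3. D m 0 / fact m * (\<delta> - 0) ^ m) + D 3 t / fact 3 * (\<delta> - 0) ^ 3"
  proof (rule Taylor[where a="- (1 / 2)" and b="1 / 2"])
    show "\<forall>m t. m < 3 \<and> - (1 / 2) \<le> t \<and> t \<le> 1 / 2 \<longrightarrow> DERIV (D m) t :> D (Suc m) t"
    proof (intro allI impI)
      fix m :: nat and t :: real assume "m < 3 \<and> - (1 / 2) \<le> t \<and> t \<le> 1 / 2"
      then have t: "1 + t > 0" and "m = 0 \<or> m = 1 \<or> m = 2" by auto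
      moreover have "DERIV (\<lambda>x. (1 + x) powr a) t :> a * (1 + t) powr (a - 1)" for a :: real
        using t by (auto intro!: derivative_eq_intros)
      note der = this
      have "DERIV (\<lambda>x. (1 + x) powr s) t :> s * (1 + t) powr (s - 1)" by (rule der)
      moreover have "DERIV (\<lambda>x. s * (1 + x) powr (s - 1)) t :> s * ((s - 1) * (1 + t) powr (s - 1 - 1))"
        by (rule DERIV_cmult[OF der])
      moreover have "DERIV (\<lambda>x. s * (s - 1) * (1 + x) powr (s - 2)) t :> s * (s - 1) * ((s - 2) * (1 + t) powr (s - 2 - 1))"
        by (rule DERIV_cmult[OF der])
      ultimately show "DERIV (D m) t :> D (Suc m) t"
        by (auto simp: D_def[abs_def] mult.assoc)
    qed
  qed (use d False in auto)
  then obtain t where t0: "if \<delta> < 0 then \<delta> < t \<and> t < 0 else 0 < t \<and> t < \<delta>"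
    and eq: "D 0 \<delta> = (\<Sum>m<3. D m 0 / fact m * (\<delta> - 0) ^ m) + D 3 t / fact 3 * (\<delta> - 0) ^ 3"
    by blast
  have t: "\<bar>t\<bar> \<le> 1 / 2" using t0 d by (auto split: if_splits)
  have "(1 + \<delta>) powr s = 1 + s * \<delta> - s * (1 - s) / 2 * \<delta>\<^sup>2 + D 3 t / 6 * \<delta> ^ 3"
    using eq by (simp add: D_def eval_nat_numeral field_simps)
  also have "D 3 t / 6 * \<delta> ^ 3 \<le> 3 * \<bar>\<delta>\<bar> ^ 3"
  proof -
    have "(1 + t) powr (s - 3) \<le> (1 / 2) powr (s - 3)" using t s by (intro powr_mono2') auto
    also have "\<dots> = (2 powr (- 1)) powr (s - 3)" by (simp add: powr_minus_divide)
    also have "\<dots> = 2 powr (3 - s)" unfolding powr_powr by simp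
    also have "\<dots> \<le> 2 powr 3" using s by (intro powr_mono) auto
    finally have 1: "(1 + t) powr (s - 3) \<le> 8" by simp
    have "s * (1 - s) * (2 - s) \<le> 1 * 1 * 2" using s by (intro mult_mono) auto
    then have "s * (1 - s) * (2 - s) * (1 + t) powr (s - 3) \<le> 2 * 8"
      using 1 s by (intro mult_mono) auto
    moreover have "D 3 t = s * (1 - s) * (2 - s) * (1 + t) powr (s - 3)" by (simp add: D_def algebra_simps)
    ultimately have "D 3 t / 6 \<le> 3" "0 \<le> D 3 t / 6" using s by auto
    then have "D 3 t / 6 * \<bar>\<delta>\<bar> ^ 3 \<le> 3 * \<bar>\<delta>\<bar> ^ 3" by (intro mult_right_mono) auto
    moreover have "D 3 t / 6 * \<delta> ^ 3 \<le> D 3 t / 6 * \<bar>\<delta>\<bar> ^ 3"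
      using \<open>0 \<le> D 3 t / 6\<close> abs_ge_self[of "\<delta> ^ 3"] by (intro mult_left_mono) (auto simp: power_abs)
    ultimately show ?thesis by linarith
  qed
  finally show ?thesis by simp
qed simp

text \<open>1 + \<delta> is the squared modulus of the example below, with h = \<eta>^2. From
  |\<delta>| \<le> 15h the Taylor remainder is at most 3 * 15^3 h^3 = 10125 h^3; replacing
  \<delta>^2 by its leading term costs at most 54 h^3 more, and 10200 exceeds the sum. The bound on
  \<open>h\<close> ensures |\<delta>| \<le> 1/2.\<close>

lemma powr_pert:
  fixes x h s :: real
  assumes x: "\<bar>x\<bar> \<le> 1" and h: "0 < h" "h \<le> 1 / 30" and s: "0 < s" "s < 1"
  defines "\<delta> \<equiv> 6 * h * x + h\<^sup>2 * (1 - 2 * x)\<^sup>2"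
  shows "(1 + \<delta>) powr s \<le> 1 + s * (6 * h * x + h\<^sup>2 * (1 - 4 * x + 4 * x\<^sup>2)) - s * (1 - s) / 2 * (36 * h\<^sup>2 * x\<^sup>2) + 10200 * h ^ 3"
proof -
  have "\<bar>1 - 2 * x\<bar> \<le> \<bar>3\<bar>" using x by auto
  then have "(1 - 2 * x)\<^sup>2 \<le> 3\<^sup>2" by (simp only: abs_le_square_iff)
  then have sq: "0 \<le> (1 - 2 * x)\<^sup>2" "(1 - 2 * x)\<^sup>2 \<le> 9" by auto
  have h2: "h\<^sup>2 \<le> h" using h by (simp add: power2_eq_square mult_left_le)
  have "\<bar>\<delta>\<bar> \<le> \<bar>6 * h * x\<bar> + \<bar>h\<^sup>2 * (1 - 2 * x)\<^sup>2\<bar>" unfolding \<delta>_def by (rule abs_triangle_ineq)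
  also have "\<dots> \<le> 6 * h + 9 * h"
  proof (rule add_mono)
    show "\<bar>6 * h * x\<bar> \<le> 6 * h" using x h by (simp add: abs_mult mult_left_le)
    show "\<bar>h\<^sup>2 * (1 - 2 * x)\<^sup>2\<bar> \<le> 9 * h"
      using mult_mono[OF h2 sq(2)] h by (simp add: abs_mult)
  qed
  finally have d15: "\<bar>\<delta>\<bar> \<le> 15 * h" by simp
  then have "\<bar>\<delta>\<bar> \<le> 1 / 2" using h by simp
  note T = powr_taylor3[OF s this]
  have "\<bar>\<delta>\<bar> ^ 3 \<le> (15 * h) ^ 3" using d15 by (intro power_mono) auto
  then have 3: "3 * \<bar>\<delta>\<bar> ^ 3 \<le> 10125 * h ^ 3" by (simp add: power_mult_distrib)
  have "\<delta>\<^sup>2 = 36 * h\<^sup>2 * x\<^sup>2 + 12 * h ^ 3 * (x * (1 - 2 * x)\<^sup>2) + (h\<^sup>2 * (1 - 2 * x)\<^sup>2)\<^sup>2"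
    unfolding \<delta>_def by (simp add: power2_eq_square power3_eq_cube algebra_simps)
  moreover have "- 9 \<le> x * (1 - 2 * x)\<^sup>2"
  proof -
    have "\<bar>x\<bar> * (1 - 2 * x)\<^sup>2 \<le> 1 * 9" using x sq by (intro mult_mono) auto
    then have "\<bar>x * (1 - 2 * x)\<^sup>2\<bar> \<le> 9" by (simp add: abs_mult)
    then show ?thesis by linarith
  qed
  then have "12 * h ^ 3 * (- 9) \<le> 12 * h ^ 3 * (x * (1 - 2 * x)\<^sup>2)" using h by (intro mult_left_mono) auto
  moreover have "0 \<le> (h\<^sup>2 * (1 - 2 * x)\<^sup>2)\<^sup>2" by simp
  ultimately have d2: "36 * h\<^sup>2 * x\<^sup>2 - 108 * h ^ 3 \<le> \<delta>\<^sup>2" by linarith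
  define k where "k = s * (1 - s) / 2"
  have "s * (1 - s) \<le> 1 * 1" using s by (intro mult_mono) auto
  then have k: "0 \<le> k" "k \<le> 1 / 2" using s by (auto simp: k_def)
  have "k * (36 * h\<^sup>2 * x\<^sup>2 - 108 * h ^ 3) \<le> k * \<delta>\<^sup>2" by (rule mult_left_mono[OF d2 k(1)])
  moreover have "k * (108 * h ^ 3) \<le> 1 / 2 * (108 * h ^ 3)" using k h by (intro mult_right_mono) auto
  ultimately have "k * (36 * h\<^sup>2 * x\<^sup>2) - 54 * h ^ 3 \<le> k * \<delta>\<^sup>2" by (simp add: right_diff_distrib)
  moreover have "\<delta> = 6 * h * x + h\<^sup>2 * (1 - 4 * x + 4 * x\<^sup>2)"
    unfolding \<delta>_def by (simp add: power2_eq_square algebra_simps)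
  then have "s * \<delta> = s * (6 * h * x + h\<^sup>2 * (1 - 4 * x + 4 * x\<^sup>2))" by (rule arg_cong)
  moreover have "0 < h ^ 3" using h by simp
  ultimately show ?thesis using T 3 unfolding k_def[symmetric] by linarith
qed

section \<open>The example in the first two variables\<close>

context
  fixes d :: nat and \<eta> :: real
  assumes d: "d \<ge> 2" and eta: "0 < \<eta>" "\<eta> \<le> 1 / 2"
begin

text \<open>The factor i puts the terms of order \<eta> at right angles to the constant term, so
  they change the modulus only in order h = \<eta>^2. The last two monomials, each with a negative
  exponent, are invisible to the projection and serve to lower the norm. With coefficient c h in
  place of h, the h^2 term of the mean of |psi|^{2s} is s (1 + 2 c^2 - (1 - s) (1 + 2c)^2); at s =
  2/3 this is s (2/3) (1 - c)^2, so only c = 1 can work up to the exponent 4/3.\<close>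

definition counterex :: "(nat \<Rightarrow> real) \<Rightarrow> complex" where
  "counterex t = of_real (1 - \<eta>\<^sup>2) * chr d (idx_pair 1 1) t + (\<i> * of_real \<eta> * chr d (idx_pair 2 0) t +
    (\<i> * of_real \<eta> * chr d (idx_pair 0 2) t + (of_real (\<eta>\<^sup>2) * chr d (idx_pair 3 (- 1)) t + of_real (\<eta>\<^sup>2) * chr d (idx_pair (- 1) 3) t)))"

definition counterex_proj :: "(nat \<Rightarrow> real) \<Rightarrow> complex" where
  "counterex_proj t = of_real (1 - \<eta>\<^sup>2) * chr d (idx_pair 1 1) t + \<i> * of_real \<eta> * chr d (idx_pair 2 0) t + \<i> * of_real \<eta> * chr d (idx_pair 0 2) t"

lemma bdd_counterex: "bdd (torus d) counterex"
  unfolding counterex_def by (intro bdd_add bdd_mult bdd_const bdd_chr)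

lemma bdd_counterex_proj: "bdd (torus d) counterex_proj"
  unfolding counterex_proj_def by (intro bdd_add bdd_mult bdd_const bdd_chr)

lemma riesz_dil_counterex:
  assumes r: "0 \<le> r" "r < 1"
  shows "riesz_dil d counterex r t = of_real (r\<^sup>2) * counterex_proj t"
proof -
  have n1: "riesz_dil d (chr d (idx_pair 3 (- 1))) r t = 0"
    by (rule riesz_dil_chr_neg[of 1]) (use d in \<open>auto simp: idx_pair_def\<close>)
  have n2: "riesz_dil d (chr d (idx_pair (- 1) 3)) r t = 0"
    by (rule riesz_dil_chr_neg[of 0]) (use d in \<open>auto simp: idx_pair_def\<close>)
  have p: "riesz_dil d (chr d (idx_pair 1 1)) r t = of_real (r\<^sup>2) * chr d (idx_pair 1 1) t"
    "riesz_dil d (chr d (idx_pair 2 0)) r t = of_real (r\<^sup>2) * chr d (idx_pair 2 0) t"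
    "riesz_dil d (chr d (idx_pair 0 2)) r t = of_real (r\<^sup>2) * chr d (idx_pair 0 2) t"
    using riesz_dil_idx_pair[OF d, of 1 1 r t] riesz_dil_idx_pair[OF d, of 2 0 r t] riesz_dil_idx_pair[OF d, of 0 2 r t] by (simp_all add: power2_eq_square)
  have c: "riesz_dil d (\<lambda>t. a * chr d \<beta> t) r t = a * riesz_dil d (chr d \<beta>) r t" for a \<beta>
    using riesz_dil_lin[OF r bdd_chr bdd_const[of _ 0], of d a \<beta> t] by (simp add: riesz_dil_def fourier_def)
  show ?thesis
    unfolding counterex_def[abs_def]
    by (simp only: riesz_dil_lin[OF r] bdd_chr bdd_add bdd_mult bdd_const c n1 n2 p)
       (simp add: counterex_proj_def algebra_simps)
qed

text \<open>Up to a unimodular factor both functions depend on w = z1 / z2 alone. The product form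
  of the projection shows that it has no zeros and that its logarithm splits into two terms of mean
  zero.\<close>

lemma counterex_factor:
  fixes t :: "nat \<Rightarrow> real"
  defines "w \<equiv> cis2pi (t 0 - t 1)"
  shows "counterex t = cis2pi (t 0 + t 1) * (of_real (1 - \<eta>\<^sup>2) + \<i> * of_real \<eta> * (w + cnj w) + of_real (\<eta>\<^sup>2) * (w\<^sup>2 + (cnj w)\<^sup>2))"
    and "counterex_proj t = cis2pi (t 0 + t 1) * ((1 + \<i> * of_real \<eta> * w) * (1 + \<i> * of_real \<eta> * cnj w))"
proof -
  define e where "e = cis2pi (t 0 + t 1)"
  have w2: "w\<^sup>2 = cis2pi (2 * (t 0 - t 1))" "(cnj w)\<^sup>2 = cis2pi (2 * (t 1 - t 0))"
    unfolding w_def cnj_cis2pi using cis2pi_power[of 2 "t 0 - t 1"] cis2pi_power[of 2 "t 1 - t 0"] by auto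
  have X: "chr d (idx_pair 1 1) t = e" "chr d (idx_pair 2 0) t = e * w" "chr d (idx_pair 0 2) t = e * cnj w"
    "chr d (idx_pair 3 (- 1)) t = e * w\<^sup>2" "chr d (idx_pair (- 1) 3) t = e * (cnj w)\<^sup>2"
    unfolding chr_idx_pair[OF d] w2 unfolding e_def w_def cnj_cis2pi cis2pi_add[symmetric] by (auto intro!: arg_cong[where f=cis2pi])
  show "counterex t = cis2pi (t 0 + t 1) * (of_real (1 - \<eta>\<^sup>2) + \<i> * of_real \<eta> * (w + cnj w) + of_real (\<eta>\<^sup>2) * (w\<^sup>2 + (cnj w)\<^sup>2))"
    unfolding counterex_def X e_def[symmetric] by (simp add: algebra_simps)
  have "w * cnj w = 1" using complex_norm_square[of w] by (simp add: w_def)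
  then have "(1 + \<i> * of_real \<eta> * w) * (1 + \<i> * of_real \<eta> * cnj w) = 1 + \<i> * of_real \<eta> * (w + cnj w) - (of_real \<eta>)\<^sup>2"
    by (simp add: algebra_simps power2_eq_square)
  then show "counterex_proj t = cis2pi (t 0 + t 1) * ((1 + \<i> * of_real \<eta> * w) * (1 + \<i> * of_real \<eta> * cnj w))"
    unfolding counterex_proj_def X e_def[symmetric] by (simp add: algebra_simps)
qed

lemma norm_counterex_proj: "cmod (counterex_proj t) = cmod (1 + \<i> * of_real \<eta> * cis2pi (t 0 - t 1)) * cmod (1 + \<i> * of_real \<eta> * cis2pi (t 1 - t 0))"
  unfolding counterex_factor(2) cnj_cis2pi norm_mult by simp

lemma ce: "cmod (\<i> * of_real \<eta>) \<le> 1 / 2"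
  using eta by (simp add: norm_mult)

lemma norm_counterex_proj_pos: "cmod (counterex_proj t) > 0"
  unfolding norm_counterex_proj using one_plus_bounds(1)[OF ce, of "t 0 - t 1"] one_plus_bounds(1)[OF ce, of "t 1 - t 0"]
  by (intro mult_pos_pos) linarith+

lemma ln_counterex_proj: "ln (cmod (counterex_proj t)) = ln (cmod (1 + \<i> * of_real \<eta> * cis2pi (t 0 - t 1))) + ln (cmod (1 + \<i> * of_real \<eta> * cis2pi (t 1 - t 0)))"
  unfolding norm_counterex_proj using one_plus_bounds(1)[OF ce, of "t 0 - t 1"] one_plus_bounds(1)[OF ce, of "t 1 - t 0"]
  by (intro ln_mult_pos) linarith+

lemma counterex_proj_ln_mean:
  "(\<integral>t. ln (cmod (counterex_proj t)) \<partial>torus d) = 0" "integrable (torus d) (\<lambda>t. ln (cmod (counterex_proj t)))"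
proof -
  have j: "0 < d" "1 < d" "(0::nat) \<noteq> 1" "(1::nat) \<noteq> 0" using d by auto
  note a = torus_ln_mean_zero[OF ce j(1,2,3)] and b = torus_ln_mean_zero[OF ce j(2,1,4)]
  show "integrable (torus d) (\<lambda>t. ln (cmod (counterex_proj t)))"
    unfolding ln_counterex_proj by (intro torus.bdd_int bdd_add a(2) b(2))
  show "(\<integral>t. ln (cmod (counterex_proj t)) \<partial>torus d) = 0"
    unfolding ln_counterex_proj using a(1) b(1) torus.bdd_int[OF a(2)] torus.bdd_int[OF b(2)] by simp
qed

lemma norm_counterex:
  fixes t :: "nat \<Rightarrow> real"
  defines "x \<equiv> Re (cis2pi (2 * (t 0 - t 1)))"
  shows "(cmod (counterex t))\<^sup>2 = 1 + (6 * \<eta>\<^sup>2 * x + (\<eta>\<^sup>2)\<^sup>2 * (1 - 2 * x)\<^sup>2)"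
proof -
  define w where "w = cis2pi (t 0 - t 1)"
  define a where "a = Re w"
  have nw: "(Re w)\<^sup>2 + (Im w)\<^sup>2 = 1" using norm_cis2pi[of "t 0 - t 1"] unfolding w_def[symmetric] by (simp add: cmod_def)
  have xw: "x = Re (w\<^sup>2)" unfolding x_def w_def using cis2pi_power[of 2 "t 0 - t 1"] by simp
  then have x: "x = 2 * a\<^sup>2 - 1" using nw by (simp add: a_def power2_eq_square)
  have ww: "w + cnj w = of_real (2 * a)" by (simp add: a_def complex_eq_iff)
  have ww2: "w\<^sup>2 + (cnj w)\<^sup>2 = of_real (2 * x)" using complex_add_cnj[of "w\<^sup>2"] xw by simp
  have "cmod (counterex t) = cmod (of_real (1 - \<eta>\<^sup>2) + \<i> * of_real \<eta> * of_real (2 * a) + of_real (\<eta>\<^sup>2) * of_real (2 * x))"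
    unfolding counterex_factor(1) norm_mult norm_cis2pi w_def[symmetric] ww ww2 by simp
  also have "of_real (1 - \<eta>\<^sup>2) + \<i> * of_real \<eta> * of_real (2 * a) + of_real (\<eta>\<^sup>2) * of_real (2 * x) = Complex (1 - \<eta>\<^sup>2 + 2 * \<eta>\<^sup>2 * x) (2 * \<eta> * a)"
    by (simp add: complex_eq_iff)
  finally have "(cmod (counterex t))\<^sup>2 = (1 - \<eta>\<^sup>2 + 2 * \<eta>\<^sup>2 * x)\<^sup>2 + (2 * \<eta> * a)\<^sup>2" by (simp add: cmod_power2)
  also have "(2 * \<eta> * a)\<^sup>2 = 2 * \<eta>\<^sup>2 * (1 + x)" unfolding x by (simp add: power2_eq_square)
  finally show ?thesis by (simp add: power2_eq_square algebra_simps)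
qed

text \<open>\<open>x\<close> has mean 0 and its square has mean 1/2. The term of order h therefore
  vanishes, and the coefficient of h^2 is s + 2s - 9s (1 - s) = - s (6 - 9s).\<close>

lemma counterex_mean_powr:
  assumes h: "\<eta>\<^sup>2 \<le> 1 / 30" and s: "0 < s" "s < 1"
  shows "(\<integral>t. cmod (counterex t) powr (2 * s) \<partial>torus d) \<le> 1 - s * (6 - 9 * s) * (\<eta>\<^sup>2)\<^sup>2 + 10200 * (\<eta>\<^sup>2) ^ 3"
proof -
  define x where "x t = Re (cis2pi (2 * (t 0 - t 1)))" for t :: "nat \<Rightarrow> real"
  define h where "h = \<eta>\<^sup>2"
  have h: "0 < h" "h \<le> 1 / 30" using eta assms(1) by (auto simp: h_def)
  have x_chr: "x t = Re (chr d (idx_pair 2 (- 2)) t)" for t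
    unfolding chr_idx_pair[OF d] x_def by (simp add: algebra_simps)
  have x2_chr: "(x t)\<^sup>2 = 1 / 2 + 1 / 2 * Re (chr d (idx_pair 4 (- 4)) t)" for t
  proof -
    define v where "v = cis2pi (2 * (t 0 - t 1))"
    have nv: "(Re v)\<^sup>2 + (Im v)\<^sup>2 = 1" using norm_cis2pi[of "2 * (t 0 - t 1)"] unfolding v_def[symmetric] by (simp add: cmod_def)
    have "v\<^sup>2 = cis2pi (2 * (2 * (t 0 - t 1)))" unfolding v_def using cis2pi_power[of 2 "2 * (t 0 - t 1)"] by simp
    then have "chr d (idx_pair 4 (- 4)) t = v\<^sup>2" unfolding chr_idx_pair[OF d] by (simp add: algebra_simps)
    then show ?thesis using nv unfolding x_def v_def[symmetric] by (simp add: power2_eq_square field_simps)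
  qed
  have bx: "bdd (torus d) x" unfolding x_chr[abs_def] by (intro bdd_Re bdd_chr)
  have Rechr: "(\<integral>t. Re (chr d (idx_pair m (- m)) t) \<partial>torus d) = 0" if "m \<noteq> 0" for m
    using that d by (subst integral_Re[OF torus.bdd_int[OF bdd_chr]]) (auto simp: integral_chr idx_pair_def)
  have Ix: "(\<integral>t. x t \<partial>torus d) = 0" unfolding x_chr using Rechr[of 2] by simp
  have Ix2: "(\<integral>t. (x t)\<^sup>2 \<partial>torus d) = 1 / 2"
    unfolding x2_chr using Rechr[of 4] torus.bdd_int[OF bdd_Re[OF bdd_chr[of d "idx_pair 4 (- 4)"]]]
    by (simp add: torus.prob_space)
  have b: "bdd (torus d) (\<lambda>t. cmod (counterex t) powr (2 * s))" by (rule bdd_powr[OF bdd_counterex]) (use s in simp)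
  note ix = torus.bdd_int[OF bx] torus.bdd_int[OF bdd_power2[OF bx, of 2]]
  let ?P = "\<lambda>x. (1 + s * h\<^sup>2 + 10200 * h ^ 3) + (s * 6 * h - 4 * s * h\<^sup>2) * x + (4 * s * h\<^sup>2 - s * (1 - s) / 2 * 36 * h\<^sup>2) * x\<^sup>2"
  have "(\<integral>t. cmod (counterex t) powr (2 * s) \<partial>torus d) \<le>
    (\<integral>t. ?P (x t) \<partial>torus d)"
  proof (rule integral_mono)
    show "integrable (torus d) (\<lambda>t. cmod (counterex t) powr (2 * s))" by (rule torus.bdd_int[OF b])
    show "integrable (torus d) (\<lambda>t. ?P (x t))"
      by (intro torus.bdd_int bdd_add bdd_mult bdd_const bx bdd_power2)
    fix t
    have "cmod (counterex t) powr (2 * s) = ((cmod (counterex t))\<^sup>2) powr s"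
      by (simp add: powr_powr flip: powr_numeral)
    also have "\<dots> = (1 + (6 * h * x t + h\<^sup>2 * (1 - 2 * x t)\<^sup>2)) powr s"
      unfolding norm_counterex by (simp add: x_def h_def)
    also have "\<dots> \<le> 1 + s * (6 * h * x t + h\<^sup>2 * (1 - 4 * x t + 4 * (x t)\<^sup>2)) - s * (1 - s) / 2 * (36 * h\<^sup>2 * (x t)\<^sup>2) + 10200 * h ^ 3"
      by (rule powr_pert[OF _ h s]) (use abs_Re_le_cmod[of "cis2pi (2 * (t 0 - t 1))"] in \<open>simp add: x_def\<close>)
    finally show "cmod (counterex t) powr (2 * s) \<le> ?P (x t)"
      by (simp add: algebra_simps)
  qed
  also have "\<dots> = (1 + s * h\<^sup>2 + 10200 * h ^ 3) + (s * 6 * h - 4 * s * h\<^sup>2) * 0 + (4 * s * h\<^sup>2 - s * (1 - s) / 2 * 36 * h\<^sup>2) * (1 / 2)"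
    using ix by (simp add: Ix Ix2 torus.prob_space)
  also have "\<dots> = 1 - s * (6 - 9 * s) * h\<^sup>2 + 10200 * h ^ 3" by (simp add: field_simps)
  finally show ?thesis by (simp add: h_def)
qed

text \<open>Integrating e^v \<ge> 1 + v for v = p ln |\<open>counterex_proj\<close>|, whose mean is
  0.\<close>

lemma counterex_mean_p:
  assumes "p > 0" shows "1 \<le> (\<integral>t. cmod (counterex_proj t) powr p \<partial>torus d)"
proof -
  have "(\<integral>t. 1 + p * ln (cmod (counterex_proj t)) \<partial>torus d) \<le> (\<integral>t. cmod (counterex_proj t) powr p \<partial>torus d)"
  proof (rule integral_mono)
    show "integrable (torus d) (\<lambda>t. 1 + p * ln (cmod (counterex_proj t)))" using counterex_proj_ln_mean(2) by simp
    show "integrable (torus d) (\<lambda>t. cmod (counterex_proj t) powr p)"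
      by (rule torus.bdd_int[OF bdd_powr[OF bdd_counterex_proj]]) (use assms in simp)
    show "1 + p * ln (cmod (counterex_proj t)) \<le> cmod (counterex_proj t) powr p" for t
      using norm_counterex_proj_pos[of t] exp_ge_add_one_self[of "p * ln (cmod (counterex_proj t))"] by (simp add: powr_def)
  qed
  then show ?thesis using counterex_proj_ln_mean by (simp add: torus.prob_space)
qed

lemma counterex_not_bounded:
  assumes c: "0 \<le> c" "c < 1" and p: "p \<ge> 0"
  shows "\<not> riesz_bound d p counterex c"
proof
  assume rb: "riesz_bound d p counterex c"
  show False
  proof (cases "p > 0")
    case True
    \<comment> \<open>Dilation multiplies the projection by \<open>r\<^sup>2\<close>, which is
      chosen strictly between \<open>c\<close> and 1.\<close>
    define r where "r = sqrt ((1 + c) / 2)"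
    have r: "0 \<le> r" "r < 1" and r2: "r\<^sup>2 = (1 + c) / 2" using c by (auto simp: r_def)
    have "int_mean d p (riesz_dil d counterex r) \<le> ennreal (c powr p)" using rb True r by (simp add: riesz_bound_def)
    moreover have "int_mean d p (riesz_dil d counterex r) = ennreal (\<integral>t. (r\<^sup>2) powr p * cmod (counterex_proj t) powr p \<partial>torus d)"
    proof -
      have "cmod (riesz_dil d counterex r t) powr p = (r\<^sup>2) powr p * cmod (counterex_proj t) powr p" for t
        by (simp add: riesz_dil_counterex[OF r] norm_mult norm_power powr_mult)
      then show ?thesis unfolding int_mean_def
        by (subst nn_integral_eq_integral[symmetric])
           (use p in \<open>auto intro!: torus.bdd_int bdd_mult bdd_powr bdd_counterex_proj\<close>)
    qed
    ultimately have "ennreal (\<integral>t. (r\<^sup>2) powr p * cmod (counterex_proj t) powr p \<partial>torus d) \<le> ennreal (c powr p)" by simp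
    then have "(r\<^sup>2) powr p * (\<integral>t. cmod (counterex_proj t) powr p \<partial>torus d) \<le> c powr p" by (simp add: ennreal_le_iff)
    moreover have "(r\<^sup>2) powr p * 1 \<le> (r\<^sup>2) powr p * (\<integral>t. cmod (counterex_proj t) powr p \<partial>torus d)"
      by (intro mult_left_mono counterex_mean_p True) simp
    ultimately have "(r\<^sup>2) powr p \<le> c powr p" by simp
    moreover have "c powr p < (r\<^sup>2) powr p" unfolding r2 using c True by (intro powr_less_mono2) auto
    ultimately show False by simp
  next
    case False
    have ibc: "integrable (torus d) counterex" by (rule torus.bdd_int[OF bdd_counterex])
    \<comment> \<open>The trivial alternative in the definition is refuted by the value of one
      dilation at one point.\<close>
    have "\<not> (\<forall>\<alpha>\<in>multi_idx d. fourier d counterex (int \<circ> \<alpha>) = 0)"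
    proof
      assume "\<forall>\<alpha>\<in>multi_idx d. fourier d counterex (int \<circ> \<alpha>) = 0"
      then have "riesz_dil d counterex (1/2) (\<lambda>_. 0) = 0" unfolding riesz_dil_def by (intro infsum_0) simp
      then show False using riesz_dil_counterex[of "1/2" "\<lambda>_. 0"] norm_counterex_proj_pos[of "\<lambda>_. 0"] by simp
    qed
    then obtain s f where s: "s > 0" and f[measurable]: "f \<in> borel_measurable (torus d)"
      and lim: "((\<lambda>r. int_mean d s (\<lambda>t. riesz_dil d counterex r t - f t)) \<longlongrightarrow> 0) (at_left 1)"
      and gm: "geo_mean d f \<le> c"
      using rb False unfolding riesz_bound_def by auto
    note bdd_measurable[OF bdd_counterex_proj, measurable]
    have ev: "\<forall>\<^sub>F r in at_left (1::real). 0 \<le> r \<and> r < 1"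
      unfolding eventually_at_left_field by (rule exI[of _ 0]) auto
    define I where "I = (\<integral>t. cmod (counterex_proj t) powr s \<partial>torus d)"
    have I: "(\<integral>\<^sup>+t. ennreal (cmod (counterex_proj t) powr s) \<partial>torus d) = ennreal I"
      unfolding I_def by (rule nn_integral_eq_integral) (use s in \<open>auto intro!: torus.bdd_int bdd_powr bdd_counterex_proj\<close>)
    \<comment> \<open>The definition supplies only some limit \<open>f\<close> in some L^s. Letting
      \<open>r\<close> tend to 1 in this estimate identifies \<open>f\<close> with
      \<open>counterex_proj\<close> almost everywhere.\<close>
    have est: "int_mean d s (\<lambda>t. counterex_proj t - f t) \<le> ennreal (2 powr s) * (ennreal ((1 - r\<^sup>2) powr s * I) + int_mean d s (\<lambda>t. riesz_dil d counterex r t - f t))"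
      if r: "0 \<le> r" "r < 1" for r
    proof -
      \<comment> \<open>A substitute for the triangle inequality that covers every
        \<open>s > 0\<close>, since \<open>s\<close> may lie on either side of 1.\<close>
      have ab: "(a + b) powr s \<le> 2 powr s * (a powr s + b powr s)" if "0 \<le> a" "0 \<le> b" for a b :: real
      proof -
        have "(a + b) powr s \<le> (2 * max a b) powr s" using that s by (intro powr_mono2) auto
        also have "\<dots> = 2 powr s * (max a b) powr s" using that by (simp add: powr_mult)
        also have "(max a b) powr s \<le> a powr s + b powr s" by (auto simp: max_def)
        finally show ?thesis by (simp add: mult_left_mono)
      qed
      have r2: "r\<^sup>2 \<le> 1" using r by (simp add: abs_square_le_1)
      have "cmod (counterex_proj t - f t) powr s \<le> 2 powr s * ((1 - r\<^sup>2) powr s * cmod (counterex_proj t) powr s + cmod (riesz_dil d counterex r t - f t) powr s)" for t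
      proof -
        have "counterex_proj t - f t = of_real (1 - r\<^sup>2) * counterex_proj t + (riesz_dil d counterex r t - f t)"
          by (simp add: riesz_dil_counterex[OF r] algebra_simps)
        then have "cmod (counterex_proj t - f t) \<le> cmod (of_real (1 - r\<^sup>2) * counterex_proj t) + cmod (riesz_dil d counterex r t - f t)"
          by (metis norm_triangle_ineq)
        also have "cmod (of_real (1 - r\<^sup>2) * counterex_proj t) = (1 - r\<^sup>2) * cmod (counterex_proj t)"
          unfolding norm_mult norm_of_real using r2 by simp
        finally have "cmod (counterex_proj t - f t) powr s \<le> ((1 - r\<^sup>2) * cmod (counterex_proj t) + cmod (riesz_dil d counterex r t - f t)) powr s"
          using s by (intro powr_mono2) auto
        also have "\<dots> \<le> 2 powr s * (((1 - r\<^sup>2) * cmod (counterex_proj t)) powr s + cmod (riesz_dil d counterex r t - f t) powr s)"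
          using r2 by (intro ab) auto
        finally show ?thesis using r2 by (simp add: powr_mult)
      qed
      then have "int_mean d s (\<lambda>t. counterex_proj t - f t) \<le> (\<integral>\<^sup>+t. ennreal (2 powr s) * (ennreal ((1 - r\<^sup>2) powr s) * ennreal (cmod (counterex_proj t) powr s) + ennreal (cmod (riesz_dil d counterex r t - f t) powr s)) \<partial>torus d)"
        unfolding int_mean_def by (intro nn_integral_mono) (simp add: ennreal_leI flip: ennreal_mult ennreal_plus)
      also have "\<dots> = ennreal (2 powr s) * (ennreal ((1 - r\<^sup>2) powr s) * ennreal I + int_mean d s (\<lambda>t. riesz_dil d counterex r t - f t))"
      proof -
        note bdd_measurable[OF bdd_riesz_dil[OF r ibc], measurable]
        show ?thesis unfolding int_mean_def I[symmetric]
          by (subst nn_integral_cmult, measurable, subst nn_integral_add, measurable, subst nn_integral_cmult, measurable)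
      qed
      also have "ennreal ((1 - r\<^sup>2) powr s) * ennreal I = ennreal ((1 - r\<^sup>2) powr s * I)"
        by (simp add: ennreal_mult I_def integral_nonneg_AE)
      finally show ?thesis .
    qed
    have "((\<lambda>r. (1 - r\<^sup>2) powr s * I) \<longlongrightarrow> (1 - 1\<^sup>2) powr s * I) (at_left (1::real))"
    proof (intro tendsto_mult tendsto_const tendsto_powr2 tendsto_diff tendsto_power tendsto_ident_at)
      show "\<forall>\<^sub>F r in at_left (1::real). 0 \<le> 1 - r\<^sup>2"
        using ev by (rule eventually_mono) (simp add: abs_square_le_1)
    qed (use s in auto)
    then have "((\<lambda>r. (1 - r\<^sup>2) powr s * I) \<longlongrightarrow> 0) (at_left (1::real))" by simp
    then have "((\<lambda>r. ennreal ((1 - r\<^sup>2) powr s * I)) \<longlongrightarrow> ennreal 0) (at_left (1::real))"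
      by (rule tendsto_ennrealI)
    then have "((\<lambda>r. ennreal (2 powr s) * (ennreal ((1 - r\<^sup>2) powr s * I) + int_mean d s (\<lambda>t. riesz_dil d counterex r t - f t))) \<longlongrightarrow> ennreal (2 powr s) * (ennreal 0 + 0)) (at_left 1)"
      by (intro ennreal_tendsto_cmult tendsto_add lim) auto
    then have "int_mean d s (\<lambda>t. counterex_proj t - f t) \<le> ennreal (2 powr s) * (ennreal 0 + 0)"
      by (rule tendsto_lowerbound) (use ev est in \<open>auto elim!: eventually_mono\<close>)
    then have "(\<integral>\<^sup>+t. ennreal (cmod (counterex_proj t - f t) powr s) \<partial>torus d) = 0" by (simp add: int_mean_def)
    then have "AE t in torus d. ennreal (cmod (counterex_proj t - f t) powr s) = 0"
      by (subst (asm) nn_integral_0_iff_AE) auto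
    then have eq: "AE t in torus d. f t = counterex_proj t" by (rule AE_mp) (auto simp: powr_eq_0_iff ennreal_eq_0_iff)
    have nz: "AE t in torus d. f t \<noteq> 0" using eq by (rule AE_mp) (use norm_counterex_proj_pos in fastforce)
    have lneq: "AE t in torus d. ln (cmod (f t)) = ln (cmod (counterex_proj t))" using eq by (rule AE_mp) auto
    have int: "integrable (torus d) (\<lambda>t. ln (cmod (f t)))"
      by (subst integrable_cong_AE[OF _ _ lneq]) (use counterex_proj_ln_mean(2) in auto)
    have "(\<integral>t. ln (cmod (f t)) \<partial>torus d) = (\<integral>t. ln (cmod (counterex_proj t)) \<partial>torus d)"
      by (rule integral_cong_AE[OF _ _ lneq]) auto
    then have "geo_mean d f = 1" unfolding geo_mean_eq[OF nz int] by (simp add: counterex_proj_ln_mean)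
    then show False using gm c by simp
  qed
qed

end

lemma pd_negative:
  assumes d: "d \<ge> 2" and q: "1 \<le> q" "q < 4 / 3"
  shows "pd d q = -1"
proof -
  define s where "s = q / 2"
  have s: "0 < s" "s < 1" "1 / 2 \<le> s" "9 * s < 6" using q by (auto simp: s_def)
  \<comment> \<open>Chosen so that the gain s (6 - 9s) h^2 becomes 30000 s h^3. Since q \<ge> 1
    means s \<ge> 1/2, this is at least 15000 h^3 and beats the error 10200 h^3.\<close>
  define h where "h = (6 - 9 * s) / 30000"
  have h: "0 < h" "h \<le> 1 / 30" "h \<le> 1 / 4" using s by (auto simp: h_def)
  define \<eta> where "\<eta> = sqrt h"
  have h2: "\<eta>\<^sup>2 = h" using h by (simp add: \<eta>_def)
  have "sqrt h \<le> sqrt ((1 / 2)\<^sup>2)" using h by (intro real_sqrt_le_mono) (simp add: power2_eq_square)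
  then have eta: "0 < \<eta>" "\<eta> \<le> 1 / 2" using h by (auto simp: \<eta>_def)
  let ?psi = "counterex d \<eta>"
  have b: "bdd (torus d) ?psi" by (rule bdd_counterex[OF d eta])
  have L: "in_Lq d q ?psi" using q b by (auto simp: in_Lq_iff intro!: torus.bdd_int bdd_powr bdd_measurable)
  have "(\<integral>t. cmod (?psi t) powr q \<partial>torus d) < 1"
  proof -
    have "(\<integral>t. cmod (?psi t) powr q \<partial>torus d) \<le> 1 - s * (6 - 9 * s) * h\<^sup>2 + 10200 * h ^ 3"
      using counterex_mean_powr[OF d eta _ s(1,2)] h by (simp add: h2 s_def)
    also have "s * (6 - 9 * s) = s * (30000 * h)" by (simp add: h_def)
    also have "1 - s * (30000 * h) * h\<^sup>2 + 10200 * h ^ 3 = 1 - (30000 * s - 10200) * h ^ 3"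
      by (simp add: power2_eq_square power3_eq_cube algebra_simps)
    also have "\<dots> < 1" using s h by simp
    finally show ?thesis .
  qed
  then have "Lpnorm (torus d) q ?psi < 1 powr (1 / q)"
    unfolding Lpnorm_def using q by (intro powr_less_mono2) (auto intro!: integral_nonneg_AE)
  then have c: "0 \<le> Lq_norm d q ?psi" "Lq_norm d q ?psi < 1"
    using Lq_norm_eq[OF L] q by (auto simp: Lpnorm_nonneg)
  have "{p::real. p \<ge> 0 \<and> (\<forall>\<psi>. in_Lq d q \<psi> \<longrightarrow> riesz_bound d p \<psi> (Lq_norm d q \<psi>))} = {}"
    using counterex_not_bounded[OF d eta c] L by blast
  then show ?thesis by (simp add: pd_def)
qed

theorem theorem11:
  fixes d :: nat
  assumes "d \<ge> 2"
  shows "ereal (4/3) \<le> qd d \<and> qd d \<le> ereal (2 / (1 + 2 powr (1 - real d)))"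
proof
  show "ereal (4/3) \<le> qd d"
    unfolding qd_def
  proof (rule Inf_greatest)
    fix z assume "z \<in> {ereal q |q. q \<ge> 1 \<and> pd d q \<ge> 0}"
    then obtain q where q: "z = ereal q" "q \<ge> 1" "pd d q \<ge> 0" by blast
    have "\<not> q < 4 / 3" using pd_negative[OF assms q(2)] q(3) by auto
    then show "ereal (4/3) \<le> z" using q(1) by simp
  qed
  show "qd d \<le> ereal (2 / (1 + 2 powr (1 - real d)))"
    using qd_upper[OF assms] by (simp add: crit_exp_def)
qed

end
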